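(* Let $\alpha$ be an ordinal. (1) If all games on $\{0,1\}$ of length $\omega+\alpha$ with ordinal definable payoff set are determined, then all games on $\{0,1\}$ of length $\alpha$ whose payoff set is ordinal definable from the real numbers are determined. (2) If all games on $\{0,1\}$ of length $\omega\cdot\alpha$ with ordinal definable payoff set are determined, then all games on $\{0,1\}$ of length $\alpha$ whose payoff set is ordinal definable from the real numbers are determined.
   Context: We work in ZFC. Real numbers are identified with subsets of $\omega$. Here $\omega+\alpha$ and $\omega\cdot\alpha$ denote ordinal addition and ordinal multiplication ($\omega\cdot\alpha$ is $\alpha$ consecutive copies of $\omega$). Games: a game is given by an ordinal $\theta$ (its length), a nonempty set $S$ (the move set; one says the game is "on $S$"), and a payoff set $A$ of sequences of moves. It is a perfect information game of two players who move in turns, and at limit ordinals the first player moves (so the first player makes the moves with index $\lambda+2n$ and the second player those with index $\lambda+2n+1$, for $\lambda$ zero or a limit ordinal and $n<\omega$). Each move consists of picking an element of $S$. A position is the sequence of moves made so far at a point before the game ends. The game ends once the sequence of moves has length $\theta$; this sequence is the play. The first player wins if the play belongs to $A$; otherwise the second player wins. A strategy for a player is a mapping that assigns a valid move to every position at which it is that player's turn. A strategy is winning if the player wins whenever he follows it, regardless of the choices of the other player. A game is determined if one of the players has a winning strategy, and undetermined otherwise. A set is ordinal definable if there is an ordinal $\lambda$ such that the set is definable in $V_\lambda$ by a first-order formula with ordinal parameters. A set is ordinal definable from the real numbers if it is ordinal definable in this sense with real numbers allowed as additional parameters. *)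

theory Defs
  imports Main
begin

text \<open>
  ``Working in ZFC'' is rendered as working in an arbitrary model of first-order ZFC: a type whose
  elements are the sets, where \<open>x \<in> elts y\<close> is the membership relation of the model. The model may be
  ill-founded or non-standard from the outside, so ordinals, functions, strategies, formulas and
  satisfaction are all taken in the sense of the model.
\<close>

class membership =
  fixes elts :: "'a \<Rightarrow> 'a set"

text \<open>Formulas of the meta-language, used only to state the two axiom schemas.\<close>

datatype fm = FMem nat nat | FEq nat nat | FNot fm | FAnd fm fm | FAll nat fm

primrec holds :: "fm \<Rightarrow> (nat \<Rightarrow> 'v::membership) \<Rightarrow> bool" where
  "holds (FMem i j) e \<longleftrightarrow> e i \<in> elts (e j)"
| "holds (FEq i j) e \<longleftrightarrow> e i = e j"
| "holds (FNot \<phi>) e \<longleftrightarrow> \<not> holds \<phi> e"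
| "holds (FAnd \<phi> \<psi>) e \<longleftrightarrow> holds \<phi> e \<and> holds \<psi> e"
| "holds (FAll i \<phi>) e \<longleftrightarrow> (\<forall>x. holds \<phi> (e(i := x)))"

class zfc = membership +
  assumes extensionality: "elts x = elts y \<Longrightarrow> x = y"
    and foundation: "elts x \<noteq> {} \<Longrightarrow> \<exists>y\<in>elts x. elts y \<inter> elts x = {}"
    and pairing: "\<exists>z. elts z = {x, y}"
    and union: "\<exists>z. elts z = (\<Union>y\<in>elts x. elts y)"
    and powerset: "\<exists>z. elts z = {y. elts y \<subseteq> elts x}"
    and infinity: "\<exists>x. (\<exists>y\<in>elts x. elts y = {}) \<and>
          (\<forall>y\<in>elts x. \<exists>z\<in>elts x. elts z = insert y (elts y))"
    and separation: "\<exists>z. elts z = {y \<in> elts x. holds \<phi> (e(0 := y))}"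
    and replacement: "(\<forall>y\<in>elts x. \<exists>!z. holds \<phi> (e(0 := y, 1 := z))) \<Longrightarrow>
          \<exists>w. elts w = {z. \<exists>y\<in>elts x. holds \<phi> (e(0 := y, 1 := z))}"
    and choice: "(\<forall>y\<in>elts x. elts y \<noteq> {}) \<Longrightarrow>
          (\<forall>y\<in>elts x. \<forall>z\<in>elts x. y \<noteq> z \<longrightarrow> elts y \<inter> elts z = {}) \<Longrightarrow>
          \<exists>c. \<forall>y\<in>elts x. \<exists>!u. u \<in> elts c \<and> u \<in> elts y"

text \<open>
  \<open>mkset X\<close> is only meaningful when some set of the model has exactly the elements \<open>X\<close>; below it is
  applied only where ZFC proves this.
\<close>

definition mkset :: "'v::membership set \<Rightarrow> 'v" where
  "mkset X = (THE z. elts z = X)"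

definition vempty :: "'v::membership" where
  "vempty = mkset {}"

definition vsucc :: "'v::membership \<Rightarrow> 'v" where
  "vsucc x = mkset (insert x (elts x))"

primrec vnat :: "nat \<Rightarrow> 'v::membership" where
  "vnat 0 = vempty"
| "vnat (Suc n) = vsucc (vnat n)"

definition vpow :: "'v::membership \<Rightarrow> 'v" where
  "vpow x = mkset {y. elts y \<subseteq> elts x}"

definition upair :: "'v::membership \<Rightarrow> 'v \<Rightarrow> 'v" where
  "upair x y = mkset {x, y}"

definition opair :: "'v::membership \<Rightarrow> 'v \<Rightarrow> 'v" where
  "opair x y = upair (upair x x) (upair x y)"


section \<open>Functions\<close>

definition is_fun :: "'v::membership \<Rightarrow> 'v \<Rightarrow> 'v \<Rightarrow> bool" where
  "is_fun f A B \<longleftrightarrow>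
     (\<forall>z\<in>elts f. \<exists>x\<in>elts A. \<exists>y\<in>elts B. z = opair x y) \<and>
     (\<forall>x\<in>elts A. \<exists>!y. opair x y \<in> elts f)"

definition app :: "'v::membership \<Rightarrow> 'v \<Rightarrow> 'v" where
  "app f x = (THE y. opair x y \<in> elts f)"

definition restr :: "'v::membership \<Rightarrow> 'v \<Rightarrow> 'v" where
  "restr f A = mkset {z \<in> elts f. \<exists>x\<in>elts A. \<exists>y. z = opair x y}"

definition upd :: "'v::membership \<Rightarrow> 'v \<Rightarrow> 'v \<Rightarrow> 'v" where
  "upd f i x = mkset (insert (opair i x) {z \<in> elts f. \<forall>y. z \<noteq> opair i y})"


section \<open>Ordinals\<close>

text \<open>Well-foundedness of membership is the axiom of foundation.\<close>

definition ordinal :: "'v::membership \<Rightarrow> bool" where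
  "ordinal x \<longleftrightarrow>
     (\<forall>y\<in>elts x. elts y \<subseteq> elts x) \<and>
     (\<forall>y\<in>elts x. \<forall>z\<in>elts x. y \<in> elts z \<or> y = z \<or> z \<in> elts y)"

definition limit_ordinal :: "'v::membership \<Rightarrow> bool" where
  "limit_ordinal x \<longleftrightarrow> ordinal x \<and> x \<noteq> vempty \<and> (\<forall>y. x \<noteq> vsucc y)"

definition omega :: "'v::membership" where
  "omega = mkset {n. \<forall>I. vempty \<in> elts I \<and> (\<forall>y\<in>elts I. vsucc y \<in> elts I) \<longrightarrow> n \<in> elts I}"

text \<open>
  The value at the ordinal \<open>\<beta>\<close> of the transfinite recursion that starts at \<open>a\<close>, applies \<open>s\<close> at
  successors and takes unions at limits.
\<close>

definition ord_iter :: "('v::membership \<Rightarrow> 'v) \<Rightarrow> 'v \<Rightarrow> 'v \<Rightarrow> 'v" where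
  "ord_iter s a \<beta> = (THE x. \<exists>f B. is_fun f (vsucc \<beta>) B \<and>
     app f vempty = a \<and>
     (\<forall>\<gamma>\<in>elts \<beta>. app f (vsucc \<gamma>) = s (app f \<gamma>)) \<and>
     (\<forall>\<gamma>\<in>elts (vsucc \<beta>). limit_ordinal \<gamma> \<longrightarrow>
        elts (app f \<gamma>) = (\<Union>\<delta>\<in>elts \<gamma>. elts (app f \<delta>))) \<and>
     x = app f \<beta>)"

definition ord_add :: "'v::membership \<Rightarrow> 'v \<Rightarrow> 'v" where
  "ord_add \<alpha> \<beta> = ord_iter vsucc \<alpha> \<beta>"

definition ord_mult :: "'v::membership \<Rightarrow> 'v \<Rightarrow> 'v" where
  "ord_mult \<alpha> \<beta> = ord_iter (\<lambda>x. ord_add x \<alpha>) vempty \<beta>"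

definition Vlevel :: "'v::membership \<Rightarrow> 'v" where
  "Vlevel \<mu> = ord_iter vpow vempty \<mu>"


section \<open>Games\<close>

definition first_turn :: "'v::membership \<Rightarrow> bool" where
  "first_turn \<beta> \<longleftrightarrow> (\<exists>\<mu> n. (\<mu> = vempty \<or> limit_ordinal \<mu>) \<and> n \<in> elts omega \<and>
     \<beta> = ord_add \<mu> (ord_mult (vnat 2) n))"

definition second_turn :: "'v::membership \<Rightarrow> bool" where
  "second_turn \<beta> \<longleftrightarrow> (\<exists>\<mu> n. (\<mu> = vempty \<or> limit_ordinal \<mu>) \<and> n \<in> elts omega \<and>
     \<beta> = vsucc (ord_add \<mu> (ord_mult (vnat 2) n)))"

text \<open>
  A game of length \<open>\<theta>\<close> on \<open>S\<close> with payoff set \<open>A\<close>. A predicate \<open>turn\<close> on the indices of moves tells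
  when the player in question moves; the position before the move with index \<open>\<beta>\<close> is a function
  from \<open>\<beta>\<close> to \<open>S\<close>.
\<close>

definition payoff_set :: "'v::membership \<Rightarrow> 'v \<Rightarrow> 'v \<Rightarrow> bool" where
  "payoff_set \<theta> S A \<longleftrightarrow> (\<forall>x\<in>elts A. is_fun x \<theta> S)"

definition positions :: "('v::membership \<Rightarrow> bool) \<Rightarrow> 'v \<Rightarrow> 'v \<Rightarrow> 'v" where
  "positions turn \<theta> S = mkset {p. \<exists>\<beta>\<in>elts \<theta>. turn \<beta> \<and> is_fun p \<beta> S}"

definition strategy :: "('v::membership \<Rightarrow> bool) \<Rightarrow> 'v \<Rightarrow> 'v \<Rightarrow> 'v \<Rightarrow> bool" where
  "strategy turn \<theta> S \<sigma> \<longleftrightarrow> is_fun \<sigma> (positions turn \<theta> S) S"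

definition follows :: "('v::membership \<Rightarrow> bool) \<Rightarrow> 'v \<Rightarrow> 'v \<Rightarrow> 'v \<Rightarrow> bool" where
  "follows turn \<theta> \<sigma> x \<longleftrightarrow> (\<forall>\<beta>\<in>elts \<theta>. turn \<beta> \<longrightarrow> app x \<beta> = app \<sigma> (restr x \<beta>))"

definition first_wins :: "'v::membership \<Rightarrow> 'v \<Rightarrow> 'v \<Rightarrow> bool" where
  "first_wins \<theta> S A \<longleftrightarrow> (\<exists>\<sigma>. strategy first_turn \<theta> S \<sigma> \<and>
     (\<forall>x. is_fun x \<theta> S \<longrightarrow> follows first_turn \<theta> \<sigma> x \<longrightarrow> x \<in> elts A))"

definition second_wins :: "'v::membership \<Rightarrow> 'v \<Rightarrow> 'v \<Rightarrow> bool" where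
  "second_wins \<theta> S A \<longleftrightarrow> (\<exists>\<sigma>. strategy second_turn \<theta> S \<sigma> \<and>
     (\<forall>x. is_fun x \<theta> S \<longrightarrow> follows second_turn \<theta> \<sigma> x \<longrightarrow> x \<notin> elts A))"

definition determined :: "'v::membership \<Rightarrow> 'v \<Rightarrow> 'v \<Rightarrow> bool" where
  "determined \<theta> S A \<longleftrightarrow> first_wins \<theta> S A \<or> second_wins \<theta> S A"


section \<open>Definability\<close>

text \<open>
  First-order formulas as sets of the model, with variables indexed by \<open>omega\<close>. (A non-standard model
  has more formulas than those of type \<^typ>\<open>fm\<close>.)
\<close>

definition mem_code :: "'v::membership \<Rightarrow> 'v \<Rightarrow> 'v" where
  "mem_code i j = opair (vnat 0) (opair i j)"

definition eq_code :: "'v::membership \<Rightarrow> 'v \<Rightarrow> 'v" where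
  "eq_code i j = opair (vnat 1) (opair i j)"

definition not_code :: "'v::membership \<Rightarrow> 'v" where
  "not_code p = opair (vnat 2) p"

definition and_code :: "'v::membership \<Rightarrow> 'v \<Rightarrow> 'v" where
  "and_code p q = opair (vnat 3) (opair p q)"

definition all_code :: "'v::membership \<Rightarrow> 'v \<Rightarrow> 'v" where
  "all_code i p = opair (vnat 4) (opair i p)"

definition formula :: "'v::membership \<Rightarrow> bool" where
  "formula p \<longleftrightarrow> (\<forall>X.
     (\<forall>i\<in>elts omega. \<forall>j\<in>elts omega. mem_code i j \<in> elts X \<and> eq_code i j \<in> elts X) \<and>
     (\<forall>q\<in>elts X. not_code q \<in> elts X) \<and>
     (\<forall>q\<in>elts X. \<forall>r\<in>elts X. and_code q r \<in> elts X) \<and>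
     (\<forall>i\<in>elts omega. \<forall>q\<in>elts X. all_code i q \<in> elts X)
     \<longrightarrow> p \<in> elts X)"

text \<open>
  \<open>truth_set M T\<close>: the set \<open>T\<close> obeys Tarski's clauses for the structure \<open>(M, \<in>)\<close> on pairs of a formula
  and an assignment of elements of \<open>M\<close> to all variables. Such a \<open>T\<close> exists and is determined on
  these pairs.
\<close>

definition truth_set :: "'v::membership \<Rightarrow> 'v \<Rightarrow> bool" where
  "truth_set M T \<longleftrightarrow> (\<forall>a. is_fun a omega M \<longrightarrow>
     (\<forall>i\<in>elts omega. \<forall>j\<in>elts omega.
        (opair (mem_code i j) a \<in> elts T \<longleftrightarrow> app a i \<in> elts (app a j)) \<and>
        (opair (eq_code i j) a \<in> elts T \<longleftrightarrow> app a i = app a j)) \<and>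
     (\<forall>p. formula p \<longrightarrow>
        (opair (not_code p) a \<in> elts T \<longleftrightarrow> opair p a \<notin> elts T)) \<and>
     (\<forall>p q. formula p \<longrightarrow> formula q \<longrightarrow>
        (opair (and_code p q) a \<in> elts T \<longleftrightarrow> opair p a \<in> elts T \<and> opair q a \<in> elts T)) \<and>
     (\<forall>i\<in>elts omega. \<forall>p. formula p \<longrightarrow>
        (opair (all_code i p) a \<in> elts T \<longleftrightarrow>
          (\<forall>x\<in>elts M. opair p (upd a i x) \<in> elts T))))"

definition satisfies :: "'v::membership \<Rightarrow> 'v \<Rightarrow> 'v \<Rightarrow> bool" where
  "satisfies M p a \<longleftrightarrow> (\<exists>T. truth_set M T \<and> opair p a \<in> elts T)"

text \<open>
  \<open>A\<close> is the subset of some level of the cumulative hierarchy defined over that level by a formula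
  with finitely many parameters, each of which satisfies \<open>P\<close>. The defined element is the value of
  the variable 0; the parameters are the values of the other variables, and these are 0 from
  some index on.
\<close>

definition definable_from :: "('v::membership \<Rightarrow> bool) \<Rightarrow> 'v \<Rightarrow> bool" where
  "definable_from P A \<longleftrightarrow> (\<exists>\<mu> p a n. ordinal \<mu> \<and> formula p \<and>
     is_fun a omega (Vlevel \<mu>) \<and>
     (\<forall>i\<in>elts omega. P (app a i)) \<and>
     n \<in> elts omega \<and> (\<forall>i\<in>elts omega. i \<notin> elts n \<longrightarrow> app a i = vempty) \<and>
     elts A = {x \<in> elts (Vlevel \<mu>). satisfies (Vlevel \<mu>) p (upd a vempty x)})"

definition real_number :: "'v::membership \<Rightarrow> bool" where
  "real_number x \<longleftrightarrow> elts x \<subseteq> elts omega"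

definition ordinal_definable :: "'v::membership \<Rightarrow> bool" where
  "ordinal_definable A \<longleftrightarrow> definable_from ordinal A"

definition ordinal_definable_from_reals :: "'v::membership \<Rightarrow> bool" where
  "ordinal_definable_from_reals A \<longleftrightarrow> definable_from (\<lambda>x. ordinal x \<or> real_number x) A"

end

theory Submission
  imports Defs
begin

text \<open>
  Suppose the game \<open>A\<close> of length \<open>\<alpha>\<close>, defined from ordinals and finitely many reals, is undetermined.
  Consider the longer game in which the first player plays the real parameters in the first \<open>\<omega>\<close>
  rounds, must choose them such that he has no winning strategy in the game they define, and wins if
  the remaining play is won in that game. It is ordinal definable. A winning strategy for him would,
  for the reals that it plays against constantly 0, win the game they define; one for the second
  player would win \<open>A\<close>. Since limit moves belong to the first player, turns do not change when a
  game starts at \<open>\<omega>\<close>. For (2), \<open>\<omega> + \<alpha> \<le> \<omega> \<cdot> \<alpha>\<close> unless \<open>\<alpha>\<close> is 0 or 1, and superfluous moves are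
  ignored.

  The definition of the new payoff set is made inside a level of the hierarchy that reflects it. The
  possibly non-standard formula and parameter sequence of \<open>A\<close> are first shown to be definable
  there, by induction in the model.
\<close>


section \<open>Sets of the model\<close>

text \<open>The clause that the first player must choose reals for which he has no winning strategy
  is what lets the payoff set forget the actual reals. Without it he could choose reals that make
  the rest easy; with it, a winning strategy of his in the long game refutes itself, while the
  actual parameters remain an admissible choice because \<open>A\<close> is undetermined. The second
  player has no influence on the reals, so he must in particular be able to beat the actual ones.

  The obstacle is that nothing in the model may be treated as finite from outside.
  \<open>omega\<close>, the formula defining \<open>A\<close> and the number \<open>n\<close> of its
  parameters may be non-standard, and separation and replacement apply only to classes given by a
  first-order formula with parameters. Hence recursions and inductions over sets of the model take
  place inside it and carry a definability obligation, discharged along the syntax by the rules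
  \<open>dint\<close>. For the same reason the formula of \<open>A\<close> cannot be written out in
  the definition of the new payoff set; it enters as an object, which has to be eliminated again
  because only ordinals may serve as parameters.\<close>

lemma v_eqI: "(\<And>z. z \<in> elts x \<longleftrightarrow> z \<in> elts y) \<Longrightarrow> x = (y::'v::zfc)"
  by (rule extensionality) auto

lemma v_eq_iff: "x = y \<longleftrightarrow> (\<forall>z. z \<in> elts x \<longleftrightarrow> z \<in> elts (y::'v::zfc))"
  by (metis v_eqI)

definition small :: "'v::membership set \<Rightarrow> bool" where
  "small X \<longleftrightarrow> (\<exists>z. elts z = X)"

lemma small_elts [simp]: "small (elts x)"
  unfolding small_def by blast

lemma elts_mkset: "small X \<Longrightarrow> elts (mkset X :: 'v::zfc) = X"
proof -
  assume "small X"
  then obtain z :: 'v where z: "elts z = X" unfolding small_def by blast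
  then have "mkset X = z" unfolding mkset_def by (intro the_equality extensionality) simp_all
  with z show ?thesis by simp
qed

lemma small_empty [simp]: "small ({} :: 'v::zfc set)"
proof -
  obtain I :: 'v where "\<exists>y\<in>elts I. elts y = {}" using infinity by blast
  then show ?thesis unfolding small_def by blast
qed

lemma small_pair [simp]: "small {x, y::'v::zfc}"
  unfolding small_def by (rule pairing)

lemma small_UN_elts: "small (\<Union>y\<in>elts x. elts (y::'v::zfc))"
  unfolding small_def by (rule union)

lemma small_Un [simp]: "small (X :: 'v::zfc set) \<Longrightarrow> small Y \<Longrightarrow> small (X \<union> Y)"
  using small_UN_elts[of "mkset {mkset X, mkset Y}"] by (simp add: elts_mkset)

lemma small_insert [simp]: "small X \<Longrightarrow> small (insert (x::'v::zfc) X)"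
  using small_Un[OF small_pair[of x x]] by simp

lemma small_Pow: "small {y. elts y \<subseteq> elts (x::'v::zfc)}"
  unfolding small_def by (rule powerset)

lemma elts_vempty [simp]: "elts (vempty :: 'v::zfc) = {}"
  unfolding vempty_def by (simp add: elts_mkset)

lemma elts_upair [simp]: "elts (upair x y :: 'v::zfc) = {x, y}"
  unfolding upair_def by (simp add: elts_mkset)

lemma elts_vsucc [simp]: "elts (vsucc x :: 'v::zfc) = insert x (elts x)"
  unfolding vsucc_def by (simp add: elts_mkset)

lemma elts_vpow [simp]: "elts (vpow x :: 'v::zfc) = {y. elts y \<subseteq> elts x}"
  unfolding vpow_def by (simp add: elts_mkset small_Pow)

lemma elts_eq_empty: "elts x = {} \<longleftrightarrow> x = (vempty::'v::zfc)"
  using extensionality[of x vempty] by auto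

lemma upair_eq_iff: "upair a b = upair c d \<longleftrightarrow> a = c \<and> b = d \<or> a = d \<and> b = (c::'v::zfc)"
proof -
  have "upair a b = upair c d \<longleftrightarrow> elts (upair a b) = elts (upair c d)"
    by (metis extensionality)
  then show ?thesis by (simp add: doubleton_eq_iff)
qed

lemma opair_eq_iff [simp]: "opair a b = opair c d \<longleftrightarrow> a = c \<and> b = (d::'v::zfc)"
  unfolding opair_def upair_eq_iff by metis

lemma mem_irrefl [simp]: "x \<notin> elts (x::'v::zfc)"
  using foundation[of "upair x x"] by simp

lemma mem_asym: "x \<in> elts y \<Longrightarrow> y \<notin> elts (x::'v::zfc)"
  using foundation[of "upair x y"] by auto

lemma vsucc_neq_vempty [simp]: "vsucc x \<noteq> (vempty::'v::zfc)" "vempty \<noteq> vsucc x"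
proof -
  show "vsucc x \<noteq> vempty"
  proof
    assume "vsucc x = vempty"
    then have "elts (vsucc x) = elts vempty" by (rule arg_cong)
    then show False by simp
  qed
  from this[symmetric] show "vempty \<noteq> vsucc x" .
qed

lemma vsucc_inject [simp]: "vsucc x = vsucc y \<longleftrightarrow> x = (y::'v::zfc)"
proof
  assume eq: "vsucc x = vsucc y"
  have "x \<in> elts (vsucc y)" unfolding eq[symmetric] by simp
  moreover have "y \<in> elts (vsucc x)" unfolding eq by simp
  ultimately show "x = y" using mem_asym[of x y] by auto
qed simp

definition vUnion :: "'v::membership \<Rightarrow> 'v" where
  "vUnion x = mkset (\<Union>y\<in>elts x. elts y)"

lemma elts_vUnion [simp]: "elts (vUnion x :: 'v::zfc) = (\<Union>y\<in>elts x. elts y)"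
  unfolding vUnion_def by (simp add: elts_mkset small_UN_elts)

definition vun :: "'v::membership \<Rightarrow> 'v \<Rightarrow> 'v" where
  "vun x y = mkset (elts x \<union> elts y)"

lemma elts_vun [simp]: "elts (vun x y :: 'v::zfc) = elts x \<union> elts y"
  unfolding vun_def by (simp add: elts_mkset)


section \<open>Definable predicates and operations\<close>

primrec ren :: "(nat \<Rightarrow> nat) \<Rightarrow> fm \<Rightarrow> fm" where
  "ren r (FMem i j) = FMem (r i) (r j)"
| "ren r (FEq i j) = FEq (r i) (r j)"
| "ren r (FNot \<phi>) = FNot (ren r \<phi>)"
| "ren r (FAnd \<phi> \<psi>) = FAnd (ren r \<phi>) (ren r \<psi>)"
| "ren r (FAll i \<phi>) = FAll (r i) (ren r \<phi>)"

text \<open>Bound variables are renamed together with the free ones; injectivity prevents capture,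
  since an update at \<open>r k\<close> then changes no other renamed variable.\<close>

lemma holds_ren: "inj r \<Longrightarrow> holds (ren r \<phi>) e \<longleftrightarrow> holds \<phi> (\<lambda>i. e (r i))"
proof (induction \<phi> arbitrary: e)
  case (FAll k \<phi>)
  have "(\<lambda>i. (e(r k := x)) (r i)) = (\<lambda>i. e (r i))(k := x)" for x
    using FAll.prems by (auto simp: fun_eq_iff inj_eq)
  with FAll show ?case by simp
qed auto

text \<open>A formula of the meta-language is a finite object. The bound yields a fresh variable for
  quantification in \<open>dfn_all\<close>, and in the reflection theorem it reduces an infinite
  environment to finitely many values.\<close>

lemma holds_fresh: "\<exists>N. \<forall>e e' :: nat \<Rightarrow> 'v::membership. (\<forall>i<N. e i = e' i) \<longrightarrow> holds \<phi> e = holds \<phi> e'"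
proof (induction \<phi>)
  case (FMem i j)
  show ?case by (rule exI[of _ "Suc (max i j)"]) simp
next
  case (FEq i j)
  show ?case by (rule exI[of _ "Suc (max i j)"]) simp
next
  case (FNot \<phi>)
  then show ?case by simp
next
  case (FAnd \<phi> \<psi>)
  obtain M where M: "\<And>e e' :: nat \<Rightarrow> 'v. (\<forall>i<M. e i = e' i) \<Longrightarrow> holds \<phi> e = holds \<phi> e'" using FAnd(1) by metis
  obtain N where N: "\<And>e e' :: nat \<Rightarrow> 'v. (\<forall>i<N. e i = e' i) \<Longrightarrow> holds \<psi> e = holds \<psi> e'" using FAnd(2) by metis
  have "holds (FAnd \<phi> \<psi>) e = holds (FAnd \<phi> \<psi>) e'" if "\<forall>i<max M N. e i = e' i" for e e' :: "nat \<Rightarrow> 'v"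
    using M[of e e'] N[of e e'] that by simp
  then show ?case by metis
next
  case (FAll k \<phi>)
  obtain N where N: "\<And>e e' :: nat \<Rightarrow> 'v. (\<forall>i<N. e i = e' i) \<Longrightarrow> holds \<phi> e = holds \<phi> e'" using FAll by metis
  have "holds (FAll k \<phi>) e = holds (FAll k \<phi>) e'" if "\<forall>i<N. e i = e' i" for e e' :: "nat \<Rightarrow> 'v"
  proof -
    have "holds \<phi> (e(k := x)) = holds \<phi> (e'(k := x))" for x
      using that by (intro N) simp
    then show ?thesis by simp
  qed
  then show ?case by metis
qed

definition padd :: "nat \<Rightarrow> (nat \<Rightarrow> 'v) \<Rightarrow> (nat \<Rightarrow> 'v) \<Rightarrow> nat \<Rightarrow> 'v" where
  "padd n c e = (\<lambda>i. if i < n then c i else e (i - n))"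

abbreviation sh :: "(nat \<Rightarrow> 'v) \<Rightarrow> nat \<Rightarrow> 'v" where
  "sh e \<equiv> \<lambda>i. e (Suc i)"

text \<open>
  The argument of \<open>Q\<close> is an environment for free variables in de Bruijn style, so that the rules below
  decompose a definability goal along the syntax of the predicate; \<open>P\<close> is the set of permitted
  parameters (lightface \<open>{}\<close>, boldface \<open>UNIV\<close>).
\<close>

definition dfn :: "'v::membership set \<Rightarrow> ((nat \<Rightarrow> 'v) \<Rightarrow> bool) \<Rightarrow> bool" where
  "dfn P Q \<longleftrightarrow> (\<exists>\<phi> n c. (\<forall>i<n. c i \<in> P) \<and> (\<forall>e. holds \<phi> (padd n c e) \<longleftrightarrow> Q e))"

definition dterm :: "'v::membership set \<Rightarrow> ((nat \<Rightarrow> 'v) \<Rightarrow> 'v) \<Rightarrow> bool" where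
  "dterm P t \<longleftrightarrow> dfn P (\<lambda>e. e 0 = t (sh e))"

named_theorems dint

lemma dfn_holds: "dfn P (holds \<phi>)"
  unfolding dfn_def padd_def by (intro exI[of _ \<phi>] exI[of _ 0]) simp

lemma dfn_empty: "dfn {} Q \<longleftrightarrow> (\<exists>\<phi>. \<forall>e. holds \<phi> e \<longleftrightarrow> Q e)"
proof
  assume "dfn {} Q"
  then obtain \<phi> n c where *: "\<forall>i<n. c i \<in> {}" "\<forall>e. holds \<phi> (padd n c e) \<longleftrightarrow> Q e"
    unfolding dfn_def by blast
  then have "n = 0" by auto
  with * show "\<exists>\<phi>. \<forall>e. holds \<phi> e \<longleftrightarrow> Q e" unfolding padd_def by auto
next
  assume "\<exists>\<phi>. \<forall>e. holds \<phi> e \<longleftrightarrow> Q e"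
  then obtain \<phi> where "holds \<phi> = Q" by blast
  then show "dfn {} Q" using dfn_holds by blast
qed

lemma dfn_cong: "dfn P Q \<Longrightarrow> (\<And>e. Q e = R e) \<Longrightarrow> dfn P R"
  unfolding dfn_def by simp

lemma dfn_mem_var: "dfn P (\<lambda>e. e i \<in> elts (e j))"
  by (rule dfn_cong[OF dfn_holds[of P "FMem i j"]]) simp

lemma dfn_eq_var: "dfn P (\<lambda>e. e i = e j)"
  by (rule dfn_cong[OF dfn_holds[of P "FEq i j"]]) simp

lemma dfn_ren:
  assumes "dfn P Q" "inj r"
  shows "dfn P (\<lambda>e. Q (\<lambda>i. e (r i)))"
proof -
  obtain \<phi> n c where *: "\<forall>i<n. c i \<in> P" "\<forall>e. holds \<phi> (padd n c e) \<longleftrightarrow> Q e"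
    using assms(1) unfolding dfn_def by blast
  define s where "s i = (if i < n then i else r (i - n) + n)" for i
  have "inj s"
  proof (rule injI)
    fix i j assume "s i = s j"
    then have "i < n \<and> i = j \<or> \<not> i < n \<and> \<not> j < n \<and> r (i - n) = r (j - n)"
      unfolding s_def by (auto split: if_splits)
    then show "i = j" unfolding inj_eq[OF assms(2)] by linarith
  qed
  moreover have "(\<lambda>i. padd n c e (s i)) = padd n c (\<lambda>i. e (r i))" for e
    unfolding padd_def s_def by auto
  ultimately show ?thesis using * unfolding dfn_def
    by (intro exI[of _ "ren s \<phi>"] exI[of _ n] exI[of _ c]) (simp add: holds_ren)
qed

section \<open>Closure of definability under connectives and quantifiers\<close>

lemma dfn_not [dint]:
  assumes "dfn P Q" shows "dfn P (\<lambda>e. \<not> Q e)"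
proof -
  obtain \<phi> n c where *: "\<forall>i<n. c i \<in> P" "\<forall>e. holds \<phi> (padd n c e) \<longleftrightarrow> Q e"
    using assms(1) unfolding dfn_def by blast
  then show ?thesis unfolding dfn_def
    by (intro exI[of _ "FNot \<phi>"] exI[of _ n] exI[of _ c]) simp
qed

lemma dfn_conj [dint]:
  assumes "dfn P Q" "dfn P R" shows "dfn P (\<lambda>e. Q e \<and> R e)"
proof -
  obtain \<phi> n c where 1: "\<forall>i<n. c i \<in> P" "\<forall>e. holds \<phi> (padd n c e) \<longleftrightarrow> Q e"
    using assms(1) unfolding dfn_def by blast
  obtain \<psi> m d where 2: "\<forall>i<m. d i \<in> P" "\<forall>e. holds \<psi> (padd m d e) \<longleftrightarrow> R e"
    using assms(2) unfolding dfn_def by blast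
  \<comment> \<open>The parameter lists are concatenated: \<open>r\<close> moves the free variables
    of the first formula past the parameters of the second, and \<open>s\<close> moves the whole
    second formula past the parameters of the first.\<close>
  define r where "r i = (if i < n then i else i + m)" for i
  define s where "s i = i + n" for i
  define b where "b i = (if i < n then c i else d (i - n))" for i
  have "inj r" "inj s" unfolding r_def s_def by (auto simp: inj_def split: if_splits)
  moreover have "(\<lambda>i. padd (n + m) b e (r i)) = padd n c e" for e
    unfolding padd_def r_def b_def by (rule ext) (auto split: if_splits)
  moreover have "(\<lambda>i. padd (n + m) b e (s i)) = padd m d e" for e
    unfolding padd_def s_def b_def by (rule ext) (auto split: if_splits simp: add.commute)
  moreover have "\<forall>i<n+m. b i \<in> P" using 1(1) 2(1) unfolding b_def by auto
  ultimately show ?thesis using 1 2 unfolding dfn_def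
    by (intro exI[of _ "FAnd (ren r \<phi>) (ren s \<psi>)"] exI[of _ "n + m"] exI[of _ b]) (simp add: holds_ren)
qed

lemma dfn_all [dint]:
  fixes Q :: "'v::membership \<Rightarrow> (nat \<Rightarrow> 'v) \<Rightarrow> bool"
  assumes "dfn P (\<lambda>e. Q (e 0) (sh e))"
  shows "dfn P (\<lambda>e. \<forall>x. Q x e)"
proof -
  obtain \<phi> n c where *: "\<forall>i<n. c i \<in> P" "\<And>e. holds \<phi> (padd n c e) \<longleftrightarrow> Q (e 0) (sh e)"
    using assms(1) unfolding dfn_def by blast
  obtain N0 where N0: "\<And>e e' :: nat \<Rightarrow> 'v. (\<forall>i<N0. e i = e' i) \<Longrightarrow> holds \<phi> e = holds \<phi> e'"
    using holds_fresh[of \<phi>] by metis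
  \<comment> \<open>A quantifier of \<open>fm\<close> binds a named variable, whereas the de Bruijn
    variable to be bound sits right after the \<open>n\<close> parameters. The cycle
    \<open>r\<close> sends position \<open>n\<close> to the fresh index \<open>N\<close> and closes
    the gap.\<close>
  define N where "N = max N0 n"
  define r where "r i = (if i = n then N else if n < i \<and> i \<le> N then i - 1 else i)" for i
  have N: "n \<le> N" "N0 \<le> N" unfolding N_def by auto
  have r: "inj r" using N unfolding r_def by (auto simp: inj_def split: if_splits)
  have "holds \<phi> (\<lambda>i. ((padd n c e)(N := x)) (r i)) = Q x e" for e x
  proof -
    have "holds \<phi> (\<lambda>i. ((padd n c e)(N := x)) (r i))
        = holds \<phi> (padd n c (\<lambda>i. if i = 0 then x else e (i - 1)))"
    proof (intro N0 allI impI)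
      fix i assume "i < N0"
      then consider "i < n" | "i = n" | "n < i" "i \<le> N" using N by linarith
      then show "((padd n c e)(N := x)) (r i) = padd n c (\<lambda>i. if i = 0 then x else e (i - 1)) i"
      proof cases
        case 3
        then have "r i = i - 1" "i - 1 \<noteq> N" "\<not> i - 1 < n" "i - n \<noteq> 0" "i - 1 - n = i - n - 1"
          unfolding r_def by auto
        with 3 show ?thesis unfolding padd_def by simp
      qed (use N in \<open>auto simp: r_def padd_def\<close>)
    qed
    then show ?thesis by (simp add: *(2))
  qed
  then show ?thesis using *(1) r unfolding dfn_def
    by (intro exI[of _ "FAll N (ren r \<phi>)"] exI[of _ n] exI[of _ c]) (simp add: holds_ren)
qed

lemma dfn_imp [dint]: "dfn P Q \<Longrightarrow> dfn P R \<Longrightarrow> dfn P (\<lambda>e. Q e \<longrightarrow> R e)"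
  by (rule dfn_cong[of _ "\<lambda>e. \<not> (Q e \<and> \<not> R e)"]) (intro dint, auto)

lemma dfn_disj [dint]: "dfn P Q \<Longrightarrow> dfn P R \<Longrightarrow> dfn P (\<lambda>e. Q e \<or> R e)"
  by (rule dfn_cong[of _ "\<lambda>e. \<not> (\<not> Q e \<and> \<not> R e)"]) (intro dint, auto)

lemma dfn_iff [dint]: "dfn P Q \<Longrightarrow> dfn P R \<Longrightarrow> dfn P (\<lambda>e. Q e \<longleftrightarrow> R e)"
  by (rule dfn_cong[of _ "\<lambda>e. (Q e \<longrightarrow> R e) \<and> (R e \<longrightarrow> Q e)"]) (intro dint, auto)

lemma dfn_ex [dint]:
  assumes "dfn P (\<lambda>e. Q (e 0) (sh e))"
  shows "dfn P (\<lambda>e. \<exists>x. Q x e)"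
proof -
  have "dfn P (\<lambda>e. \<not> (\<forall>x. \<not> Q x e))" by (intro dint assms)
  then show ?thesis by simp
qed

lemma dfn_True [dint]: "dfn P (\<lambda>e. True)"
  using dfn_eq_var[of P 0 0] by simp

lemma dfn_False [dint]: "dfn P (\<lambda>e. False)"
  using dfn_not[OF dfn_True] by simp

text \<open>\<open>fm\<close> has no function terms, so in an atom the values of the terms are named
  by existential quantifiers and described by their graphs. Under a quantifier the substitution is
  extended by the bound variable itself and the other terms are shifted.\<close>

lemma dfn_holds_subst:
  assumes "\<And>i. dterm P (t i)"
  shows "dfn P (\<lambda>e. holds \<phi> (\<lambda>i. t i e))"
  using assms
proof (induction \<phi> arbitrary: t)
  case (FMem i j)
  have "dfn P (\<lambda>e. e 0 = t i (\<lambda>k. e (Suc (Suc k))))"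
    using dfn_ren[OF FMem[of i, unfolded dterm_def], of "\<lambda>k. if k = 0 then 0 else Suc k"] by (simp add: inj_def)
  moreover have "dfn P (\<lambda>e. e 1 = t j (\<lambda>k. e (Suc (Suc k))))"
    using dfn_ren[OF FMem[of j, unfolded dterm_def], of "Suc"] by simp
  ultimately have "dfn P (\<lambda>e. \<exists>y x. x = t i e \<and> y = t j e \<and> x \<in> elts y)"
    by (intro dint dfn_mem_var) simp_all
  then show ?case by simp
next
  case (FEq i j)
  have "dfn P (\<lambda>e. e 0 = t i (\<lambda>k. e (Suc (Suc k))))"
    using dfn_ren[OF FEq[of i, unfolded dterm_def], of "\<lambda>k. if k = 0 then 0 else Suc k"] by (simp add: inj_def)
  moreover have "dfn P (\<lambda>e. e 1 = t j (\<lambda>k. e (Suc (Suc k))))"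
    using dfn_ren[OF FEq[of j, unfolded dterm_def], of "Suc"] by simp
  ultimately have "dfn P (\<lambda>e. \<exists>y x. x = t i e \<and> y = t j e \<and> x = y)"
    by (intro dint dfn_eq_var) simp_all
  then show ?case by simp
next
  case (FNot \<phi>)
  then show ?case by (simp add: dfn_not)
next
  case (FAnd \<phi> \<psi>)
  then show ?case by (simp add: dfn_conj)
next
  case (FAll k \<phi>)
  define s where "s i = (if i = k then (\<lambda>e. e 0) else (\<lambda>e. t i (\<lambda>j. e (Suc j))))" for i
  have s: "dterm P (s i)" for i
    using dfn_ren[OF FAll(2)[of i, unfolded dterm_def], of "\<lambda>k. if k = 0 then 0 else Suc k"]
      dfn_eq_var[of P 0 1]
    unfolding dterm_def s_def by (simp add: inj_def)
  have "(\<lambda>i. s i e) = (\<lambda>i. t i (\<lambda>j. e (Suc j)))(k := e 0)" for e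
    unfolding s_def by (auto simp: fun_eq_iff)
  then have "dfn P (\<lambda>e. holds \<phi> ((\<lambda>i. t i (\<lambda>j. e (Suc j)))(k := e 0)))"
    using FAll(1)[of s, OF s] by simp
  then show ?case by (simp add: dfn_all)
qed

section \<open>Definable terms and their substitution\<close>

lemma dterm_var [dint]: "dterm P (\<lambda>e. e i)"
  unfolding dterm_def by (rule dfn_eq_var)

lemma dterm_const:
  assumes "c \<in> P" shows "dterm P (\<lambda>e. c)"
  using assms unfolding dterm_def dfn_def padd_def
  by (intro exI[of _ "FEq 1 0"] exI[of _ 1] exI[of _ "\<lambda>_. c"]) auto

lemma dterm_const_UNIV [dint]: "dterm UNIV (\<lambda>e. c)"
  by (simp add: dterm_const)

lemma dfn_subst:
  assumes "dfn P Q" "P \<subseteq> P'" "\<And>i. dterm P' (t i)"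
  shows "dfn P' (\<lambda>e. Q (\<lambda>i. t i e))"
proof -
  obtain \<phi> n c where *: "\<forall>i<n. c i \<in> P" "\<forall>e. holds \<phi> (padd n c e) \<longleftrightarrow> Q e"
    using assms(1) unfolding dfn_def by blast
  \<comment> \<open>The parameters of \<open>Q\<close> are substituted as constant terms, which is
    why \<open>P\<close> must be contained in \<open>P'\<close>.\<close>
  define s where "s i = (if i < n then (\<lambda>e. c i) else t (i - n))" for i
  have "dterm P' (s i)" for i
    unfolding s_def using assms(2,3) *(1) by (auto intro: dterm_const)
  then have "dfn P' (\<lambda>e. holds \<phi> (\<lambda>i. s i e))" by (rule dfn_holds_subst)
  moreover have "(\<lambda>i. s i e) = padd n c (\<lambda>i. t i e)" for e
    unfolding s_def padd_def by auto
  ultimately show ?thesis by (simp add: *(2))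
qed

lemma dterm_shift: "dterm P t \<Longrightarrow> dterm P (\<lambda>e. t (sh e))"
  unfolding dterm_def
  using dfn_ren[of P "\<lambda>e. e 0 = t (sh e)" "\<lambda>k. if k = 0 then 0 else Suc k"] by (simp add: inj_def)

lemma dfn_let:
  assumes "dterm P t" "dfn P (\<lambda>e. Q (e 0) (sh e))"
  shows "dfn P (\<lambda>e. Q (t e) e)"
proof -
  have "dterm P (if i = 0 then t else (\<lambda>e. e (i - 1)))" for i
    using assms(1) by (simp add: dterm_var)
  from dfn_subst[OF assms(2) subset_refl, where t = "\<lambda>i. if i = 0 then t else (\<lambda>e. e (i - 1))", OF this] show ?thesis by simp
qed

lemma dterm_let:
  assumes "dterm P t" "dterm P (\<lambda>e. s (e 0) (sh e))"
  shows "dterm P (\<lambda>e. s (t e) e)"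
proof -
  have "dterm P (if i = 0 then (\<lambda>e. e 1) else if i = 1 then (\<lambda>e. e 0) else (\<lambda>e. e i))" for i
    by (simp add: dterm_var)
  from dfn_subst[OF assms(2)[unfolded dterm_def] subset_refl,
      where t = "\<lambda>i. if i = 0 then (\<lambda>e. e 1) else if i = 1 then (\<lambda>e. e 0) else (\<lambda>e. e i)", OF this]
  have "dfn P (\<lambda>e. e 1 = s (e 0) (sh (sh e)))" by simp
  then have "dfn P (\<lambda>e. e 0 = s (t (sh e)) (sh e))"
    using dfn_let[of P "\<lambda>e. t (sh e)" "\<lambda>x e. e 0 = s x (sh e)"] dterm_shift[OF assms(1)]
    by simp
  then show ?thesis unfolding dterm_def .
qed

lemma dfn_inst:
  assumes "dfn P (\<lambda>e. Q (e 0) (sh e))"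
  shows "dfn UNIV (\<lambda>e. Q (e 0) e0)"
proof -
  have "dterm UNIV (if i = 0 then (\<lambda>e. e 0) else (\<lambda>e. e0 (i - 1)))" for i
    by (simp add: dterm_var dterm_const_UNIV)
  from dfn_subst[OF assms subset_UNIV, where t = "\<lambda>i. if i = 0 then (\<lambda>e. e 0) else (\<lambda>e. e0 (i - 1))", OF this] show ?thesis by simp
qed

text \<open>With its companions for more arguments, this lets a notion be unfolded and shown
  definable once, at variables, and then be applied to arbitrary terms. Unfolding it at terms would
  require shifting them under each quantifier of its definition.\<close>

lemma dfn1I:
  assumes "dfn {} (\<lambda>e. R (e 0))" "dterm P s"
  shows "dfn P (\<lambda>e. R (s e))"
  using dfn_subst[OF assms(1) empty_subsetI, of P "\<lambda>i. s"] assms(2) by simp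

lemma dfn2I:
  assumes "dfn {} (\<lambda>e. R (e 0) (e 1))" "dterm P s" "dterm P t"
  shows "dfn P (\<lambda>e. R (s e) (t e))"
  using dfn_subst[OF assms(1) empty_subsetI, of P "\<lambda>i. if i = 0 then s else t"] assms(2-) by simp

lemma dfn3I:
  assumes "dfn {} (\<lambda>e. R (e 0) (e 1) (e 2))" "dterm P s" "dterm P t" "dterm P u"
  shows "dfn P (\<lambda>e. R (s e) (t e) (u e))"
  using dfn_subst[OF assms(1) empty_subsetI, of P "\<lambda>i. if i = 0 then s else if i = 1 then t else u"]
    assms(2-) by simp

lemma dfn4I:
  assumes "dfn {} (\<lambda>e. R (e 0) (e 1) (e 2) (e 3))" "dterm P s" "dterm P t" "dterm P u" "dterm P v"
  shows "dfn P (\<lambda>e. R (s e) (t e) (u e) (v e))"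
  using dfn_subst[OF assms(1) empty_subsetI, of P
      "\<lambda>i. if i = 0 then s else if i = 1 then t else if i = 2 then u else v"]
    assms(2-) by simp

lemma dterm2I:
  assumes "dfn {} (\<lambda>e. e 0 = f (e 1) (e 2))" "dterm P s" "dterm P t"
  shows "dterm P (\<lambda>e. f (s e) (t e))"
  unfolding dterm_def
  by (rule dfn3I[of "\<lambda>x y z. x = f y z", OF assms(1) dterm_var dterm_shift[OF assms(2)] dterm_shift[OF assms(3)]])

lemma dterm3I:
  assumes "dfn {} (\<lambda>e. e 0 = f (e 1) (e 2) (e 3))" "dterm P s" "dterm P t" "dterm P u"
  shows "dterm P (\<lambda>e. f (s e) (t e) (u e))"
  unfolding dterm_def
  by (rule dfn4I[of "\<lambda>x y z w. x = f y z w", OF assms(1) dterm_var dterm_shift[OF assms(2)]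
        dterm_shift[OF assms(3)] dterm_shift[OF assms(4)]])

lemma dfn_mem [dint]: "dterm P s \<Longrightarrow> dterm P t \<Longrightarrow> dfn P (\<lambda>e. s e \<in> elts (t e))"
  by (rule dfn2I[of "\<lambda>x y. x \<in> elts y", OF dfn_mem_var])

lemma dfn_eq [dint]: "dterm P s \<Longrightarrow> dterm P t \<Longrightarrow> dfn P (\<lambda>e. s e = t e)"
  by (rule dfn2I[of "\<lambda>x y. x = y", OF dfn_eq_var])

lemma dfn_ball [dint]:
  assumes "dterm P t" "dfn P (\<lambda>e. Q (e 0) (sh e))"
  shows "dfn P (\<lambda>e. \<forall>x\<in>elts (t e). Q x e)"
  unfolding Ball_def by (intro dint dterm_shift assms)

lemma dfn_bex [dint]:
  assumes "dterm P t" "dfn P (\<lambda>e. Q (e 0) (sh e))"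
  shows "dfn P (\<lambda>e. \<exists>x\<in>elts (t e). Q x e)"
  unfolding Bex_def by (intro dint dterm_shift assms)

lemma dfn_subset [dint]: "dterm P s \<Longrightarrow> dterm P t \<Longrightarrow> dfn P (\<lambda>e. elts (s e) \<subseteq> elts (t e))"
  unfolding subset_eq by (intro dint dterm_shift)

lemma dfn_ex1 [dint]:
  assumes "dfn P (\<lambda>e. Q (e 0) (sh e))"
  shows "dfn P (\<lambda>e. \<exists>!x. Q x e)"
  using dfn_ren[OF assms, of "\<lambda>k. if k = 0 then 0 else Suc k"]
  unfolding Ex1_def by (intro dint assms) (simp_all add: inj_def)

text \<open>By extensionality the graph of a set-valued operation is definable as soon as membership
  in its value is. In this way comprehension terms become part of the syntax.\<close>

lemma dterm_set:
  assumes "\<And>e. elts (t e) = {z. Q z e}" "dfn P (\<lambda>e. Q (e 0) (sh e))"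
  shows "dterm P (t :: (nat \<Rightarrow> 'v::zfc) \<Rightarrow> 'v)"
proof -
  have "dfn P (\<lambda>e. Q (e 0) (sh (sh e)))"
    using dfn_ren[OF assms(2), of "\<lambda>k. if k = 0 then 0 else Suc k"] by (simp add: inj_def)
  then show ?thesis
    unfolding dterm_def v_eq_iff[of "_ 0"] assms(1) mem_Collect_eq by (intro dint) simp_all
qed

lemma dterm_if [dint]:
  assumes "dfn P Q" "dterm P s" "dterm P t"
  shows "dterm P (\<lambda>e. if Q e then s e else t e)"
proof -
  have "dfn P (\<lambda>e. Q (sh e))" using dfn_ren[OF assms(1), of Suc] by simp
  moreover have "x = (if b then y else z) \<longleftrightarrow> b \<and> x = y \<or> \<not> b \<and> x = z" for x y z and b by auto
  ultimately show ?thesis unfolding dterm_def by (simp, intro dint dterm_shift assms) simp_all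
qed

section \<open>Basic set operations as terms\<close>

lemma dterm_vempty [dint]: "dterm P (\<lambda>e. vempty :: 'v::zfc)"
  by (rule dterm_set[where Q = "\<lambda>z e. False"], simp) (intro dint)

lemma dterm_upair [dint]:
  assumes "dterm P s" "dterm P t" shows "dterm P (\<lambda>e. upair (s e) (t e) :: 'v::zfc)"
  by (rule dterm_set[where Q = "\<lambda>z e. z = s e \<or> z = t e"], simp, blast?)
    (intro dint dterm_shift[OF assms(1)] dterm_shift[OF assms(2)])

lemma dterm_opair [dint]:
  assumes "dterm P s" "dterm P t" shows "dterm P (\<lambda>e. opair (s e) (t e) :: 'v::zfc)"
  unfolding opair_def by (intro dint assms)

lemma dterm_vsucc [dint]:
  assumes "dterm P s" shows "dterm P (\<lambda>e. vsucc (s e) :: 'v::zfc)"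
  by (rule dterm_set[where Q = "\<lambda>z e. z = s e \<or> z \<in> elts (s e)"], simp, blast?) (intro dint dterm_shift[OF assms])

lemma dterm_vpow [dint]:
  assumes "dterm P s" shows "dterm P (\<lambda>e. vpow (s e) :: 'v::zfc)"
  by (rule dterm_set[where Q = "\<lambda>z e. elts z \<subseteq> elts (s e)"], simp, blast?) (intro dint dterm_shift[OF assms])

lemma dterm_vUnion [dint]:
  assumes "dterm P s" shows "dterm P (\<lambda>e. vUnion (s e) :: 'v::zfc)"
  by (rule dterm_set[where Q = "\<lambda>z e. \<exists>y\<in>elts (s e). z \<in> elts y"], simp, blast?) (intro dint dterm_shift[OF assms])

lemma dterm_vun [dint]:
  assumes "dterm P s" "dterm P t" shows "dterm P (\<lambda>e. vun (s e) (t e) :: 'v::zfc)"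
  by (rule dterm_set[where Q = "\<lambda>z e. z \<in> elts (s e) \<or> z \<in> elts (t e)"], simp, blast?)
    (intro dint dterm_shift[OF assms(1)] dterm_shift[OF assms(2)])

lemma dterm_vnat [dint]: "dterm P (\<lambda>e. vnat n :: 'v::zfc)"
  by (induction n) (auto intro: dint)


section \<open>Separation and replacement\<close>

lemma small_sep:
  assumes "dfn UNIV (\<lambda>e. Q (e 0))"
  shows "small {y \<in> elts (x::'v::zfc). Q y}"
proof -
  obtain \<phi> n c where *: "\<forall>e. holds \<phi> (padd n c e) \<longleftrightarrow> Q (e 0)"
    using assms(1) unfolding dfn_def by blast
  \<comment> \<open>The axiom reads the element from variable 0, whereas \<open>dfn\<close> reads it
    from the variable after the \<open>n\<close> parameters; \<open>r\<close> is the corresponding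
    cycle.\<close>
  define r where "r i = (if i < n then Suc i else if i = n then 0 else i)" for i
  have r: "inj r" unfolding r_def inj_def by auto
  define e :: "nat \<Rightarrow> 'v" where "e i = c (i - 1)" for i
  have "holds (ren r \<phi>) (e(0 := y)) = Q y" for y
  proof -
    have "(\<lambda>i. (e(0 := y)) (r i)) = padd n c (\<lambda>i. if i = 0 then y else e (i + n))"
      unfolding padd_def r_def e_def by (auto simp: fun_eq_iff)
    then show ?thesis using * by (simp add: holds_ren[OF r])
  qed
  then show ?thesis
    using separation[of x "ren r \<phi>" e] unfolding small_def by simp
qed

lemma small_subset:
  assumes "X \<subseteq> elts x" "dfn UNIV (\<lambda>e. e 0 \<in> X)"
  shows "small (X :: 'v::zfc set)"
proof -
  have "X = {y \<in> elts x. y \<in> X}" using assms(1) by blast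
  then show ?thesis using small_sep[OF assms(2), of x] by simp
qed

lemma small_image:
  assumes "dterm UNIV (\<lambda>e. F (e 0))"
  shows "small (F ` elts (x::'v::zfc))"
proof -
  obtain \<phi> n c where *: "\<forall>e. holds \<phi> (padd n c e) \<longleftrightarrow> e 0 = F (e 1)"
    using assms(1) unfolding dfn_def dterm_def by auto
  \<comment> \<open>Replacement has the argument in variable 0 and the value in variable 1, while
    the graph in \<open>dterm\<close> has them in the opposite order behind the parameters.\<close>
  define r where "r i = (if i < n then i + 2 else if i = n then 1 else if i = n + 1 then 0 else i)" for i
  have r: "inj r" unfolding r_def inj_def by auto
  define e :: "nat \<Rightarrow> 'v" where "e i = c (i - 2)" for i
  have h: "holds (ren r \<phi>) (e(0 := y, 1 := z)) \<longleftrightarrow> z = F y" for y z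
  proof -
    have "(\<lambda>i. (e(0 := y, 1 := z)) (r i)) = padd n c (\<lambda>i. if i = 0 then z else if i = 1 then y else e (i + n))"
      unfolding padd_def r_def e_def by (auto simp: fun_eq_iff)
    then show ?thesis using * by (simp add: holds_ren[OF r])
  qed
  then show ?thesis
    using replacement[of x "ren r \<phi>" e] unfolding small_def h image_def by simp
qed


lemma dterm_subst:
  assumes "dterm P s" "\<And>i. dterm P (t i)"
  shows "dterm P (\<lambda>e. s (\<lambda>i. t i e))"
proof -
  define u where "u i = (if i = 0 then (\<lambda>e. e 0) else (\<lambda>e. t (i - 1) (\<lambda>j. e (Suc j))))" for i :: nat
  have "dterm P (u i)" for i
    unfolding u_def using dterm_shift[OF assms(2)] by (simp add: dterm_var)
  from dfn_subst[OF assms(1)[unfolded dterm_def] subset_refl, where t = u, OF this]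
  show ?thesis unfolding dterm_def u_def by simp
qed

lemma dterm_app1:
  assumes "dterm P (\<lambda>e. f (e 0))" "dterm P s"
  shows "dterm P (\<lambda>e. f (s e))"
  using dterm_subst[OF assms(1), where t = "\<lambda>i. s"] assms(2) by simp

lemma dterm_ren: "dterm P t \<Longrightarrow> dterm P (\<lambda>e. t (\<lambda>i. e (r i)))"
  by (rule dterm_subst[where t = "\<lambda>i e. e (r i)"]) (simp_all add: dterm_var)

lemma dfn_rename: "dfn P Q \<Longrightarrow> dfn P (\<lambda>e. Q (\<lambda>i. e (r i)))"
  by (rule dfn_subst[where t = "\<lambda>i e. e (r i)", OF _ subset_refl]) (simp_all add: dterm_var)

lemma dterm_push:
  assumes "dterm P (\<lambda>e. F (e 0) (sh e))"
  shows "dterm P (\<lambda>e. F (e 0) (sh (sh e)))"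
  using dterm_ren[OF assms, of "\<lambda>k. if k = 0 then 0 else Suc k"] by simp

lemma dfn_push:
  assumes "dfn P (\<lambda>e. F (e 0) (sh e))"
  shows "dfn P (\<lambda>e. F (e 0) (sh (sh e)))"
  using dfn_rename[OF assms, of "\<lambda>k. if k = 0 then 0 else Suc k"] by simp

lemma dterm_inst:
  assumes "dterm P (\<lambda>e. F (e 0) (sh e))"
  shows "dterm UNIV (\<lambda>e. F (e 0) e0)"
proof -
  define u where "u i = (if i < 2 then (\<lambda>e. e i) else (\<lambda>e. e0 (i - 2)))" for i :: nat
  have "dterm UNIV (u i)" for i
    unfolding u_def by (simp add: dterm_var dterm_const_UNIV)
  from dfn_subst[OF assms[unfolded dterm_def] subset_UNIV, where t = u, OF this]
  show ?thesis unfolding dterm_def u_def by (simp add: numeral_2_eq_2)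
qed

text \<open>A description with a definable default: the value of \<open>THE\<close> is unspecified
  when nothing unique exists, so terms built from it could not be shown definable at all
  arguments.\<close>

definition vthe :: "('v::zfc \<Rightarrow> bool) \<Rightarrow> 'v" where
  "vthe Q = (if \<exists>!x. Q x then THE x. Q x else vempty)"

lemma vthe_eq: "Q y \<Longrightarrow> (\<And>x. Q x \<Longrightarrow> x = y) \<Longrightarrow> vthe Q = y"
  unfolding vthe_def by (metis the_equality)

lemma dterm_vthe [dint]:
  assumes "dfn P (\<lambda>e. Q (e 0) (sh e))"
  shows "dterm P (\<lambda>e. vthe (\<lambda>x. Q x e))"
proof -
  have "y = vthe R \<longleftrightarrow> (\<exists>!x. R x) \<and> R y \<or> \<not> (\<exists>!x. R x) \<and> y = vempty" for y and R :: "'a \<Rightarrow> bool"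
    unfolding vthe_def using theI'[of R] by auto
  then show ?thesis unfolding dterm_def
    by (simp, intro dint dfn_push assms)
qed


section \<open>Comprehension terms and functions\<close>

definition vsep :: "'v::zfc \<Rightarrow> ('v \<Rightarrow> bool) \<Rightarrow> 'v" where
  "vsep x Q = mkset {y \<in> elts x. Q y}"

lemma elts_vsep: "dfn UNIV (\<lambda>e. Q (e 0)) \<Longrightarrow> elts (vsep x Q) = {y \<in> elts x. Q y}"
  unfolding vsep_def by (simp add: elts_mkset small_sep)

lemma dterm_vsep [dint]:
  assumes "dterm P x" "dfn P (\<lambda>e. Q (e 0) (sh e))"
  shows "dterm P (\<lambda>e. vsep (x e) (\<lambda>y. Q y e))"
  by (rule dterm_set[where Q = "\<lambda>y e. y \<in> elts (x e) \<and> Q y e"])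
    (simp add: elts_vsep[OF dfn_inst[OF assms(2)]], intro dint assms dterm_shift[OF assms(1)])

definition vimage :: "('v::zfc \<Rightarrow> 'v) \<Rightarrow> 'v \<Rightarrow> 'v" where
  "vimage F A = mkset (F ` elts A)"

lemma elts_vimage: "dterm UNIV (\<lambda>e. F (e 0)) \<Longrightarrow> elts (vimage F A) = F ` elts A"
  unfolding vimage_def by (simp add: elts_mkset small_image)

lemma dterm_vimage [dint]:
  assumes "dterm P A" "dterm P (\<lambda>e. F (e 0) (sh e))"
  shows "dterm P (\<lambda>e. vimage (\<lambda>x. F x e) (A e))"
  by (rule dterm_set[where Q = "\<lambda>z e. \<exists>x\<in>elts (A e). z = F x e"])
    (simp add: elts_vimage[OF dterm_inst[OF assms(2)]] image_def,
      intro dint assms dterm_shift[OF assms(1)] dterm_push[OF assms(2)])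

definition vUN :: "'v::zfc \<Rightarrow> ('v \<Rightarrow> 'v) \<Rightarrow> 'v" where
  "vUN A F = vUnion (vimage F A)"

lemma elts_vUN: "dterm UNIV (\<lambda>e. F (e 0)) \<Longrightarrow> elts (vUN A F) = (\<Union>x\<in>elts A. elts (F x))"
  unfolding vUN_def by (simp add: elts_vimage)

lemma dterm_vUN [dint]:
  assumes "dterm P A" "dterm P (\<lambda>e. F (e 0) (sh e))"
  shows "dterm P (\<lambda>e. vUN (A e) (\<lambda>x. F x e))"
  unfolding vUN_def by (intro dint assms)

definition vlam :: "'v::zfc \<Rightarrow> ('v \<Rightarrow> 'v) \<Rightarrow> 'v" where
  "vlam A F = vimage (\<lambda>x. opair x (F x)) A"

lemma dterm_vlam [dint]:
  assumes "dterm P A" "dterm P (\<lambda>e. F (e 0) (sh e))"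
  shows "dterm P (\<lambda>e. vlam (A e) (\<lambda>x. F x e))"
  unfolding vlam_def by (intro dint assms)

text \<open>A total, definable version of \<open>app\<close>, with value 0 where no unique value
  exists; on the domain of a function the two agree.\<close>

definition ap :: "'v::zfc \<Rightarrow> 'v \<Rightarrow> 'v" where
  "ap f x = vthe (\<lambda>y. opair x y \<in> elts f)"

lemma dterm_ap [dint]:
  assumes "dterm P f" "dterm P x" shows "dterm P (\<lambda>e. ap (f e) (x e))"
  unfolding ap_def by (intro dint dterm_shift[OF assms(1)] dterm_shift[OF assms(2)])

definition fn :: "'v::zfc \<Rightarrow> 'v \<Rightarrow> bool" where
  "fn f A \<longleftrightarrow> (\<forall>z\<in>elts f. \<exists>x\<in>elts A. \<exists>y. z = opair x y) \<and> (\<forall>x\<in>elts A. \<exists>!y. opair x y \<in> elts f)"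

lemma dfn_fn [dint]:
  assumes "dterm P f" "dterm P A" shows "dfn P (\<lambda>e. fn (f e) (A e))"
  by (rule dfn2I[OF _ assms], unfold fn_def, intro dint)

lemma dfn_is_fun [dint]:
  assumes "dterm P f" "dterm P A" "dterm P B" shows "dfn P (\<lambda>e. is_fun (f e) (A e) (B e :: 'v::zfc))"
  by (rule dfn3I[OF _ assms], unfold is_fun_def, intro dint)

lemma fn_mem:
  assumes "fn f A" shows "opair x y \<in> elts f \<longleftrightarrow> x \<in> elts A \<and> y = ap f x"
proof -
  have 1: "x \<in> elts A" if "opair x y \<in> elts f" for y
    using assms that unfolding fn_def by (metis opair_eq_iff)
  have 2: "\<exists>!y. opair x y \<in> elts f" if "x \<in> elts A"
    using assms that unfolding fn_def by blast
  have 3: "opair x (ap f x) \<in> elts f" if "x \<in> elts A"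
    using 2[OF that] unfolding ap_def by (metis vthe_eq)
  show ?thesis using 1 2 3 by blast
qed

lemma fn_memE:
  assumes "fn f A" "z \<in> elts f" obtains x where "x \<in> elts A" "z = opair x (ap f x)"
proof -
  obtain x y where "x \<in> elts A" "z = opair x y" using assms unfolding fn_def by blast
  then show ?thesis using assms fn_mem[OF assms(1)] that by metis
qed

lemma elts_fn: "fn f A \<Longrightarrow> elts f = (\<lambda>x. opair x (ap f x)) ` elts A"
  using fn_mem[of f A] fn_memE[of f A] by (auto simp: image_iff) metis

lemma fn_ext:
  assumes "fn f A" "fn g A" "\<And>x. x \<in> elts A \<Longrightarrow> ap f x = ap g x"
  shows "f = g"
  by (rule extensionality) (simp add: elts_fn[OF assms(1)] elts_fn[OF assms(2)] assms(3))

lemma app_eq_ap: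
  assumes "fn f A" "x \<in> elts A" shows "app f x = ap f x"
  unfolding app_def using fn_mem[OF assms(1), of x] assms(2) by simp

lemma is_fun_iff: "is_fun f A B \<longleftrightarrow> fn f A \<and> (\<forall>x\<in>elts A. ap f x \<in> elts (B::'v::zfc))"
proof
  assume f: "is_fun f A B"
  then have fn: "fn f A" unfolding is_fun_def fn_def by blast
  have "ap f x \<in> elts B" if x: "x \<in> elts A" for x
  proof -
    have "opair x (ap f x) \<in> elts f" using fn_mem[OF fn, of x] x by simp
    then obtain x' y where "y \<in> elts B" "opair x (ap f x) = opair x' y"
      using f unfolding is_fun_def by blast
    then show ?thesis by auto
  qed
  with fn show "fn f A \<and> (\<forall>x\<in>elts A. ap f x \<in> elts B)" by blast
next
  assume f: "fn f A \<and> (\<forall>x\<in>elts A. ap f x \<in> elts B)"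
  then have "\<exists>x\<in>elts A. \<exists>y\<in>elts B. z = opair x y" if "z \<in> elts f" for z
    using fn_memE[of f A z] that by metis
  with f show "is_fun f A B" unfolding is_fun_def fn_def by blast
qed

lemma is_fun_fn: "is_fun f A B \<Longrightarrow> fn f (A::'v::zfc)"
  by (simp add: is_fun_iff)

lemma is_fun_ap: "is_fun f A B \<Longrightarrow> x \<in> elts A \<Longrightarrow> ap f x \<in> elts (B::'v::zfc)"
  by (simp add: is_fun_iff)

lemma is_fun_app: "is_fun f A B \<Longrightarrow> x \<in> elts A \<Longrightarrow> app f x = ap f (x::'v::zfc)"
  using app_eq_ap is_fun_fn by blast

lemma fn_image:
  assumes "elts f = (\<lambda>x. opair x (F x)) ` elts A" shows "fn f A" "x \<in> elts A \<Longrightarrow> ap f x = F x"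
proof -
  have *: "opair x y \<in> elts f \<longleftrightarrow> x \<in> elts A \<and> y = F x" for x y unfolding assms by auto
  show "fn f A" unfolding fn_def using * assms by auto
  show "ap f x = F x" if "x \<in> elts A" unfolding ap_def by (rule vthe_eq) (simp_all add: * that)
qed

lemma elts_vlam: "dterm UNIV (\<lambda>e. F (e 0)) \<Longrightarrow> elts (vlam A F) = (\<lambda>x. opair x (F x)) ` elts A"
  unfolding vlam_def by (rule elts_vimage) (intro dint)

lemma fn_vlam: "dterm UNIV (\<lambda>e. F (e 0)) \<Longrightarrow> fn (vlam A F) A"
  by (rule fn_image(1)[OF elts_vlam])

lemma ap_vlam: "dterm UNIV (\<lambda>e. F (e 0)) \<Longrightarrow> x \<in> elts A \<Longrightarrow> ap (vlam A F) x = F x"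
  by (rule fn_image(2)[OF elts_vlam])

lemma is_fun_vlam:
  "dterm UNIV (\<lambda>e. F (e 0)) \<Longrightarrow> (\<And>x. x \<in> elts A \<Longrightarrow> F x \<in> elts B) \<Longrightarrow> is_fun (vlam A F) A B"
  unfolding is_fun_iff by (simp add: fn_vlam ap_vlam)

lemma elts_restr: "elts (restr f A) = {z \<in> elts f. \<exists>x\<in>elts A. \<exists>y. z = opair x (y::'v::zfc)}"
  unfolding restr_def by (rule elts_mkset, rule small_sep) (intro dint)

lemma dterm_restr [dint]:
  assumes "dterm P f" "dterm P A" shows "dterm P (\<lambda>e. restr (f e) (A e :: 'v::zfc))"
  by (rule dterm_set[where Q = "\<lambda>z e. z \<in> elts (f e) \<and> (\<exists>x\<in>elts (A e). \<exists>y. z = opair x y)"])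
    (simp add: elts_restr, intro dint dterm_shift[OF assms(1)] dterm_shift[OF assms(2)])

lemma
  assumes "fn f A" "elts B \<subseteq> elts A"
  shows fn_restr: "fn (restr f B) B" and ap_restr: "x \<in> elts B \<Longrightarrow> ap (restr f B) x = ap f x"
proof -
  have "elts (restr f B) = (\<lambda>x. opair x (ap f x)) ` elts B"
    unfolding elts_restr elts_fn[OF assms(1)] using assms(2) by auto
  from fn_image[OF this] show "fn (restr f B) B" "x \<in> elts B \<Longrightarrow> ap (restr f B) x = ap f x"
    by simp_all
qed

lemma is_fun_restr: "is_fun f A C \<Longrightarrow> elts B \<subseteq> elts A \<Longrightarrow> is_fun (restr f B) B (C::'v::zfc)"
  unfolding is_fun_iff by (auto simp: fn_restr ap_restr)

lemma elts_upd: "elts (upd f i x) = insert (opair i x) {z \<in> elts f. \<forall>y. z \<noteq> opair i (y::'v::zfc)}"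
  unfolding upd_def by (rule elts_mkset, rule small_insert, rule small_sep) (intro dint)

lemma dterm_upd [dint]:
  assumes "dterm P f" "dterm P i" "dterm P x" shows "dterm P (\<lambda>e. upd (f e) (i e) (x e :: 'v::zfc))"
  by (rule dterm3I[OF _ assms], subst v_eq_iff, unfold elts_upd insert_iff mem_Collect_eq, intro dint)

lemma
  assumes "fn f A" "i \<in> elts A"
  shows fn_upd: "fn (upd f i x) A"
    and ap_upd: "y \<in> elts A \<Longrightarrow> ap (upd f i x) y = (if y = i then x else ap f y)"
proof -
  have "elts (upd f i x) = (\<lambda>y. opair y (if y = i then x else ap f y)) ` elts A"
    unfolding elts_upd elts_fn[OF assms(1)] using assms(2) by auto
  from fn_image[OF this] show "fn (upd f i x) A"
    "y \<in> elts A \<Longrightarrow> ap (upd f i x) y = (if y = i then x else ap f y)"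
    by simp_all
qed

lemma is_fun_upd: "is_fun f A B \<Longrightarrow> i \<in> elts A \<Longrightarrow> x \<in> elts B \<Longrightarrow> is_fun (upd f i x) A (B::'v::zfc)"
  unfolding is_fun_iff by (auto simp: fn_upd ap_upd)

definition vfuns :: "'v::zfc \<Rightarrow> 'v \<Rightarrow> 'v" where
  "vfuns A B = mkset {f. is_fun f A B}"

lemma elts_vfuns: "elts (vfuns A B) = {f. is_fun f A B}"
  unfolding vfuns_def
proof (rule elts_mkset, rule small_subset)
  \<comment> \<open>An ordered pair over \<open>A\<close> and \<open>B\<close> is a set of subsets
    of their union, so three power sets bound the functions.\<close>
  show "{f. is_fun f A B} \<subseteq> elts (vpow (vpow (vpow (vun A B))))"
  proof
    fix f assume "f \<in> {f. is_fun f A B}"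
    then have "\<exists>x\<in>elts A. \<exists>y\<in>elts B. z = opair x y" if "z \<in> elts f" for z
      using that unfolding is_fun_def by simp
    then show "f \<in> elts (vpow (vpow (vpow (vun A B))))"
      unfolding opair_def by fastforce
  qed
qed (unfold mem_Collect_eq, intro dint)

lemma dterm_vfuns [dint]:
  assumes "dterm P A" "dterm P B" shows "dterm P (\<lambda>e. vfuns (A e) (B e))"
  by (rule dterm_set[where Q = "\<lambda>z e. is_fun z (A e) (B e)"])
    (simp add: elts_vfuns, intro dint dterm_shift[OF assms(1)] dterm_shift[OF assms(2)])


section \<open>Ordinals\<close>

lemma dfn_ordinal [dint]:
  assumes "dterm P s" shows "dfn P (\<lambda>e. ordinal (s e :: 'v::zfc))"
  by (rule dfn1I[OF _ assms], unfold ordinal_def, intro dint)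

lemma ordinal_mem_trans: "ordinal x \<Longrightarrow> y \<in> elts x \<Longrightarrow> z \<in> elts y \<Longrightarrow> z \<in> elts x"
  unfolding ordinal_def by blast

lemma ordinal_subset: "ordinal x \<Longrightarrow> y \<in> elts x \<Longrightarrow> elts y \<subseteq> elts x"
  unfolding ordinal_def by blast

lemma ordinal_elem:
  assumes x: "ordinal (x::'v::zfc)" and y: "y \<in> elts x" shows "ordinal y"
proof -
  have "elts z \<subseteq> elts y" if z: "z \<in> elts y" for z
  proof
    fix w assume w: "w \<in> elts z"
    have zx: "z \<in> elts x" and wx: "w \<in> elts x" using ordinal_mem_trans[OF x] y z w by blast+
    then consider "w \<in> elts y" | "w = y" | "y \<in> elts w" using x y unfolding ordinal_def by blast
    then show "w \<in> elts y"
    proof cases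
      case 2
      then show ?thesis using w z mem_asym by blast
    next
      case 3
      \<comment> \<open>Here \<open>y\<close> is in \<open>w\<close>, \<open>w\<close> in
        \<open>z\<close> and \<open>z\<close> in \<open>y\<close>; foundation for the set of these
        three excludes the cycle.\<close>
      have "\<exists>u\<in>elts (vun (upair y z) (upair w w)). elts u \<inter> elts (vun (upair y z) (upair w w)) = {}"
        by (rule foundation) simp
      then show ?thesis using 3 w z by auto
    qed
  qed
  moreover have "u \<in> elts v \<or> u = v \<or> v \<in> elts u" if "u \<in> elts y" "v \<in> elts y" for u v
    using x ordinal_mem_trans[OF x y] that unfolding ordinal_def by blast
  ultimately show ?thesis unfolding ordinal_def by blast
qed

text \<open>The counterexamples up to \<open>x\<close> form a set by separation, and foundation
  gives a minimal one. From outside the ordinals of the model may be ill-founded, so induction is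
  available only for definable \<open>Q\<close>; hence the case \<open>definable\<close> in all
  induction rules.\<close>

lemma ordinal_induct [consumes 1, case_names definable step]:
  assumes "ordinal (x::'v::zfc)" "dfn UNIV (\<lambda>e. Q (e 0))"
    and step: "\<And>x. ordinal x \<Longrightarrow> (\<And>y. y \<in> elts x \<Longrightarrow> Q y) \<Longrightarrow> Q x"
  shows "Q x"
proof (rule ccontr)
  assume "\<not> Q x"
  define B where "B = vsep (vsucc x) (\<lambda>y. \<not> Q y)"
  have B: "elts B = {y \<in> elts (vsucc x). \<not> Q y}"
    unfolding B_def by (rule elts_vsep) (intro dint assms)
  have "elts B \<noteq> {}" unfolding B using \<open>\<not> Q x\<close> by auto
  then obtain y where y: "y \<in> elts B" "elts y \<inter> elts B = {}" using foundation by blast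
  have "ordinal y" using y(1) ordinal_elem[OF assms(1)] assms(1) unfolding B by auto
  moreover have "Q z" if "z \<in> elts y" for z
    using y that ordinal_mem_trans[OF assms(1)] unfolding B by auto
  ultimately have "Q y" by (rule step)
  with y(1) show False unfolding B by simp
qed

lemma ordinal_mem_induct [consumes 2, case_names definable step]:
  assumes \<theta>: "ordinal (\<theta>::'v::zfc)" and "x \<in> elts \<theta>" and d: "dfn UNIV (\<lambda>e. Q (e 0))"
    and step: "\<And>x. x \<in> elts \<theta> \<Longrightarrow> ordinal x \<Longrightarrow> elts x \<subseteq> elts \<theta> \<Longrightarrow> (\<And>y. y \<in> elts x \<Longrightarrow> Q y) \<Longrightarrow> Q x"
  shows "Q x"
proof -
  have "x \<in> elts \<theta> \<longrightarrow> Q x"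
    using ordinal_elem[OF assms(1,2)]
  proof (induction x rule: ordinal_induct)
    case definable
    show ?case by (intro dint d)
  next
    case (step x)
    then show ?case using assms(4) ordinal_subset[OF \<theta>, of x] by blast
  qed
  with assms(2) show ?thesis by blast
qed

text \<open>Take a minimal element of the ordinal \<open>a\<close> outside \<open>c\<close>. Its
  elements all lie in \<open>c\<close>, and transitivity of \<open>c\<close> gives the converse
  inclusion, so it is \<open>c\<close> itself.\<close>

lemma ordinal_transitive_subset:
  assumes a: "ordinal (a::'v::zfc)" and c: "\<And>y. y \<in> elts c \<Longrightarrow> elts y \<subseteq> elts c"
    and sub: "elts c \<subseteq> elts a" and "c \<noteq> a"
  shows "c \<in> elts a"
proof -
  define B where "B = vsep a (\<lambda>y. y \<notin> elts c)"
  have B: "elts B = {y \<in> elts a. y \<notin> elts c}"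
    unfolding B_def by (rule elts_vsep) (intro dint)
  have "elts B \<noteq> {}" unfolding B using sub \<open>c \<noteq> a\<close> extensionality[of c a] by auto
  then obtain x where x: "x \<in> elts B" "elts x \<inter> elts B = {}" using foundation by blast
  have "elts x = elts c"
  proof
    show "elts x \<subseteq> elts c" using x ordinal_subset[OF a] unfolding B by auto
    show "elts c \<subseteq> elts x"
    proof
      fix y assume y: "y \<in> elts c"
      have "y \<in> elts x \<or> y = x \<or> x \<in> elts y" using a y x(1) sub unfolding ordinal_def B by auto
      then show "y \<in> elts x" using y x(1) c[OF y] unfolding B by auto
    qed
  qed
  then have "x = c" by (rule extensionality)
  then show ?thesis using x(1) unfolding B by simp
qed

lemma ordinal_subset_iff:
  assumes "ordinal (a::'v::zfc)" "ordinal b" shows "elts a \<subseteq> elts b \<longleftrightarrow> a \<in> elts b \<or> a = b"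
  using ordinal_transitive_subset[OF assms(2), of a] ordinal_subset[OF assms(1)] ordinal_subset[OF assms(2)]
  by auto

text \<open>By \<open>ordinal_transitive_subset\<close> the intersection \<open>c\<close> equals or
  is an element of each of the two ordinals; being an element of both would put \<open>c\<close>
  into itself.\<close>

lemma ordinal_linear:
  assumes a: "ordinal (a::'v::zfc)" and b: "ordinal b" shows "a \<in> elts b \<or> a = b \<or> b \<in> elts a"
proof -
  define c where "c = vsep a (\<lambda>y. y \<in> elts b)"
  have c: "elts c = {y \<in> elts a. y \<in> elts b}"
    unfolding c_def by (rule elts_vsep) (intro dint)
  have t: "elts y \<subseteq> elts c" if "y \<in> elts c" for y
    using that ordinal_subset[OF a] ordinal_subset[OF b] unfolding c by auto
  have "c \<in> elts a \<or> c = a" using ordinal_transitive_subset[OF a t] unfolding c by auto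
  moreover have "c \<in> elts b \<or> c = b" using ordinal_transitive_subset[OF b t] unfolding c by auto
  moreover have "\<not> (c \<in> elts a \<and> c \<in> elts b)" using c mem_irrefl[of c] by auto
  ultimately show ?thesis by auto
qed

lemma ordinal_not_mem: "ordinal (a::'v::zfc) \<Longrightarrow> ordinal b \<Longrightarrow> a \<notin> elts b \<longleftrightarrow> elts b \<subseteq> elts a"
  using ordinal_linear[of a b] ordinal_subset_iff[of b a] mem_asym[of a b] mem_irrefl[of a] by auto

lemma ordinal_vempty [simp]: "ordinal (vempty::'v::zfc)"
  unfolding ordinal_def by simp

lemma ordinal_vsucc [simp]: "ordinal (x::'v::zfc) \<Longrightarrow> ordinal (vsucc x)"
  unfolding ordinal_def by auto

lemma ordinal_of_vsucc: "ordinal (vsucc x) \<Longrightarrow> ordinal (x::'v::zfc)"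
  using ordinal_elem[of "vsucc x" x] by simp

lemma ordinal_UN:
  assumes "\<And>y. y \<in> Y \<Longrightarrow> ordinal (y::'v::zfc)" "elts x = (\<Union>y\<in>Y. elts y)" shows "ordinal x"
proof -
  have o: "ordinal z" if "z \<in> elts x" for z using that assms ordinal_elem by blast
  have "elts z \<subseteq> elts x" if "z \<in> elts x" for z
    using that assms(1) ordinal_subset unfolding assms(2) by blast
  then show ?thesis unfolding ordinal_def using ordinal_linear[OF o o] by simp
qed

lemma ordinal_vun: "ordinal (x::'v::zfc) \<Longrightarrow> ordinal y \<Longrightarrow> ordinal (vun x y)"
  by (rule ordinal_UN[of "{x, y}"]) auto

lemma vsucc_subset: "ordinal (x::'v::zfc) \<Longrightarrow> y \<in> elts x \<Longrightarrow> elts (vsucc y) \<subseteq> elts x"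
  using ordinal_subset[of x y] by auto

lemma vsucc_mem_vsucc:
  assumes "ordinal (x::'v::zfc)" "y \<in> elts x" shows "vsucc y \<in> elts (vsucc x)"
  using ordinal_subset_iff[of "vsucc y" x] vsucc_subset[OF assms] assms ordinal_elem[OF assms] by auto

lemma vUnion_vsucc: "ordinal (x::'v::zfc) \<Longrightarrow> vUnion (vsucc x) = x"
  by (rule extensionality) (use ordinal_subset in auto)

lemma dfn_limit_ordinal [dint]:
  assumes "dterm P s" shows "dfn P (\<lambda>e. limit_ordinal (s e :: 'v::zfc))"
  by (rule dfn1I[OF _ assms], unfold limit_ordinal_def, intro dint)

lemma limit_ordinal_ordinal: "limit_ordinal x \<Longrightarrow> ordinal x"
  unfolding limit_ordinal_def by blast

lemma not_limit [simp]: "\<not> limit_ordinal (vempty::'v::zfc)" "\<not> limit_ordinal (vsucc x)"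
  unfolding limit_ordinal_def by auto

lemma ordinal_cases:
  assumes "ordinal (x::'v::zfc)"
  obtains "x = vempty" | y where "ordinal y" "x = vsucc y" | "limit_ordinal x"
  using assms ordinal_of_vsucc unfolding limit_ordinal_def by metis

lemma limit_vsucc: "limit_ordinal (x::'v::zfc) \<Longrightarrow> y \<in> elts x \<Longrightarrow> vsucc y \<in> elts x"
  using ordinal_subset_iff[of "vsucc y" x] vsucc_subset[of x y] ordinal_elem[of x y]
  unfolding limit_ordinal_def by (metis ordinal_vsucc)

lemma limit_vempty: "limit_ordinal (x::'v::zfc) \<Longrightarrow> vempty \<in> elts x"
  using ordinal_subset_iff[of vempty x] unfolding limit_ordinal_def by (metis elts_vempty empty_subsetI ordinal_vempty)

lemma limit_ordinalI:
  assumes "ordinal (x::'v::zfc)" "vempty \<in> elts x" "\<And>y. y \<in> elts x \<Longrightarrow> vsucc y \<in> elts x"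
  shows "limit_ordinal x"
proof -
  have "x \<noteq> vsucc y" for y
  proof
    assume "x = vsucc y"
    then have "y \<in> elts x" by simp
    then have "vsucc y \<in> elts x" by (rule assms(3))
    then show False unfolding \<open>x = vsucc y\<close> by (simp only: mem_irrefl)
  qed
  moreover have "x \<noteq> vempty" using assms(2) by auto
  ultimately show ?thesis unfolding limit_ordinal_def using assms(1) by blast
qed

lemma ordinal_vnat [simp]: "ordinal (vnat n :: 'v::zfc)"
  by (induction n) auto

text \<open>Selects a witness definably, so that replacement can be applied to the selection without
  any choice.\<close>

definition vleast :: "('v::zfc \<Rightarrow> bool) \<Rightarrow> 'v" where
  "vleast Q = vthe (\<lambda>x. ordinal x \<and> Q x \<and> (\<forall>y\<in>elts x. \<not> Q y))"

lemma dterm_vleast [dint]: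
  assumes "dfn P (\<lambda>e. Q (e 0) (sh e))"
  shows "dterm P (\<lambda>e. vleast (\<lambda>x. Q x e))"
  unfolding vleast_def by (intro dint assms dfn_push)

lemma vleast:
  assumes "dfn UNIV (\<lambda>e. Q (e 0))" "ordinal x" "Q (x::'v::zfc)"
  shows "ordinal (vleast Q)" "Q (vleast Q)" "ordinal y \<Longrightarrow> Q y \<Longrightarrow> elts (vleast Q) \<subseteq> elts y"
proof -
  have "\<exists>m. ordinal m \<and> Q m \<and> (\<forall>y\<in>elts m. \<not> Q y)"
  proof (rule ccontr)
    assume no: "\<nexists>m. ordinal m \<and> Q m \<and> (\<forall>y\<in>elts m. \<not> Q y)"
    have "\<not> Q x" using assms(2)
    proof (induction x rule: ordinal_induct)
      case definable
      then show ?case by (intro dint assms)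
    next
      case (step x)
      then show ?case using no by blast
    qed
    with assms(3) show False by blast
  qed
  then obtain m where m: "ordinal m" "Q m" "\<And>y. y \<in> elts m \<Longrightarrow> \<not> Q y" by blast
  have "vleast Q = m" unfolding vleast_def
  proof (rule vthe_eq)
    fix x assume "ordinal x \<and> Q x \<and> (\<forall>y\<in>elts x. \<not> Q y)"
    then show "x = m" using ordinal_linear[of x m] m by blast
  qed (use m in blast)
  then show "ordinal (vleast Q)" "Q (vleast Q)" "ordinal y \<Longrightarrow> Q y \<Longrightarrow> elts (vleast Q) \<subseteq> elts y"
    using m ordinal_not_mem by blast+
qed

section \<open>The natural numbers of the model\<close>

lemma elts_omega: "elts (omega::'v::zfc) =
  {n. \<forall>I. vempty \<in> elts I \<and> (\<forall>y\<in>elts I. vsucc y \<in> elts I) \<longrightarrow> n \<in> elts I}" (is "_ = ?N")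
proof -
  obtain I :: 'v where I: "\<exists>y\<in>elts I. elts y = {}" "\<forall>y\<in>elts I. \<exists>z\<in>elts I. elts z = insert y (elts y)"
    using infinity by blast
  have "vempty \<in> elts I" using I(1) elts_eq_empty by metis
  moreover have "vsucc y \<in> elts I" if "y \<in> elts I" for y
    using I(2) that extensionality by (metis elts_vsucc)
  ultimately have sub: "?N \<subseteq> elts I" by blast
  have "small ?N"
    by (rule small_subset[OF sub], unfold mem_Collect_eq, intro dint)
  then show ?thesis unfolding omega_def by (rule elts_mkset)
qed

lemma dterm_omega [dint]: "dterm P (\<lambda>e. omega :: 'v::zfc)"
  by (rule dterm_set[OF elts_omega], intro dint)

lemma vempty_omega [simp]: "vempty \<in> elts (omega::'v::zfc)"
  unfolding elts_omega by blast

lemma vsucc_omega [simp]: "n \<in> elts (omega::'v::zfc) \<Longrightarrow> vsucc n \<in> elts omega"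
  unfolding elts_omega by blast

lemma vnat_omega [simp]: "vnat n \<in> elts (omega::'v::zfc)"
  by (induction n) auto

text \<open>The set of \<open>n\<close> in \<open>omega\<close> with \<open>Q n\<close> is inductive
  and hence exhausts \<open>omega\<close>. Induction over the type \<open>nat\<close> would miss the
  non-standard elements.\<close>

lemma omega_induct [consumes 1, case_names definable zero succ]:
  assumes "n \<in> elts (omega::'v::zfc)" "dfn UNIV (\<lambda>e. Q (e 0))" "Q vempty"
    and "\<And>n. n \<in> elts omega \<Longrightarrow> Q n \<Longrightarrow> Q (vsucc n)"
  shows "Q n"
proof -
  have "elts (vsep omega Q) = {y \<in> elts omega. Q y}" by (rule elts_vsep[OF assms(2)])
  then have "n \<in> elts (vsep omega Q)"
    using assms unfolding elts_omega[THEN eq_reflection] by auto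
  with \<open>elts (vsep omega Q) = _\<close> show ?thesis by simp
qed

lemma ordinal_of_omega: "n \<in> elts (omega::'v::zfc) \<Longrightarrow> ordinal n"
  by (induction rule: omega_induct) (intro dint, auto)

lemma omega_trans: "n \<in> elts (omega::'v::zfc) \<Longrightarrow> elts n \<subseteq> elts omega"
proof (induction rule: omega_induct)
  case definable
  show ?case by (intro dint)
qed auto

lemma ordinal_omega [simp]: "ordinal (omega::'v::zfc)"
  unfolding ordinal_def
proof (intro conjI ballI)
  fix y z :: 'v assume "y \<in> elts omega" "z \<in> elts omega"
  then show "y \<in> elts z \<or> y = z \<or> z \<in> elts y" by (intro ordinal_linear ordinal_of_omega)
qed (rule omega_trans)

lemma limit_omega [simp]: "limit_ordinal (omega::'v::zfc)"
  by (rule limit_ordinalI) simp_all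

lemma omega_subset_limit:
  assumes "limit_ordinal (x::'v::zfc)" shows "elts omega \<subseteq> elts x"
  using limit_vempty[OF assms] limit_vsucc[OF assms] unfolding elts_omega by blast

lemma omega_cases:
  assumes "n \<in> elts (omega::'v::zfc)"
  obtains "n = vempty" | m where "m \<in> elts omega" "n = vsucc m"
proof -
  have "n = vempty \<or> (\<exists>m\<in>elts omega. n = vsucc m)"
    using assms
  proof (induction rule: omega_induct)
    case definable
    show ?case by (intro dint)
  qed auto
  then show ?thesis using that by blast
qed

lemma vnat_eq_iff [simp]: "vnat m = (vnat n :: 'v::zfc) \<longleftrightarrow> m = n"
proof (induction m arbitrary: n)
  case 0
  then show ?case by (cases n) auto
next
  case (Suc m)
  then show ?case by (cases n) auto
qed


section \<open>Transfinite recursion\<close>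

definition recfun :: "('v::zfc \<Rightarrow> 'v \<Rightarrow> 'v) \<Rightarrow> 'v \<Rightarrow> 'v \<Rightarrow> bool" where
  "recfun H \<theta> f \<longleftrightarrow> fn f \<theta> \<and> (\<forall>\<beta>\<in>elts \<theta>. ap f \<beta> = H \<beta> (restr f \<beta>))"

definition trec :: "('v::zfc \<Rightarrow> 'v \<Rightarrow> 'v) \<Rightarrow> 'v \<Rightarrow> 'v" where
  "trec H \<beta> = (if ordinal \<beta> then H \<beta> (vthe (\<lambda>f. recfun H \<beta> f)) else vempty)"

lemma dterm_appH:
  assumes "dterm P (\<lambda>e. H (e 1) (e 0) (sh (sh e)))" "dterm P s" "dterm P t"
  shows "dterm P (\<lambda>e. H (s e) (t e) e)"
proof -
  define u where "u i = (if i = 0 then t else if i = 1 then s else (\<lambda>e. e (i - 2)))" for i :: nat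
  have "dterm P (u i)" for i unfolding u_def using assms(2,3) by (simp add: dterm_var)
  from dterm_subst[OF assms(1), where t = u, OF this] show ?thesis
    unfolding u_def by (simp add: numeral_2_eq_2)
qed

lemma dfn_recfun:
  assumes "dterm P (\<lambda>e. H (e 1) (e 0) (sh (sh e)))" "dterm P \<theta>" "dterm P f"
  shows "dfn P (\<lambda>e. recfun (\<lambda>\<beta> g. H \<beta> g e) (\<theta> e) (f e))"
proof -
  have "dterm P (\<lambda>e. H (e 1) (e 0) (sh (sh (sh e))))"
    using dterm_ren[OF assms(1), of "\<lambda>i. if i < 2 then i else Suc i"] by simp
  from dterm_appH[of P "\<lambda>\<beta> g e. H \<beta> g (sh e)", OF this, of "\<lambda>e. e 0"
      "\<lambda>e. restr (f (sh e)) (e 0)"] dterm_shift[OF assms(3)]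
  have "dterm P (\<lambda>e. H (e 0) (restr (f (sh e)) (e 0)) (sh e))"
    by (simp add: dterm_restr dterm_var)
  then show ?thesis unfolding recfun_def by (intro dint assms dterm_shift[OF assms(3)])
qed

lemma dterm_trec [dint]:
  assumes "dterm P (\<lambda>e. H (e 1) (e 0) (sh (sh e)))" "dterm P \<theta>"
  shows "dterm P (\<lambda>e. trec (\<lambda>\<beta> g. H \<beta> g e) (\<theta> e))"
proof -
  have "dterm P (\<lambda>e. H (e 1) (e 0) (sh (sh (sh e))))"
    using dterm_ren[OF assms(1), of "\<lambda>i. if i < 2 then i else Suc i"] by simp
  note r = dfn_recfun[of P "\<lambda>\<beta> g e. H \<beta> g (sh e)", OF this dterm_shift[OF assms(2)] dterm_var[of _ 0]]
  show ?thesis unfolding trec_def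
    by (intro dint assms dterm_appH[OF assms(1)] r)
qed

lemma recfun_agree:
  assumes "ordinal \<theta>" "elts \<theta> \<subseteq> elts \<theta>'" "recfun H \<theta> f" "recfun H \<theta>' g"
  shows "f = restr g \<theta>"
proof -
  have f: "fn f \<theta>" and g: "fn g \<theta>'" using assms(3,4) unfolding recfun_def by auto
  have eq: "ap f \<beta> = ap g \<beta>" if "\<beta> \<in> elts \<theta>" for \<beta>
    using assms(1) that
  proof (induction rule: ordinal_mem_induct)
    case definable
    show ?case by (intro dint)
  next
    case (step \<beta>)
    have sub: "elts \<beta> \<subseteq> elts \<theta>'" using step(3) assms(2) by blast
    have "restr f \<beta> = restr g \<beta>"
      by (rule fn_ext[OF fn_restr[OF f step(3)] fn_restr[OF g sub]])
        (simp add: ap_restr[OF f step(3)] ap_restr[OF g sub] step(4))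
    then show "ap f \<beta> = ap g \<beta>" using assms(2-4) step(1) unfolding recfun_def by auto
  qed
  show ?thesis
    by (rule fn_ext[OF f fn_restr[OF g assms(2)]]) (simp add: ap_restr[OF g assms(2)] eq)
qed

lemma restr_self: "fn f A \<Longrightarrow> restr f A = f"
  by (rule fn_ext[of _ A]) (auto intro: fn_restr ap_restr)

lemma recfun_unique: "ordinal \<theta> \<Longrightarrow> recfun H \<theta> f \<Longrightarrow> recfun H \<theta> g \<Longrightarrow> f = g"
  using recfun_agree[of \<theta> \<theta> H f g] restr_self[of g \<theta>] by (simp add: recfun_def)

text \<open>Induction on the length. For \<open>\<beta>\<close> below \<open>\<theta>\<close> the
  induction hypothesis identifies the approximation used in \<open>trec H \<beta>\<close> with the
  collected values below \<open>\<beta>\<close>, which form a set by replacement.\<close>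

lemma recfun_trec:
  assumes H: "dterm UNIV (\<lambda>e. H (e 0) (e 1))" and "ordinal \<theta>"
  shows "recfun H \<theta> (vlam \<theta> (trec H))"
  using assms(2)
proof (induction \<theta> rule: ordinal_induct)
  case definable
  have "dterm UNIV (\<lambda>e. H (e 1) (e 0))" using dterm_ren[OF H, of "\<lambda>i. 1 - i"] by simp
  then show ?case by (intro dfn_recfun[where H = "\<lambda>\<beta> g e. H \<beta> g"] dint)
next
  case (step \<theta>)
  have H': "dterm UNIV (\<lambda>e. H (e 1) (e 0))" using dterm_ren[OF H, of "\<lambda>i. 1 - i"] by simp
  have t: "dterm UNIV (\<lambda>e. trec H (e 0))"
    using dterm_trec[of UNIV "\<lambda>\<beta> g e. H \<beta> g", OF H' dterm_var[of _ 0]] .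
  let ?f = "vlam \<theta> (trec H)"
  have fn: "fn ?f \<theta>" by (rule fn_vlam[OF t])
  have "ap ?f \<beta> = H \<beta> (restr ?f \<beta>)" if b: "\<beta> \<in> elts \<theta>" for \<beta>
  proof -
    have ob: "ordinal \<beta>" and sub: "elts \<beta> \<subseteq> elts \<theta>"
      using ordinal_elem[OF step(1) b] ordinal_subset[OF step(1) b] .
    have "restr ?f \<beta> = vlam \<beta> (trec H)"
    proof (rule fn_ext[OF fn_restr[OF fn sub] fn_vlam[OF t]])
      fix x assume x: "x \<in> elts \<beta>"
      then show "ap (restr ?f \<beta>) x = ap (vlam \<beta> (trec H)) x"
        using ap_restr[OF fn sub x] ap_vlam[OF t x] ap_vlam[OF t, of x \<theta>] sub by auto
    qed
    moreover have "vthe (\<lambda>f. recfun H \<beta> f) = vlam \<beta> (trec H)"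
      using step(2)[OF b] recfun_unique[OF ob] by (intro vthe_eq) auto
    ultimately show ?thesis using ap_vlam[OF t b] ob unfolding trec_def[of H \<beta>] by simp
  qed
  with fn show ?case unfolding recfun_def by blast
qed

lemma trec_eq:
  assumes H: "dterm UNIV (\<lambda>e. H (e 0) (e 1))" and "ordinal \<beta>"
  shows "trec H \<beta> = H \<beta> (vlam \<beta> (trec H))"
proof -
  have "vthe (\<lambda>f. recfun H \<beta> f) = vlam \<beta> (trec H)"
    using recfun_trec[OF assms] recfun_unique[OF assms(2)] by (intro vthe_eq) auto
  then show ?thesis using assms(2) unfolding trec_def[of H \<beta>] by simp
qed

lemma dterm_trec': "dterm UNIV (\<lambda>e. H (e 0) (e 1)) \<Longrightarrow> dterm UNIV (\<lambda>e. trec H (e 0))"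
  using dterm_trec[of UNIV "\<lambda>\<beta> g e. H \<beta> g" "\<lambda>e. e 0"] dterm_ren[of UNIV "\<lambda>e. H (e 0) (e 1)" "\<lambda>i. 1 - i"]
  by (simp add: dterm_var)

text \<open>The definable counterpart of \<open>ord_iter\<close>. At a successor ordinal
  \<open>vUnion \<beta>\<close> is the predecessor.\<close>

definition iter :: "('v::zfc \<Rightarrow> 'v) \<Rightarrow> 'v \<Rightarrow> 'v \<Rightarrow> 'v" where
  "iter s a = trec (\<lambda>\<beta> f. if \<beta> = vempty then a else if limit_ordinal \<beta> then vUN \<beta> (\<lambda>\<delta>. ap f \<delta>)
     else s (ap f (vUnion \<beta>)))"

lemma dterm_iter [dint]:
  assumes "dterm P (\<lambda>e. s (e 0) (sh e))" "dterm P a" "dterm P \<beta>"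
  shows "dterm P (\<lambda>e. iter (\<lambda>x. s x e) (a e) (\<beta> e))"
proof -
  have "dterm P (\<lambda>e. s (e 0) (sh (sh (sh e))))"
    using dterm_ren[OF assms(1), of "\<lambda>i. if i = 0 then i else i + 2"] by simp
  then have "dterm P (\<lambda>e. s (ap (e 0) (vUnion (e 1))) (sh (sh e)))"
    by (intro dterm_let[where s = "\<lambda>x e. s x (sh (sh e))"] dint)
  then show ?thesis unfolding iter_def
    by (intro dterm_trec dint assms dterm_shift[OF dterm_shift[OF assms(2)]])
qed

context
  fixes s :: "'v::zfc \<Rightarrow> 'v" and a :: 'v
  assumes s: "dterm UNIV (\<lambda>e. s (e 0))"
begin

lemma iter_H: "dterm UNIV (\<lambda>e. if e 0 = vempty then a else if limit_ordinal (e 0)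
    then vUN (e 0) (\<lambda>\<delta>. ap (e 1) \<delta>) else s (ap (e 1) (vUnion (e 0))))"
  by (intro dint dterm_app1[OF s])

lemma dterm_iter1: "dterm UNIV (\<lambda>e. iter s a (e 0))"
  by (intro dterm_iter[where s = "\<lambda>x e. s x"] dint s)

lemma iter_vempty: "iter s a vempty = a"
  unfolding iter_def by (subst trec_eq[OF iter_H]) simp_all

lemma iter_vsucc: "ordinal \<beta> \<Longrightarrow> iter s a (vsucc \<beta>) = s (iter s a \<beta>)"
  unfolding iter_def
  by (subst trec_eq[OF iter_H], simp) (simp add: vUnion_vsucc ap_vlam[OF dterm_trec'[OF iter_H]])

lemma iter_limit: "limit_ordinal \<beta> \<Longrightarrow> elts (iter s a \<beta>) = (\<Union>\<delta>\<in>elts \<beta>. elts (iter s a \<delta>))"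
proof -
  assume l: "limit_ordinal \<beta>"
  then have "\<beta> \<noteq> vempty" by (metis not_limit(1))
  with l have "iter s a \<beta> = vUN \<beta> (\<lambda>\<delta>. ap (vlam \<beta> (iter s a)) \<delta>)"
    unfolding iter_def by (subst trec_eq[OF iter_H limit_ordinal_ordinal[OF l]]) simp
  moreover have "dterm UNIV (\<lambda>e. ap (vlam \<beta> (iter s a)) (e 0))" by (intro dint)
  ultimately show ?thesis by (simp add: elts_vUN ap_vlam[OF dterm_iter1])
qed

text \<open>The graph of \<open>iter\<close> on \<open>vsucc \<beta>\<close> witnesses existence;
  conversely the three clauses determine the values of any candidate by induction.\<close>

lemma ord_iter_eq_iter:
  assumes b: "ordinal \<beta>" shows "ord_iter s a \<beta> = iter s a \<beta>"
  unfolding ord_iter_def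
proof (rule the_equality)
  let ?f = "vlam (vsucc \<beta>) (iter s a)" and ?B = "vimage (iter s a) (vsucc \<beta>)"
  have f: "is_fun ?f (vsucc \<beta>) ?B"
    by (rule is_fun_vlam[OF dterm_iter1], unfold elts_vimage[OF dterm_iter1]) (rule imageI)
  have ap: "app ?f \<gamma> = iter s a \<gamma>" if "\<gamma> \<in> elts (vsucc \<beta>)" for \<gamma>
    using that is_fun_app[OF f that] ap_vlam[OF dterm_iter1 that] by simp
  have 0: "vempty \<in> elts (vsucc \<beta>)"
    using ordinal_subset_iff[of vempty "\<beta>"] b by auto
  show "\<exists>f B. is_fun f (vsucc \<beta>) B \<and> app f vempty = a \<and>
      (\<forall>\<gamma>\<in>elts \<beta>. app f (vsucc \<gamma>) = s (app f \<gamma>)) \<and>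
      (\<forall>\<gamma>\<in>elts (vsucc \<beta>). limit_ordinal \<gamma> \<longrightarrow> elts (app f \<gamma>) = (\<Union>\<delta>\<in>elts \<gamma>. elts (app f \<delta>))) \<and>
      iter s a \<beta> = app f \<beta>"
  proof (intro exI conjI ballI impI, rule f)
    show "app ?f vempty = a" by (simp add: ap[OF 0] iter_vempty)
    show "app ?f (vsucc \<gamma>) = s (app ?f \<gamma>)" if g: "\<gamma> \<in> elts \<beta>" for \<gamma>
      using ap[of \<gamma>] ap[OF vsucc_mem_vsucc[OF b g]] g iter_vsucc[OF ordinal_elem[OF b g]] by simp
    show "elts (app ?f \<gamma>) = (\<Union>\<delta>\<in>elts \<gamma>. elts (app ?f \<delta>))"
      if g: "\<gamma> \<in> elts (vsucc \<beta>)" "limit_ordinal \<gamma>" for \<gamma>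
    proof -
      have "app ?f \<delta> = iter s a \<delta>" if "\<delta> \<in> elts \<gamma>" for \<delta>
        using ordinal_mem_trans[OF ordinal_vsucc[OF b] g(1) that] by (rule ap)
      then show ?thesis using ap[OF g(1)] iter_limit[OF g(2)] by simp
    qed
    show "iter s a \<beta> = app ?f \<beta>" by (simp add: ap)
  qed
next
  fix x
  assume "\<exists>f B. is_fun f (vsucc \<beta>) B \<and> app f vempty = a \<and>
      (\<forall>\<gamma>\<in>elts \<beta>. app f (vsucc \<gamma>) = s (app f \<gamma>)) \<and>
      (\<forall>\<gamma>\<in>elts (vsucc \<beta>). limit_ordinal \<gamma> \<longrightarrow> elts (app f \<gamma>) = (\<Union>\<delta>\<in>elts \<gamma>. elts (app f \<delta>))) \<and>
      x = app f \<beta>"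
  then obtain f B where f: "is_fun f (vsucc \<beta>) B" and f0: "app f vempty = a"
    and fs: "\<And>\<gamma>. \<gamma> \<in> elts \<beta> \<Longrightarrow> app f (vsucc \<gamma>) = s (app f \<gamma>)"
    and fl: "\<And>\<gamma>. \<gamma> \<in> elts (vsucc \<beta>) \<Longrightarrow> limit_ordinal \<gamma> \<Longrightarrow> elts (app f \<gamma>) = (\<Union>\<delta>\<in>elts \<gamma>. elts (app f \<delta>))"
    and x: "x = app f \<beta>" by blast
  note app = is_fun_app[OF f]
  have "ap f \<gamma> = iter s a \<gamma>" if "\<gamma> \<in> elts (vsucc \<beta>)" for \<gamma>
    using ordinal_vsucc[OF b] that
  proof (induction rule: ordinal_mem_induct)
    case definable
    show ?case by (intro dint dterm_iter1)
  next
    case (step \<gamma>)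
    note g = step(1)
    have IH: "ap f \<delta> = iter s a \<delta>" "\<delta> \<in> elts (vsucc \<beta>)" if "\<delta> \<in> elts \<gamma>" for \<delta>
      using step(4)[OF that] step(3) that by blast+
    from step(2) show ?case
    proof (cases rule: ordinal_cases)
      case 1
      then show ?thesis using f0 app[OF g] iter_vempty by simp
    next
      case (2 \<delta>)
      then have d: "\<delta> \<in> elts \<gamma>" by simp
      have "\<delta> \<in> elts \<beta>" using g d 2 ordinal_subset[OF b, of \<gamma>] by auto
      then show ?thesis using fs[of \<delta>] IH[OF d] iter_vsucc[OF 2(1)] app[OF g] app[OF IH(2)[OF d]] 2 by simp
    next
      case 3
      have "elts (ap f \<gamma>) = (\<Union>\<delta>\<in>elts \<gamma>. elts (app f \<delta>))" using fl[OF g 3] app[OF g] by simp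
      also have "\<dots> = (\<Union>\<delta>\<in>elts \<gamma>. elts (iter s a \<delta>))" using IH app by auto
      finally show ?thesis using iter_limit[OF 3] extensionality by metis
    qed
  qed
  then show "x = iter s a \<beta>" using x app[of \<beta>] by simp
qed

end

lemma ordinal_induct3 [consumes 1, case_names definable zero succ limit]:
  assumes "ordinal (x::'v::zfc)" "dfn UNIV (\<lambda>e. Q (e 0))" "Q vempty"
    and "\<And>x. ordinal x \<Longrightarrow> Q x \<Longrightarrow> Q (vsucc x)"
    and "\<And>x. limit_ordinal x \<Longrightarrow> (\<And>y. y \<in> elts x \<Longrightarrow> Q y) \<Longrightarrow> Q x"
  shows "Q x"
  using assms(1)
proof (induction x rule: ordinal_induct)
  case definable
  show ?case by (rule assms(2))
next
  case (step x)
  from step(1) show ?case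
    by (cases rule: ordinal_cases) (use step(2) assms(3-) in auto)
qed


section \<open>Ordinal arithmetic\<close>

definition oadd :: "'v::zfc \<Rightarrow> 'v \<Rightarrow> 'v" where
  "oadd a b = iter vsucc a b"

lemma dterm_oadd [dint]: "dterm P s \<Longrightarrow> dterm P t \<Longrightarrow> dterm P (\<lambda>e. oadd (s e) (t e))"
  unfolding oadd_def by (intro dint)

definition omult :: "'v::zfc \<Rightarrow> 'v \<Rightarrow> 'v" where
  "omult a b = iter (\<lambda>x. oadd x a) vempty b"

lemma dterm_omult [dint]: "dterm P s \<Longrightarrow> dterm P t \<Longrightarrow> dterm P (\<lambda>e. omult (s e) (t e))"
  unfolding omult_def by (intro dint dterm_shift[of P s])

lemma ord_add_eq: "ordinal b \<Longrightarrow> ord_add a b = oadd a (b::'v::zfc)"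
  unfolding ord_add_def oadd_def by (rule ord_iter_eq_iter) (intro dint)

lemma ord_mult_eq: "ordinal a \<Longrightarrow> ordinal b \<Longrightarrow> ord_mult a b = omult a (b::'v::zfc)"
  unfolding ord_mult_def omult_def by (simp add: ord_add_eq, rule ord_iter_eq_iter) (intro dint)

lemma oadd_vempty [simp]: "oadd a vempty = a"
  unfolding oadd_def by (rule iter_vempty) (intro dint)

lemma oadd_vsucc [simp]: "ordinal b \<Longrightarrow> oadd a (vsucc b) = vsucc (oadd a b)"
  unfolding oadd_def by (rule iter_vsucc) (intro dint)

lemma elts_oadd_limit: "limit_ordinal b \<Longrightarrow> elts (oadd a b) = (\<Union>x\<in>elts b. elts (oadd a x))"
  unfolding oadd_def by (rule iter_limit) (intro dint)

lemma omult_vempty [simp]: "omult a vempty = vempty"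
  unfolding omult_def by (rule iter_vempty) (intro dint)

lemma omult_vsucc [simp]: "ordinal b \<Longrightarrow> omult a (vsucc b) = oadd (omult a b) a"
  unfolding omult_def by (rule iter_vsucc) (intro dint)

lemma elts_omult_limit: "limit_ordinal b \<Longrightarrow> elts (omult a b) = (\<Union>x\<in>elts b. elts (omult a x))"
  unfolding omult_def by (rule iter_limit) (intro dint)

lemma ordinal_oadd [simp]:
  assumes "ordinal a" "ordinal b" shows "ordinal (oadd a b)"
  using assms(2)
proof (induction b rule: ordinal_induct3)
  case definable
  show ?case by (intro dint)
next
  case (limit x)
  show ?case by (rule ordinal_UN[of "oadd a ` elts x"]) (use limit in \<open>auto simp: elts_oadd_limit\<close>)
qed (use assms in simp_all)

lemma ordinal_omult [simp]:
  assumes "ordinal a" "ordinal b" shows "ordinal (omult a b)"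
  using assms(2)
proof (induction b rule: ordinal_induct3)
  case definable
  show ?case by (intro dint)
next
  case (limit x)
  show ?case by (rule ordinal_UN[of "omult a ` elts x"]) (use limit in \<open>auto simp: elts_omult_limit\<close>)
qed (use assms in simp_all)

lemma oadd_less:
  assumes "ordinal b" shows "x \<in> elts b \<Longrightarrow> oadd a x \<in> elts (oadd a b)"
proof -
  have "\<forall>x\<in>elts b. oadd a x \<in> elts (oadd a b)"
    using assms
  proof (induction b rule: ordinal_induct3)
    case definable
    show ?case by (intro dint)
  next
    case (limit b)
    show ?case
    proof
      fix x assume x: "x \<in> elts b"
      have "ordinal x" using ordinal_elem[OF limit_ordinal_ordinal[OF limit(1)] x] .
      then have "oadd a x \<in> elts (oadd a (vsucc x))" by simp
      then show "oadd a x \<in> elts (oadd a b)"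
        using limit_vsucc[OF limit(1) x] unfolding elts_oadd_limit[OF limit(1)] by blast
    qed
  qed auto
  then show "x \<in> elts b \<Longrightarrow> oadd a x \<in> elts (oadd a b)" by blast
qed

text \<open>For games this splits the indices into an opening of length \<open>a\<close> and a
  shifted copy of \<open>b\<close>, which is how \<open>strategy_tail\<close> locates moves.\<close>

lemma elts_oadd:
  assumes "ordinal b" shows "elts (oadd a b) = elts a \<union> oadd a ` elts b"
proof -
  have "\<forall>x. x \<in> elts (oadd a b) \<longleftrightarrow> x \<in> elts a \<or> (\<exists>y\<in>elts b. x = oadd a y)"
    using assms
  proof (induction b rule: ordinal_induct3)
    case definable
    show ?case by (intro dint)
  next
    case (limit b)
    show ?case
    proof
      fix x
      show "x \<in> elts (oadd a b) \<longleftrightarrow> x \<in> elts a \<or> (\<exists>y\<in>elts b. x = oadd a y)" (is "_ \<longleftrightarrow> ?R")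
      proof
        assume "x \<in> elts (oadd a b)"
        then obtain y where y: "y \<in> elts b" "x \<in> elts (oadd a y)" unfolding elts_oadd_limit[OF limit(1)] by blast
        then show ?R using limit(2)[OF y(1)] ordinal_mem_trans[OF limit_ordinal_ordinal[OF limit(1)] y(1)] by blast
      next
        assume ?R
        then show "x \<in> elts (oadd a b)"
        proof
          assume "x \<in> elts a"
          then have "x \<in> elts (oadd a vempty)" by simp
          then show ?thesis using limit_vempty[OF limit(1)] unfolding elts_oadd_limit[OF limit(1)] by blast
        next
          assume "\<exists>y\<in>elts b. x = oadd a y"
          then show ?thesis using oadd_less[OF limit_ordinal_ordinal[OF limit(1)]] by blast
        qed
      qed
    qed
  qed auto
  then show ?thesis by auto
qed

lemma oadd_inject:
  assumes "ordinal b" "ordinal c" shows "oadd a b = oadd a c \<longleftrightarrow> b = c"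
  using oadd_less[of b c a] oadd_less[of c b a] ordinal_linear[of b c] assms mem_irrefl[of "oadd a b"] by auto

lemma limit_oadd:
  assumes "ordinal a" "limit_ordinal b" shows "limit_ordinal (oadd a b)"
proof (rule limit_ordinalI)
  have b: "ordinal b" using assms(2) by (rule limit_ordinal_ordinal)
  show o: "ordinal (oadd a b)" using assms(1) b by simp
  have "oadd a b \<noteq> vempty" using oadd_less[OF b limit_vempty[OF assms(2)], of a] by auto
  then show "vempty \<in> elts (oadd a b)"
    using ordinal_subset_iff[OF ordinal_vempty o] by (metis elts_vempty empty_subsetI)
  show "vsucc y \<in> elts (oadd a b)" if "y \<in> elts (oadd a b)" for y
  proof -
    obtain x where x: "x \<in> elts b" "y \<in> elts (oadd a x)"
      using \<open>y \<in> elts (oadd a b)\<close> unfolding elts_oadd_limit[OF assms(2)] by blast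
    have "ordinal x" using ordinal_elem[OF b x(1)] .
    then have "vsucc y \<in> elts (oadd a (vsucc x))" using vsucc_mem_vsucc[OF _ x(2)] assms(1) by simp
    then show ?thesis using limit_vsucc[OF assms(2) x(1)] unfolding elts_oadd_limit[OF assms(2)] by blast
  qed
qed

lemma vempty_oadd: "ordinal b \<Longrightarrow> oadd vempty b = b"
proof (induction b rule: ordinal_induct3)
  case definable
  show ?case by (intro dint)
next
  case (limit b)
  show ?case
  proof (rule v_eqI)
    fix z
    have "elts (oadd vempty b) = (\<Union>x\<in>elts b. elts x)" using limit by (simp add: elts_oadd_limit)
    then show "z \<in> elts (oadd vempty b) \<longleftrightarrow> z \<in> elts b"
      using limit_vsucc[OF limit(1), of z] ordinal_mem_trans[OF limit_ordinal_ordinal[OF limit(1)]]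
      by (auto intro: bexI[of _ "vsucc z"])
  qed
qed simp_all

lemma omult_mono:
  assumes "ordinal a" "ordinal b" "x \<in> elts b" shows "elts (omult a x) \<subseteq> elts (omult a b)"
proof -
  have "\<forall>x\<in>elts b. elts (omult a x) \<subseteq> elts (omult a b)"
    using assms(2)
  proof (induction b rule: ordinal_induct3)
    case definable
    show ?case by (intro dint)
  next
    case (succ b)
    then show ?case using assms(1) by (auto simp: elts_oadd)
  next
    case (limit b)
    then show ?case by (auto simp: elts_omult_limit)
  qed auto
  then show ?thesis using assms(3) by blast
qed

lemma oadd_omega: "m \<in> elts omega \<Longrightarrow> n \<in> elts omega \<Longrightarrow> oadd n m \<in> elts omega"
  by (induction m rule: omega_induct) (intro dint, simp_all add: ordinal_of_omega)

lemma omult_omega: "m \<in> elts omega \<Longrightarrow> n \<in> elts omega \<Longrightarrow> omult n m \<in> elts omega"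
  by (induction m rule: omega_induct) (intro dint, simp_all add: ordinal_of_omega oadd_omega)

text \<open>Uniqueness of division by m with remainder: if j < j', the first value is below m (j +
  1), which is at most m j' and hence at most the second value.\<close>

lemma omult_oadd_inject:
  assumes "ordinal m" "ordinal j" "ordinal j'" "i \<in> elts m" "i' \<in> elts m"
    and eq: "oadd (omult m j) i = oadd (omult m j') i'"
  shows "i = i' \<and> j = j'"
proof -
  have less: "oadd (omult m j) i \<in> elts (oadd (omult m j') i')"
    if "ordinal j" "ordinal j'" "i \<in> elts m" "i' \<in> elts m" "j \<in> elts j'" for i i' j j'
  proof -
    have "oadd (omult m j) i \<in> elts (omult m (vsucc j))"
      using that oadd_less[OF assms(1)] by simp
    also have "vsucc j \<in> elts j' \<or> vsucc j = j'"
      using ordinal_subset_iff[of "vsucc j" j'] vsucc_subset[of j' j] that by simp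
    then have "elts (omult m (vsucc j)) \<subseteq> elts (omult m j')"
      using omult_mono[OF assms(1) that(2)] by auto
    also have "\<dots> \<subseteq> elts (oadd (omult m j') i')"
      using ordinal_elem[OF assms(1) that(4)] by (simp add: elts_oadd)
    finally show ?thesis .
  qed
  have "j = j'"
    using less[of j j' i i'] less[of j' j i' i] assms ordinal_linear[of j j'] mem_irrefl[of "oadd (omult m j) i"]
    by auto
  with eq show ?thesis
    using oadd_inject[of i i'] ordinal_elem[OF assms(1)] assms(4,5) by simp
qed

lemma vnat2: "vnat 2 = (vsucc (vsucc vempty) :: 'v::zfc)"
  by (simp add: numeral_2_eq_2)

lemma oadd_vnat2: "oadd x (vnat 2) = vsucc (vsucc x)"
  by (simp add: vnat2)

lemma omult_inject:
  assumes "ordinal j" "ordinal j'" "omult (vnat 2) j = omult (vnat 2) j'" shows "j = j'"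
  using omult_oadd_inject[of "vnat 2" j j' vempty vempty] assms by (simp add: vnat2)

text \<open>For 0 and 1 it fails, since there \<omega> and \<omega> + 1 face 0 and \<omega>. The
  induction really starts at 2; a later successor step adds 1 on the left but \<omega> on the
  right.\<close>

lemma omega_oadd_subset_omult:
  assumes "ordinal (\<alpha>::'v::zfc)" "\<alpha> \<noteq> vempty" "\<alpha> \<noteq> vsucc vempty"
  shows "elts (oadd omega \<alpha>) \<subseteq> elts (omult omega \<alpha>)"
proof -
  have one: "omult omega (vsucc vempty) = (omega :: 'v)" by (simp add: vempty_oadd)
  have "\<alpha> \<noteq> vempty \<longrightarrow> \<alpha> \<noteq> vsucc vempty \<longrightarrow> elts (oadd omega \<alpha>) \<subseteq> elts (omult omega \<alpha>)"
    using assms(1)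
  proof (induction \<alpha> rule: ordinal_induct3)
    case definable
    show ?case by (intro dint)
  next
    case (succ b)
    show ?case
    proof (intro impI)
      assume "vsucc b \<noteq> vsucc vempty"
      then have b0: "b \<noteq> vempty" by auto
      show "elts (oadd omega (vsucc b)) \<subseteq> elts (omult omega (vsucc b))"
      proof (cases "b = vsucc vempty")
        case True
        have "oadd omega (vnat n) \<in> elts (oadd omega omega)" for n :: nat
          by (rule oadd_less) simp_all
        then have "vnat 2 \<in> elts (omega :: 'v)" "oadd omega (vnat 2) \<in> elts (oadd omega (omega :: 'v))" by simp_all
        moreover have "elts (omult omega (vsucc b)) = elts (oadd omega (omega::'v))"
          using one succ(1) by (simp add: True)
        ultimately show ?thesis using ordinal_subset[of "oadd omega omega" "oadd omega (vnat 2)"] True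
          by (simp add: vnat2)
      next
        case False
        then have IH: "elts (oadd omega b) \<subseteq> elts (omult omega b)" using succ b0 by blast
        have "oadd omega b \<in> elts (vsucc (omult omega b))"
          using IH ordinal_subset_iff[of "oadd omega b" "omult omega b"] succ(1) by auto
        moreover have "elts (vsucc (omult omega b)) \<subseteq> elts (oadd (omult omega b) omega)"
          using oadd_less[of omega "vsucc vempty" "omult omega b"] ordinal_subset succ(1)
          by (metis oadd_vempty oadd_vsucc ordinal_oadd ordinal_omega ordinal_omult ordinal_vempty
              vempty_omega vsucc_omega)
        ultimately have "oadd omega b \<in> elts (omult omega (vsucc b))" using succ(1) by auto
        then show ?thesis using vsucc_subset[of "omult omega (vsucc b)"] succ(1) by simp
      qed
    qed
  next
    case (limit b)
    show ?case
    proof (intro impI subsetI)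
      fix z assume "z \<in> elts (oadd omega b)"
      then obtain x where x: "x \<in> elts b" "z \<in> elts (oadd omega x)"
        unfolding elts_oadd_limit[OF limit(1)] by blast
      \<comment> \<open>The maximum of \<open>x\<close> and 2, as the induction hypothesis is void
        for 0 and 1.\<close>
      define y where "y = vun x (vnat 2)"
      have ox: "ordinal x" using ordinal_elem[OF limit_ordinal_ordinal[OF limit(1)] x(1)] .
      have y: "y = x \<or> y = vnat 2"
      proof -
        consider "elts x \<subseteq> elts (vnat 2)" | "elts (vnat 2) \<subseteq> elts x"
          using ordinal_linear[OF ox ordinal_vnat[of 2]] ordinal_subset[OF ox, of "vnat 2"]
            ordinal_subset[OF ordinal_vnat[of 2], of x] by blast
        then show ?thesis unfolding y_def by cases (metis elts_vun extensionality sup.absorb1 sup.absorb2)+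
      qed
      have "vnat 2 \<in> elts b" using omega_subset_limit[OF limit(1)] vnat_omega by blast
      then have yb: "y \<in> elts b" using y x(1) by auto
      have "oadd omega x \<in> elts (oadd omega y) \<or> oadd omega x = oadd omega y"
        using ordinal_subset_iff[OF ox, of y] oadd_less[of y x] ordinal_elem[OF limit_ordinal_ordinal[OF limit(1)] yb]
        unfolding y_def by auto
      then have "z \<in> elts (oadd omega y)"
        using x(2) ordinal_mem_trans ordinal_elem[OF limit_ordinal_ordinal[OF limit(1)] yb]
        by (metis ordinal_oadd ordinal_omega)
      moreover have "vempty \<in> elts y" "vsucc vempty \<in> elts y" unfolding y_def by (simp_all add: vnat2)
      then have "y \<noteq> vempty" "y \<noteq> vsucc vempty" by auto
      ultimately have "z \<in> elts (omult omega y)" using limit(2)[OF yb] by blast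
      then show "z \<in> elts (omult omega b)" unfolding elts_omult_limit[OF limit(1)] using yb by blast
    qed
  qed simp
  then show ?thesis using assms by blast
qed


section \<open>Turns\<close>

lemma first_turn_iff: "first_turn \<beta> \<longleftrightarrow> (\<exists>\<mu> n. (\<mu> = vempty \<or> limit_ordinal \<mu>) \<and> n \<in> elts omega \<and>
     \<beta> = oadd \<mu> (omult (vnat 2) (n::'v::zfc)))"
proof -
  have "ord_add \<mu> (ord_mult (vnat 2) n) = oadd \<mu> (omult (vnat 2) n)" if "n \<in> elts omega" for \<mu> n :: 'v
    using ordinal_of_omega[OF that] by (simp add: ord_mult_eq ord_add_eq)
  then show ?thesis unfolding first_turn_def by metis
qed

lemma dfn_first_turn [dint]:
  assumes "dterm P s" shows "dfn P (\<lambda>e. first_turn (s e :: 'v::zfc))"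
  by (rule dfn1I[OF _ assms], unfold first_turn_iff, intro dint)

lemma second_turn_iff: "second_turn \<beta> \<longleftrightarrow> (\<exists>\<gamma>. first_turn \<gamma> \<and> \<beta> = vsucc (\<gamma>::'v::zfc))"
  unfolding second_turn_def first_turn_def by blast

lemma dfn_second_turn [dint]:
  assumes "dterm P s" shows "dfn P (\<lambda>e. second_turn (s e :: 'v::zfc))"
  by (rule dfn1I[OF _ assms], unfold second_turn_iff, intro dint)

lemma first_turn_even: "n \<in> elts omega \<Longrightarrow> first_turn (omult (vnat 2) (n::'v::zfc))"
  unfolding first_turn_iff using vempty_oadd[of "omult (vnat 2) n"] ordinal_of_omega[of n]
  by (intro exI[of _ vempty] exI[of _ n]) simp

lemma first_turn_limit: "\<mu> = vempty \<or> limit_ordinal \<mu> \<Longrightarrow> first_turn (\<mu>::'v::zfc)"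
  unfolding first_turn_iff by (intro exI[of _ \<mu>] exI[of _ vempty]) simp

lemma oadd_omult_vsucc:
  "n \<in> elts omega \<Longrightarrow> oadd \<mu> (omult (vnat 2) (vsucc n)) = vsucc (vsucc (oadd \<mu> (omult (vnat 2) (n::'v::zfc))))"
  using ordinal_of_omega[of n] by (simp add: oadd_vnat2)

lemma first_turn_vsucc_vsucc: "first_turn \<beta> \<Longrightarrow> first_turn (vsucc (vsucc (\<beta>::'v::zfc)))"
  unfolding first_turn_iff using oadd_omult_vsucc by (metis vsucc_omega)

lemma first_turn_cases:
  assumes "first_turn (\<beta>::'v::zfc)"
  obtains "\<beta> = vempty \<or> limit_ordinal \<beta>" | \<gamma> where "first_turn \<gamma>" "\<beta> = vsucc (vsucc \<gamma>)"
proof -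
  obtain \<mu> n where *: "\<mu> = vempty \<or> limit_ordinal \<mu>" "n \<in> elts omega" "\<beta> = oadd \<mu> (omult (vnat 2) n)"
    using assms unfolding first_turn_iff by blast
  from *(2) show ?thesis
  proof (cases rule: omega_cases)
    case 1
    then show ?thesis using * that(1) by simp
  next
    case (2 m)
    then show ?thesis using that(2)[of "oadd \<mu> (omult (vnat 2) m)"] * oadd_omult_vsucc[OF 2(1)]
      unfolding first_turn_iff by blast
  qed
qed

text \<open>Adding two does not change whose turn it is, which settles successors. The successor of
  0 or of a limit is neither 0, nor a limit, nor a double successor, so it is not a first
  turn.\<close>

lemma first_turn_vsucc: "ordinal (\<beta>::'v::zfc) \<Longrightarrow> first_turn (vsucc \<beta>) \<longleftrightarrow> \<not> first_turn \<beta>"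
proof (induction \<beta> rule: ordinal_induct3)
  case definable
  show ?case by (intro dint)
next
  case zero
  show ?case using first_turn_cases[of "vsucc vempty"] first_turn_limit[of vempty] by force
next
  case (succ x)
  have "first_turn (vsucc (vsucc x)) \<longleftrightarrow> first_turn x"
    using first_turn_cases[of "vsucc (vsucc x)"] first_turn_vsucc_vsucc[of x] by force
  then show ?case using succ by blast
next
  case (limit x)
  then show ?case using first_turn_cases[of "vsucc x"] first_turn_limit[of x] by force
qed

lemma second_turn_iff_not_first:
  assumes "ordinal (\<beta>::'v::zfc)" shows "second_turn \<beta> \<longleftrightarrow> \<not> first_turn \<beta>"
  using assms
proof (cases rule: ordinal_cases)
  case (2 \<gamma>)
  then show ?thesis using first_turn_vsucc[of \<gamma>] unfolding second_turn_iff by auto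
qed (use first_turn_limit[of \<beta>] in \<open>auto simp: second_turn_iff\<close>)

lemma first_turn_oadd:
  assumes "limit_ordinal (a::'v::zfc)" "ordinal \<beta>" shows "first_turn (oadd a \<beta>) \<longleftrightarrow> first_turn \<beta>"
  using assms(2)
proof (induction \<beta> rule: ordinal_induct3)
  case definable
  show ?case by (intro dint)
next
  case zero
  show ?case using assms(1) first_turn_limit[of a] first_turn_limit[of vempty] by simp
next
  case (succ x)
  then show ?case using limit_ordinal_ordinal[OF assms(1)] by (simp add: first_turn_vsucc)
next
  case (limit x)
  then show ?case using limit_oadd[OF limit_ordinal_ordinal[OF assms(1)]] first_turn_limit by blast
qed


section \<open>The cumulative hierarchy\<close>

definition vlev :: "'v::zfc \<Rightarrow> 'v" where
  "vlev \<mu> = iter vpow vempty \<mu>"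

lemma dterm_vlev [dint]: "dterm P s \<Longrightarrow> dterm P (\<lambda>e. vlev (s e))"
  unfolding vlev_def by (intro dint)

abbreviation V :: "'v::zfc \<Rightarrow> 'v set" where
  "V \<mu> \<equiv> elts (vlev \<mu>)"

lemma Vlevel_eq: "ordinal \<mu> \<Longrightarrow> Vlevel \<mu> = vlev (\<mu>::'v::zfc)"
  unfolding Vlevel_def vlev_def by (rule ord_iter_eq_iter) (intro dint)

lemma elts_vlev_vempty: "V (vempty::'v::zfc) = {}"
  unfolding vlev_def by (subst iter_vempty) (intro dint, simp)

lemma elts_vlev_vsucc: "ordinal \<mu> \<Longrightarrow> V (vsucc \<mu>) = {x. elts x \<subseteq> V (\<mu>::'v::zfc)}"
  unfolding vlev_def by (subst iter_vsucc) (intro dint, simp_all)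

lemma elts_vlev_limit: "limit_ordinal \<mu> \<Longrightarrow> V \<mu> = (\<Union>x\<in>elts \<mu>. V (x::'v::zfc))"
  unfolding vlev_def by (rule iter_limit) (intro dint)

lemma vlev_trans_mono:
  assumes "ordinal (\<mu>::'v::zfc)"
  shows "(\<forall>x\<in>V \<mu>. elts x \<subseteq> V \<mu>) \<and> (\<forall>\<gamma>\<in>elts \<mu>. V \<gamma> \<subseteq> V \<mu>)"
  using assms
proof (induction \<mu> rule: ordinal_induct3)
  case definable
  show ?case by (intro dint)
next
  case (succ \<mu>)
  then show ?case by (auto simp: elts_vlev_vsucc subset_iff)
next
  case (limit \<mu>)
  show ?case
  proof (intro conjI ballI subsetI)
    fix x y assume "x \<in> V \<mu>" "y \<in> elts x"
    then show "y \<in> V \<mu>" unfolding elts_vlev_limit[OF limit(1)] using limit(2) by blast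
  next
    fix \<gamma> x assume "\<gamma> \<in> elts \<mu>" "x \<in> V \<gamma>"
    then show "x \<in> V \<mu>" unfolding elts_vlev_limit[OF limit(1)] by blast
  qed
qed (simp_all add: elts_vlev_vempty)

lemma vlev_trans: "ordinal (\<mu>::'v::zfc) \<Longrightarrow> x \<in> V \<mu> \<Longrightarrow> y \<in> elts x \<Longrightarrow> y \<in> V \<mu>"
  using vlev_trans_mono by blast

lemma vlev_mono:
  assumes "ordinal (\<mu>::'v::zfc)" "ordinal \<gamma>" "elts \<gamma> \<subseteq> elts \<mu>" shows "V \<gamma> \<subseteq> V \<mu>"
  using vlev_trans_mono[OF assms(1)] ordinal_subset_iff[OF assms(2,1)] assms(3) by blast

lemma vlev_limit_mem:
  assumes "limit_ordinal (\<mu>::'v::zfc)" "\<gamma> \<in> elts \<mu>" "elts x \<subseteq> V \<gamma>" shows "x \<in> V \<mu>"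
proof -
  have "x \<in> V (vsucc \<gamma>)"
    using elts_vlev_vsucc[OF ordinal_elem[OF limit_ordinal_ordinal[OF assms(1)] assms(2)]] assms(3) by blast
  then show ?thesis using limit_vsucc[OF assms(1,2)] unfolding elts_vlev_limit[OF assms(1)] by blast
qed

lemma ordinal_chain2:
  assumes "ordinal (\<mu>::'v::zfc)" "\<gamma> \<in> elts \<mu>" "\<delta> \<in> elts \<mu>"
  obtains \<epsilon> where "\<epsilon> \<in> elts \<mu>" "elts \<gamma> \<subseteq> elts \<epsilon>" "elts \<delta> \<subseteq> elts \<epsilon>"
proof -
  have o: "ordinal \<gamma>" "ordinal \<delta>" using ordinal_elem[OF assms(1)] assms(2,3) by blast+
  consider "elts \<gamma> \<subseteq> elts \<delta>" | "elts \<delta> \<subseteq> elts \<gamma>"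
    using ordinal_linear[OF o] ordinal_subset[OF o(1), of \<delta>] ordinal_subset[OF o(2), of \<gamma>] by blast
  then show ?thesis using that[of \<gamma>] that[of \<delta>] assms(2,3) by cases blast+
qed

lemma vlev_limit_vun:
  assumes "limit_ordinal (\<mu>::'v::zfc)" "x \<in> V \<mu>" "y \<in> V \<mu>"
  shows "vun x y \<in> V \<mu>" "upair x y \<in> V \<mu>"
proof -
  have o: "ordinal \<mu>" using assms(1) by (rule limit_ordinal_ordinal)
  obtain \<gamma> \<delta> where gd: "\<gamma> \<in> elts \<mu>" "x \<in> V \<gamma>" "\<delta> \<in> elts \<mu>" "y \<in> V \<delta>"
    using assms unfolding elts_vlev_limit[OF assms(1)] by blast
  obtain \<epsilon> where e0: "\<epsilon> \<in> elts \<mu>" "elts \<gamma> \<subseteq> elts \<epsilon>" "elts \<delta> \<subseteq> elts \<epsilon>"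
    by (rule ordinal_chain2[OF o gd(1,3)])
  have e: "\<epsilon> \<in> elts \<mu>" "x \<in> V \<epsilon>" "y \<in> V \<epsilon>"
    using gd e0 vlev_mono[OF ordinal_elem[OF o e0(1)] ordinal_elem[OF o gd(1)] e0(2)]
      vlev_mono[OF ordinal_elem[OF o e0(1)] ordinal_elem[OF o gd(3)] e0(3)] by blast+
  then have "elts x \<subseteq> V \<epsilon>" "elts y \<subseteq> V \<epsilon>"
    using vlev_trans[OF ordinal_elem[OF o e(1)]] by blast+
  then show "vun x y \<in> V \<mu>" "upair x y \<in> V \<mu>"
    using e by (auto intro!: vlev_limit_mem[OF assms(1) e(1)])
qed

lemma vlev_limit_opair:
  "limit_ordinal (\<mu>::'v::zfc) \<Longrightarrow> x \<in> V \<mu> \<Longrightarrow> y \<in> V \<mu> \<Longrightarrow> opair x y \<in> V \<mu>"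
  unfolding opair_def by (intro vlev_limit_vun)

lemma vlev_opairD:
  assumes "ordinal (\<mu>::'v::zfc)" "opair x y \<in> V \<mu>"
  shows "x \<in> V \<mu>" "y \<in> V \<mu>"
proof -
  have "upair x y \<in> V \<mu>" using vlev_trans[OF assms] unfolding opair_def by simp
  then show "x \<in> V \<mu>" "y \<in> V \<mu>" using vlev_trans[OF assms(1)] by simp_all
qed

lemma ordinal_subset_vlev: "ordinal (\<mu>::'v::zfc) \<Longrightarrow> elts \<mu> \<subseteq> V \<mu>"
proof (induction \<mu> rule: ordinal_induct)
  case definable
  show ?case by (intro dint)
next
  case (step \<mu>)
  show ?case
  proof
    fix x assume x: "x \<in> elts \<mu>"
    have "elts (vsucc x) \<subseteq> elts \<mu>" using vsucc_subset[OF step(1) x] .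
    moreover have "x \<in> V (vsucc x)"
      using step(2)[OF x] elts_vlev_vsucc[OF ordinal_elem[OF step(1) x]] by blast
    ultimately show "x \<in> V \<mu>"
      using vlev_mono[OF step(1) ordinal_vsucc[OF ordinal_elem[OF step(1) x]]] by blast
  qed
qed

lemma omega_vlev_limit: "limit_ordinal (\<mu>::'v::zfc) \<Longrightarrow> n \<in> elts omega \<Longrightarrow> n \<in> V \<mu>"
  using omega_subset_limit ordinal_subset_vlev limit_ordinal_ordinal by blast

text \<open>Iterating unions \<open>\<omega>\<close> times gives a transitive set, to which foundation applies.\<close>

lemma ex_vlev: "\<exists>\<mu>. ordinal \<mu> \<and> (x::'v::zfc) \<in> V \<mu>"
proof (rule ccontr)
  assume no: "\<nexists>\<mu>. ordinal \<mu> \<and> x \<in> V \<mu>"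
  let ?i = "iter vUnion (upair x x)"
  have d: "dterm UNIV (\<lambda>e. vUnion (e 0 :: 'v))" by (intro dint)
  have t: "elts (?i omega) = (\<Union>n\<in>elts omega. elts (?i n))" by (rule iter_limit[OF d limit_omega])
  have xt: "x \<in> elts (?i omega)"
    unfolding t using iter_vempty[OF d, of "upair x x"] by (intro UN_I[of vempty]) simp_all
  have trans: "z \<in> elts (?i omega)" if yz: "y \<in> elts (?i omega)" "z \<in> elts y" for y z
  proof -
    obtain n where n: "n \<in> elts omega" "y \<in> elts (?i n)" using yz(1) unfolding t by blast
    have "z \<in> elts (?i (vsucc n))"
      using n(2) yz(2) iter_vsucc[OF d ordinal_of_omega[OF n(1)], of "upair x x"] by auto
    then show ?thesis unfolding t using n(1) by (intro UN_I[of "vsucc n"]) simp_all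
  qed
  define B where "B = vsep (?i omega) (\<lambda>y. \<not> (\<exists>\<mu>. ordinal \<mu> \<and> y \<in> V \<mu>))"
  have B: "elts B = {y \<in> elts (?i omega). \<not> (\<exists>\<mu>. ordinal \<mu> \<and> y \<in> V \<mu>)}"
    unfolding B_def by (rule elts_vsep) (intro dint)
  have "x \<in> elts B" using xt no unfolding B by blast
  then obtain y where y: "y \<in> elts B" "elts y \<inter> elts B = {}" using foundation[of B] by blast
  have ranked: "\<exists>\<mu>. ordinal \<mu> \<and> z \<in> V \<mu>" if "z \<in> elts y" for z
    using y that trans[of y z] unfolding B by blast
  define r where "r z = vleast (\<lambda>\<mu>. z \<in> V \<mu>)" for z :: 'v
  have dr: "dterm UNIV (\<lambda>e. r (e 0))" unfolding r_def by (intro dint)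
  have r: "ordinal (r z)" "z \<in> V (r z)" if "z \<in> elts y" for z
  proof -
    obtain \<mu> where \<mu>: "ordinal \<mu>" "z \<in> V \<mu>" using ranked[OF \<open>z \<in> elts y\<close>] by blast
    have "dfn UNIV (\<lambda>e. z \<in> V (e 0))" by (intro dint)
    from vleast[where Q = "\<lambda>\<mu>. z \<in> V \<mu>", OF this \<mu>] show "ordinal (r z)" "z \<in> V (r z)"
      unfolding r_def by blast+
  qed
  define \<mu> where "\<mu> = vUN y r"
  have e: "elts \<mu> = (\<Union>z\<in>elts y. elts (r z))" unfolding \<mu>_def by (rule elts_vUN[OF dr])
  have o: "ordinal \<mu>" by (rule ordinal_UN[of "r ` elts y"]) (use r(1) e in auto)
  have "elts y \<subseteq> V \<mu>"
  proof
    fix z assume z: "z \<in> elts y"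
    have "elts (r z) \<subseteq> elts \<mu>" unfolding e using z by blast
    then show "z \<in> V \<mu>" using vlev_mono[OF o r(1)[OF z]] r(2)[OF z] by blast
  qed
  then have "y \<in> V (vsucc \<mu>)" using elts_vlev_vsucc[OF o] by blast
  with y(1) ordinal_vsucc[OF o] show False unfolding B by blast
qed


section \<open>The reflection theorem\<close>

primrec holdsU :: "'v::membership set \<Rightarrow> fm \<Rightarrow> (nat \<Rightarrow> 'v) \<Rightarrow> bool" where
  "holdsU U (FMem i j) e \<longleftrightarrow> e i \<in> elts (e j)"
| "holdsU U (FEq i j) e \<longleftrightarrow> e i = e j"
| "holdsU U (FNot \<phi>) e \<longleftrightarrow> \<not> holdsU U \<phi> e"
| "holdsU U (FAnd \<phi> \<psi>) e \<longleftrightarrow> holdsU U \<phi> e \<and> holdsU U \<psi> e"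
| "holdsU U (FAll i \<phi>) e \<longleftrightarrow> (\<forall>x\<in>U. holdsU U \<phi> (e(i := x)))"

text \<open>An environment of the meta-language is an external sequence and need not be a set of the
  model; only finitely many of its values can be collected in an internal assignment.\<close>

lemma finite_assignment:
  assumes "\<And>i. e i \<in> elts (M::'v::zfc)"
  shows "\<exists>a. is_fun a omega M \<and> (\<forall>i<N. ap a (vnat i) = e i)"
proof (induction N)
  case 0
  have "dterm UNIV (\<lambda>_::nat \<Rightarrow> 'v. e 0)" by (intro dint)
  then have "is_fun (vlam omega (\<lambda>_. e 0)) omega M" by (rule is_fun_vlam) (rule assms)
  then show ?case by blast
next
  case (Suc N)
  then obtain a where a: "is_fun a omega M" "\<forall>i<N. ap a (vnat i) = e i" by blast
  have "is_fun (upd a (vnat N) (e N)) omega M" by (intro is_fun_upd a assms) simp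
  moreover have "ap (upd a (vnat N) (e N)) (vnat i) = e i" if "i < Suc N" for i
    using a(2) that by (auto simp: ap_upd[OF is_fun_fn[OF a(1)]])
  ultimately show ?case by blast
qed

lemma dfn_app2:
  assumes "dfn P (\<lambda>e. R (e 0) (e 1))" "dterm P s" "dterm P t"
  shows "dfn P (\<lambda>e. R (s e) (t e))"
  using dfn_subst[OF assms(1) subset_refl, where t = "\<lambda>i. if i = 0 then s else t"] assms(2-) by simp

text \<open>\<open>C \<gamma> \<delta>\<close> says that \<open>vlev \<delta>\<close> contains the witnesses needed for assignments into \<open>vlev \<gamma>\<close>.\<close>

definition reflector :: "('v::zfc \<Rightarrow> 'v \<Rightarrow> bool) \<Rightarrow> bool" where
  "reflector C \<longleftrightarrow> dfn UNIV (\<lambda>e. C (e 0) (e 1)) \<and>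
    (\<forall>\<gamma>. ordinal \<gamma> \<longrightarrow> (\<exists>\<delta>. ordinal \<delta> \<and> C \<gamma> \<delta>)) \<and>
    (\<forall>\<gamma> \<delta> \<epsilon>. C \<gamma> \<delta> \<longrightarrow> ordinal \<delta> \<longrightarrow> ordinal \<epsilon> \<longrightarrow> elts \<delta> \<subseteq> elts \<epsilon> \<longrightarrow> C \<gamma> \<epsilon>)"

text \<open>Only cofinally many \<open>\<gamma>\<close> are asked for, because a reflector is
  monotone in its second argument only and the construction of \<open>\<mu>\<close> controls just
  the iterates of one operation.\<close>

definition closed_under :: "('v::zfc \<Rightarrow> 'v \<Rightarrow> bool) \<Rightarrow> 'v \<Rightarrow> bool" where
  "closed_under C \<mu> \<longleftrightarrow> limit_ordinal \<mu> \<and>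
    (\<forall>\<beta>\<in>elts \<mu>. \<exists>\<gamma>\<in>elts \<mu>. \<exists>\<delta>\<in>elts \<mu>. elts \<beta> \<subseteq> elts \<gamma> \<and> C \<gamma> \<delta>)"

definition reflects :: "'v::zfc \<Rightarrow> fm \<Rightarrow> bool" where
  "reflects \<mu> \<phi> \<longleftrightarrow> (\<forall>e. (\<forall>i. e i \<in> V \<mu>) \<longrightarrow> holdsU (V \<mu>) \<phi> e = holds \<phi> e)"

lemma reflector_True: "reflector (\<lambda>_ _. True)"
  unfolding reflector_def using ordinal_vempty by (auto intro: dfn_True)

lemma reflector_conj:
  assumes "reflector C" "reflector D" shows "reflector (\<lambda>\<gamma> \<delta>. C \<gamma> \<delta> \<and> D \<gamma> \<delta>)"
  unfolding reflector_def
proof (intro conjI allI impI)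
  show "dfn UNIV (\<lambda>e. C (e 0) (e 1) \<and> D (e 0) (e 1))"
    using assms unfolding reflector_def by (intro dint) auto
  fix \<gamma> :: 'a assume "ordinal \<gamma>"
  then obtain \<delta> \<delta>' where *: "ordinal \<delta>" "C \<gamma> \<delta>" "ordinal \<delta>'" "D \<gamma> \<delta>'"
    using assms unfolding reflector_def by blast
  have "C \<gamma> (vun \<delta> \<delta>')" "D \<gamma> (vun \<delta> \<delta>')"
    using assms * ordinal_vun[OF *(1,3)] unfolding reflector_def by (metis elts_vun sup_ge1 sup_ge2)+
  then show "\<exists>\<delta>. ordinal \<delta> \<and> C \<gamma> \<delta> \<and> D \<gamma> \<delta>" using ordinal_vun[OF *(1,3)] by blast
qed (use assms in \<open>auto simp: reflector_def\<close>)

lemma closed_under_mono: "closed_under C \<mu> \<Longrightarrow> (\<And>\<gamma> \<delta>. C \<gamma> \<delta> \<Longrightarrow> D \<gamma> \<delta>) \<Longrightarrow> closed_under D \<mu>"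
  unfolding closed_under_def by blast

text \<open>The least ordinal that works is a definable function of \<open>a\<close>, so by
  replacement these ordinals form a set; their supremum works for all \<open>a\<close> by
  monotonicity.\<close>

lemma collection:
  assumes d: "dfn UNIV (\<lambda>e. Q (e 0) (e 1))"
    and ex: "\<And>a. a \<in> elts X \<Longrightarrow> \<exists>\<beta>. ordinal \<beta> \<and> Q a \<beta>"
    and mono: "\<And>a \<beta> \<gamma>. Q a \<beta> \<Longrightarrow> ordinal \<beta> \<Longrightarrow> ordinal \<gamma> \<Longrightarrow> elts \<beta> \<subseteq> elts \<gamma> \<Longrightarrow> Q a \<gamma>"
  shows "\<exists>\<beta>. ordinal (\<beta>::'v::zfc) \<and> (\<forall>a\<in>elts X. Q a \<beta>)"
proof -
  have d1: "dfn UNIV (\<lambda>e. Q a (e 0))" for a by (rule dfn_app2[OF d]) (intro dint)+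
  have dr: "dterm UNIV (\<lambda>e. vleast (Q (e 0)))"
    by (intro dint dfn_app2[OF d])
  have r: "ordinal (vleast (Q a))" "Q a (vleast (Q a))" if "a \<in> elts X" for a
    using ex[OF that] vleast[OF d1[of a]] by blast+
  define \<mu> where "\<mu> = vUN X (\<lambda>a. vleast (Q a))"
  have e: "elts \<mu> = (\<Union>z\<in>elts X. elts (vleast (Q z)))" unfolding \<mu>_def by (rule elts_vUN[OF dr])
  have o: "ordinal \<mu>" by (rule ordinal_UN[of "(\<lambda>a. vleast (Q a)) ` elts X"]) (use r(1) e in auto)
  have "Q a \<mu>" if "a \<in> elts X" for a
    using mono[OF r(2)[OF that] r(1)[OF that] o] e that by blast
  with o show ?thesis by blast
qed

text \<open>The assignments into a fixed level form a set, so collection bounds the ranks of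
  witnesses for all of them at once.\<close>

lemma reflector_witnesses:
  fixes Q :: "'v::zfc \<Rightarrow> 'v \<Rightarrow> bool"
  assumes Q: "dfn UNIV (\<lambda>e. Q (e 0) (e 1))"
  shows "reflector (\<lambda>\<gamma> \<delta>. \<forall>a. is_fun a omega (vlev \<gamma>) \<longrightarrow> (\<exists>x. Q a x) \<longrightarrow> (\<exists>x\<in>V \<delta>. Q a x))"
  unfolding reflector_def
proof (intro conjI allI impI)
  note Q' = dfn_app2[OF Q]
  show "dfn UNIV (\<lambda>e. \<forall>a. is_fun a omega (vlev (e 0)) \<longrightarrow> (\<exists>x. Q a x) \<longrightarrow> (\<exists>x\<in>V (e 1). Q a x))"
    by (intro dint Q')
  fix \<gamma> :: 'v assume "ordinal \<gamma>"
  have "\<exists>\<delta>. ordinal \<delta> \<and> (\<forall>a\<in>elts (vfuns omega (vlev \<gamma>)). (\<exists>x. Q a x) \<longrightarrow> (\<exists>x\<in>V \<delta>. Q a x))"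
  proof (rule collection)
    show "dfn UNIV (\<lambda>e. (\<exists>x. Q (e 0) x) \<longrightarrow> (\<exists>x\<in>V (e 1). Q (e 0) x))"
      by (intro dint Q')
    show "\<exists>\<beta>. ordinal \<beta> \<and> ((\<exists>x. Q a x) \<longrightarrow> (\<exists>x\<in>V \<beta>. Q a x))" for a
      using ex_vlev ordinal_vempty by blast
    show "(\<exists>x. Q a x) \<longrightarrow> (\<exists>x\<in>V \<epsilon>. Q a x)"
      if "(\<exists>x. Q a x) \<longrightarrow> (\<exists>x\<in>V \<beta>. Q a x)" "ordinal \<beta>" "ordinal \<epsilon>" "elts \<beta> \<subseteq> elts \<epsilon>" for a \<beta> \<epsilon>
      using that vlev_mono[OF that(3,2,4)] by blast
  qed
  then show "\<exists>\<delta>. ordinal \<delta> \<and> (\<forall>a. is_fun a omega (vlev \<gamma>) \<longrightarrow> (\<exists>x. Q a x) \<longrightarrow> (\<exists>x\<in>V \<delta>. Q a x))"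
    by (simp add: elts_vfuns)
next
  fix \<gamma> \<delta> \<epsilon> a :: 'v
  assume *: "\<forall>a. is_fun a omega (vlev \<gamma>) \<longrightarrow> (\<exists>x. Q a x) \<longrightarrow> (\<exists>x\<in>V \<delta>. Q a x)"
    "ordinal \<delta>" "ordinal \<epsilon>" "elts \<delta> \<subseteq> elts \<epsilon>" "is_fun a omega (vlev \<gamma>)" "\<exists>x. Q a x"
  then show "\<exists>x\<in>V \<epsilon>. Q a x" using vlev_mono[OF *(3,2,4)] by blast
qed

lemma limit_bound:
  assumes "limit_ordinal (\<mu>::'v::zfc)" "\<And>i. e i \<in> V \<mu>"
  shows "\<exists>\<beta>\<in>elts \<mu>. \<forall>i<N::nat. e i \<in> V \<beta>"
proof (induction N)
  case 0
  then show ?case using limit_vempty[OF assms(1)] by blast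
next
  case (Suc N)
  have o: "ordinal \<mu>" using assms(1) by (rule limit_ordinal_ordinal)
  from Suc obtain \<beta> where b: "\<beta> \<in> elts \<mu>" "\<forall>i<N. e i \<in> V \<beta>" by blast
  obtain \<gamma> where g: "\<gamma> \<in> elts \<mu>" "e N \<in> V \<gamma>"
    using assms(2)[of N] unfolding elts_vlev_limit[OF assms(1)] by blast
  obtain \<epsilon> where e: "\<epsilon> \<in> elts \<mu>" "elts \<beta> \<subseteq> elts \<epsilon>" "elts \<gamma> \<subseteq> elts \<epsilon>"
    by (rule ordinal_chain2[OF o b(1) g(1)])
  have "V \<beta> \<subseteq> V \<epsilon>" "V \<gamma> \<subseteq> V \<epsilon>"
    using vlev_mono ordinal_elem[OF o] e b(1) g(1) by blast+
  then have "\<forall>i<Suc N. e i \<in> V \<epsilon>" using b(2) g(2) less_Suc_eq by auto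
  with e(1) show ?case by blast
qed

text \<open>The Tarski-Vaught argument by induction on the formula. Only a quantifier asks for new
  closure: if there is a counterexample for parameters in the level, there must be one in the
  level.\<close>

lemma ex_reflector:
  "\<exists>C :: 'v::zfc \<Rightarrow> 'v \<Rightarrow> bool. reflector C \<and> (\<forall>\<mu>. closed_under C \<mu> \<longrightarrow> reflects \<mu> \<phi>)"
proof (induction \<phi>)
  case (FMem i j)
  show ?case using reflector_True unfolding reflects_def by (intro exI[of _ "\<lambda>_ _. True"]) simp
next
  case (FEq i j)
  show ?case using reflector_True unfolding reflects_def by (intro exI[of _ "\<lambda>_ _. True"]) simp
next
  case (FNot \<phi>)
  then show ?case unfolding reflects_def by auto
next
  case (FAnd \<phi> \<psi>)
  then obtain C D :: "'v \<Rightarrow> 'v \<Rightarrow> bool" where "reflector C" "\<And>\<mu>. closed_under C \<mu> \<Longrightarrow> reflects \<mu> \<phi>"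
    "reflector D" "\<And>\<mu>. closed_under D \<mu> \<Longrightarrow> reflects \<mu> \<psi>" by blast
  then show ?case
    using closed_under_mono[of "\<lambda>\<gamma> \<delta>. C \<gamma> \<delta> \<and> D \<gamma> \<delta>" _ C] closed_under_mono[of "\<lambda>\<gamma> \<delta>. C \<gamma> \<delta> \<and> D \<gamma> \<delta>" _ D]
    by (intro exI[of _ "\<lambda>\<gamma> \<delta>. C \<gamma> \<delta> \<and> D \<gamma> \<delta>"]) (simp add: reflector_conj reflects_def)
next
  case (FAll k \<phi>)
  then obtain C :: "'v \<Rightarrow> 'v \<Rightarrow> bool" where C: "reflector C" "\<And>\<mu>. closed_under C \<mu> \<Longrightarrow> reflects \<mu> \<phi>" by blast
  \<comment> \<open>The environment is coded by an assignment \<open>a\<close> in the model, so that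
    collection can range over all environments with values in a level.\<close>
  define Q :: "'v \<Rightarrow> 'v \<Rightarrow> bool" where "Q a x \<longleftrightarrow> \<not> holds \<phi> ((\<lambda>i. ap a (vnat i))(k := x))" for a x
  have "dterm UNIV (\<lambda>e :: nat \<Rightarrow> 'v. if i = k then e 1 else ap (e 0) (vnat i))" for i
    by (cases "i = k") (simp_all, (intro dint)+)
  from dfn_holds_subst[where t = "\<lambda>i e. if i = k then e 1 else ap (e 0) (vnat i)", OF this]
  have "dfn UNIV (\<lambda>e :: nat \<Rightarrow> 'v. holds \<phi> ((\<lambda>i. ap (e 0) (vnat i))(k := e 1)))"
    unfolding fun_upd_def .
  then have Q: "dfn UNIV (\<lambda>e. Q (e 0) (e 1))" unfolding Q_def by (rule dfn_not)
  define D where "D \<gamma> \<delta> \<longleftrightarrow> (\<forall>a. is_fun a omega (vlev \<gamma>) \<longrightarrow> (\<exists>x. Q a x) \<longrightarrow> (\<exists>x\<in>V \<delta>. Q a x))" for \<gamma> \<delta>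
  have D: "reflector D" unfolding D_def by (rule reflector_witnesses[OF Q])
  obtain N0 where N0: "\<And>e e' :: nat \<Rightarrow> 'v. (\<forall>i<N0. e i = e' i) \<Longrightarrow> holds \<phi> e = holds \<phi> e'"
    using holds_fresh[of \<phi>] by metis
  have "reflects \<mu> (FAll k \<phi>)" if cl: "closed_under (\<lambda>\<gamma> \<delta>. C \<gamma> \<delta> \<and> D \<gamma> \<delta>) \<mu>" for \<mu>
    unfolding reflects_def
  proof (intro allI impI)
    fix e :: "nat \<Rightarrow> 'v" assume e: "\<forall>i. e i \<in> V \<mu>"
    have lim: "limit_ordinal \<mu>" using cl unfolding closed_under_def by blast
    note o = limit_ordinal_ordinal[OF lim]
    have r: "reflects \<mu> \<phi>" using C(2) closed_under_mono[OF cl] by blast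
    then have 1: "holdsU (V \<mu>) \<phi> (e(k := x)) = holds \<phi> (e(k := x))" if "x \<in> V \<mu>" for x
      using e that unfolding reflects_def by simp
    have "\<exists>x\<in>V \<mu>. \<not> holds \<phi> (e(k := x))" if ex: "\<exists>x. \<not> holds \<phi> (e(k := x))"
    proof -
      \<comment> \<open>\<open>Suc N0\<close> rather than \<open>N0\<close>: the value
        \<open>e 0\<close> serves below as the default for the irrelevant variables and must be
        bounded even if \<open>N0\<close> is 0.\<close>
      obtain \<beta> where b: "\<beta> \<in> elts \<mu>" "\<forall>i<Suc N0. e i \<in> V \<beta>"
        using limit_bound[OF lim, of e "Suc N0"] e by blast
      obtain \<gamma> \<delta> where gd: "\<gamma> \<in> elts \<mu>" "\<delta> \<in> elts \<mu>" "elts \<beta> \<subseteq> elts \<gamma>" "D \<gamma> \<delta>"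
        using cl b(1) unfolding closed_under_def by blast
      have "V \<beta> \<subseteq> V \<gamma>" using vlev_mono gd ordinal_elem[OF o] b(1) by blast
      then have "(if i < N0 then e i else e 0) \<in> V \<gamma>" for i using b(2) by auto
      from finite_assignment[of "\<lambda>i. if i < N0 then e i else e 0", OF this]
      obtain a where a: "is_fun a omega (vlev \<gamma>)" "\<forall>i<N0. ap a (vnat i) = (if i < N0 then e i else e 0)" by blast
      have Qe: "Q a x \<longleftrightarrow> \<not> holds \<phi> (e(k := x))" for x
      proof -
        have "holds \<phi> ((\<lambda>i. ap a (vnat i))(k := x)) = holds \<phi> (e(k := x))"
          by (rule N0) (simp add: a(2))
        then show ?thesis unfolding Q_def by simp
      qed
      have "\<exists>x. Q a x" using ex unfolding Qe .
      then have "\<exists>x\<in>V \<delta>. Q a x" using gd(4) a(1) unfolding D_def by blast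
      moreover have "V \<delta> \<subseteq> V \<mu>" using vlev_trans_mono[OF o] gd(2) by blast
      ultimately show ?thesis unfolding Qe by blast
    qed
    with 1 show "holdsU (V \<mu>) (FAll k \<phi>) e = holds (FAll k \<phi>) e" by auto
  qed
  then show ?case using reflector_conj[OF C(1) D] by blast
qed

lemma ex_reflector_list:
  "\<exists>C :: 'v::zfc \<Rightarrow> 'v \<Rightarrow> bool. reflector C \<and> (\<forall>\<mu>. closed_under C \<mu> \<longrightarrow> (\<forall>\<phi>\<in>set L. reflects \<mu> \<phi>))"
proof (induction L)
  case Nil
  show ?case using reflector_True by auto
next
  case (Cons \<phi> L)
  then obtain C :: "'v \<Rightarrow> 'v \<Rightarrow> bool" where C: "reflector C" "\<forall>\<mu>. closed_under C \<mu> \<longrightarrow> (\<forall>\<phi>\<in>set L. reflects \<mu> \<phi>)"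
    by blast
  obtain D :: "'v \<Rightarrow> 'v \<Rightarrow> bool" where D: "reflector D" "\<forall>\<mu>. closed_under D \<mu> \<longrightarrow> reflects \<mu> \<phi>"
    using ex_reflector by blast
  show ?case
    using C D closed_under_mono[of "\<lambda>\<gamma> \<delta>. C \<gamma> \<delta> \<and> D \<gamma> \<delta>" _ C] closed_under_mono[of "\<lambda>\<gamma> \<delta>. C \<gamma> \<delta> \<and> D \<gamma> \<delta>" _ D]
    by (intro exI[of _ "\<lambda>\<gamma> \<delta>. C \<gamma> \<delta> \<and> D \<gamma> \<delta>"]) (simp add: reflector_conj)
qed

text \<open>The desired ordinal is the supremum of the \<omega> iterates of \<open>s\<close> from
  \<open>\<beta>\<close>. Each iterate is an element of the next one, which also bounds its
  witnesses, so the iterates are the required cofinal family.\<close>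

lemma ex_closed_under:
  assumes C: "reflector (C :: 'v::zfc \<Rightarrow> 'v \<Rightarrow> bool)" and \<beta>: "ordinal \<beta>"
  shows "\<exists>\<mu>. closed_under C \<mu> \<and> \<beta> \<in> elts \<mu>"
proof -
  define s where "s \<gamma> = vleast (\<lambda>\<delta>. \<gamma> \<in> elts \<delta> \<and> C \<gamma> \<delta>)" for \<gamma>
  have dC: "dfn UNIV (\<lambda>e. C (e 0) (e 1))" using C unfolding reflector_def by blast
  have ds: "dterm UNIV (\<lambda>e. s (e 0))" unfolding s_def by (intro dint dfn_app2[OF dC])
  have s: "ordinal (s \<gamma>) \<and> \<gamma> \<in> elts (s \<gamma>) \<and> C \<gamma> (s \<gamma>)" if g: "ordinal \<gamma>" for \<gamma>
  proof -
    obtain \<delta> where d: "ordinal \<delta>" "C \<gamma> \<delta>" using C g unfolding reflector_def by blast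
    let ?d = "vun (vsucc \<gamma>) \<delta>"
    have o: "ordinal ?d" using g d by (intro ordinal_vun) simp_all
    have "C \<gamma> ?d" using C d o unfolding reflector_def by (metis elts_vun sup_ge2)
    then have "\<gamma> \<in> elts ?d \<and> C \<gamma> ?d" by simp
    moreover have "dfn UNIV (\<lambda>e. \<gamma> \<in> elts (e 0) \<and> C \<gamma> (e 0))" by (intro dint dfn_app2[OF dC])
    ultimately show ?thesis
      using vleast[where Q = "\<lambda>\<delta>. \<gamma> \<in> elts \<delta> \<and> C \<gamma> \<delta>", of ?d] o unfolding s_def by blast
  qed
  let ?i = "iter s \<beta>"
  have i: "ordinal (?i n)" if "n \<in> elts omega" for n
    using that
  proof (induction n rule: omega_induct)
    case definable
    show ?case by (intro dint dterm_iter1[OF ds])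
  next
    case (succ n)
    then show ?case using s iter_vsucc[OF ds ordinal_of_omega[OF succ(1)], of \<beta>] by simp
  qed (simp add: iter_vempty[OF ds] \<beta>)
  have i': "?i n \<in> elts (?i (vsucc n))" "C (?i n) (?i (vsucc n))" if "n \<in> elts omega" for n
    using s[OF i[OF that]] iter_vsucc[OF ds ordinal_of_omega[OF that], of \<beta>] by simp_all
  let ?m = "?i omega"
  have e: "elts ?m = (\<Union>n\<in>elts omega. elts (?i n))" by (rule iter_limit[OF ds limit_omega])
  have o: "ordinal ?m" by (rule ordinal_UN[of "?i ` elts omega"]) (use i e in auto)
  have im: "?i n \<in> elts ?m" if "n \<in> elts omega" for n
    unfolding e using i'(1)[OF that] that by (intro UN_I[of "vsucc n"]) simp_all
  have b: "\<beta> \<in> elts ?m" using im[of vempty] by (simp add: iter_vempty[OF ds])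
  have cof: "\<exists>n\<in>elts omega. \<gamma> \<in> elts (?i n)" if "\<gamma> \<in> elts ?m" for \<gamma> using that unfolding e by blast
  have "limit_ordinal ?m"
  proof (rule limit_ordinalI[OF o])
    show "vempty \<in> elts ?m"
      using ordinal_subset_iff[OF ordinal_vempty o] b by auto
    fix \<gamma> assume "\<gamma> \<in> elts ?m"
    then obtain n where n: "n \<in> elts omega" "\<gamma> \<in> elts (?i n)" using cof by blast
    have "vsucc \<gamma> \<in> elts (vsucc (?i n))" by (rule vsucc_mem_vsucc[OF i[OF n(1)] n(2)])
    then show "vsucc \<gamma> \<in> elts ?m"
      using im[OF n(1)] ordinal_mem_trans[OF o im[OF n(1)]] by auto
  qed
  moreover have "\<exists>\<gamma>\<in>elts ?m. \<exists>\<delta>\<in>elts ?m. elts x \<subseteq> elts \<gamma> \<and> C \<gamma> \<delta>" if x: "x \<in> elts ?m" for x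
  proof -
    obtain n where n: "n \<in> elts omega" "x \<in> elts (?i n)" using cof[OF x] by blast
    then show ?thesis using im[OF n(1)] im[OF vsucc_omega[OF n(1)]] i'(2)[OF n(1)]
        ordinal_subset[OF i[OF n(1)] n(2)] by blast
  qed
  ultimately show ?thesis unfolding closed_under_def using b by blast
qed

theorem reflection:
  "\<exists>\<mu>. limit_ordinal \<mu> \<and> (x::'v::zfc) \<in> V \<mu> \<and> (\<forall>\<phi>\<in>set L. reflects \<mu> \<phi>)"
proof -
  obtain C :: "'v \<Rightarrow> 'v \<Rightarrow> bool" where C: "reflector C" "\<And>\<mu>. closed_under C \<mu> \<Longrightarrow> (\<forall>\<phi>\<in>set L. reflects \<mu> \<phi>)"
    using ex_reflector_list by metis
  obtain \<beta> where \<beta>: "ordinal \<beta>" "x \<in> V \<beta>" using ex_vlev by blast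
  obtain \<mu> where \<mu>: "closed_under C \<mu>" "\<beta> \<in> elts \<mu>" using ex_closed_under[OF C(1) \<beta>(1)] by blast
  have "limit_ordinal \<mu>" using \<mu>(1) unfolding closed_under_def by blast
  moreover from this have "x \<in> V \<mu>" using \<mu>(2) \<beta>(2) elts_vlev_limit by blast
  ultimately show ?thesis using C(2)[OF \<mu>(1)] by blast
qed


section \<open>Formulas of the model and their satisfaction\<close>

lemmas codes_def = mem_code_def eq_code_def not_code_def and_code_def all_code_def

lemma code_inject [simp]:
  "mem_code i j = mem_code i' j' \<longleftrightarrow> i = i' \<and> j = (j'::'v::zfc)"
  "eq_code i j = eq_code i' j' \<longleftrightarrow> i = i' \<and> j = j'"
  "not_code p = not_code p' \<longleftrightarrow> p = p'"
  "and_code p q = and_code p' q' \<longleftrightarrow> p = p' \<and> q = q'"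
  "all_code i p = all_code i' p' \<longleftrightarrow> i = i' \<and> p = p'"
  by (simp_all add: codes_def)

lemma code_distinct [simp]:
  "mem_code i j \<noteq> eq_code i' (j'::'v::zfc)" "mem_code i j \<noteq> not_code p" "mem_code i j \<noteq> and_code p q"
  "mem_code i j \<noteq> all_code i' p" "eq_code i j \<noteq> not_code p" "eq_code i j \<noteq> and_code p q"
  "eq_code i j \<noteq> all_code i' p" "not_code p' \<noteq> and_code p q" "not_code p' \<noteq> all_code i p"
  "and_code p' q' \<noteq> all_code i p"
  by (simp_all add: codes_def del: vnat.simps One_nat_def)

lemmas code_distinct' [simp] = code_distinct[symmetric]

lemma dterm_codes [dint]:
  assumes "dterm P s" "dterm P (t :: (nat \<Rightarrow> 'v::zfc) \<Rightarrow> 'v)"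
  shows "dterm P (\<lambda>e. mem_code (s e) (t e))" "dterm P (\<lambda>e. eq_code (s e) (t e))"
    "dterm P (\<lambda>e. and_code (s e) (t e))" "dterm P (\<lambda>e. all_code (s e) (t e))"
  unfolding codes_def by (intro dint assms)+

lemma dterm_not_code [dint]:
  assumes "dterm P s" shows "dterm P (\<lambda>e. not_code (s e :: 'v::zfc))"
  unfolding codes_def by (intro dint assms)

lemma dfn_formula [dint]:
  assumes "dterm P s" shows "dfn P (\<lambda>e. formula (s e :: 'v::zfc))"
  by (rule dfn1I[OF _ assms], unfold formula_def, intro dint)

lemma formula_intros [simp]:
  "i \<in> elts omega \<Longrightarrow> j \<in> elts omega \<Longrightarrow> formula (mem_code i (j::'v::zfc))"
  "i \<in> elts omega \<Longrightarrow> j \<in> elts omega \<Longrightarrow> formula (eq_code i j)"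
  "formula p \<Longrightarrow> formula (not_code p)"
  "formula p \<Longrightarrow> formula q \<Longrightarrow> formula (and_code p q)"
  "i \<in> elts omega \<Longrightarrow> formula p \<Longrightarrow> formula (all_code i p)"
  unfolding formula_def by auto

text \<open>A limit level is closed under pairing and contains all elements of \<open>omega\<close>,
  so it is among the sets over which \<open>formula\<close> quantifies. Consequently the formulas
  form a set.\<close>

lemma formula_vlev_limit:
  assumes "formula p" "limit_ordinal (\<mu>::'v::zfc)" shows "p \<in> V \<mu>"
proof -
  have n: "vnat n \<in> V \<mu>" for n by (rule omega_vlev_limit[OF assms(2)]) simp
  note w = omega_vlev_limit[OF assms(2)] and o = vlev_limit_opair[OF assms(2)]
  show ?thesis
    using assms(1) unfolding formula_def codes_def
    by (elim allE[of _ "vlev \<mu>"] mp) (intro conjI ballI; (intro o n)?; (assumption | rule w; assumption))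
qed

definition formulas :: "'v::zfc" where
  "formulas = vsep (vlev omega) formula"

lemma elts_formulas: "elts formulas = {p :: 'v::zfc. formula p}"
proof -
  have "dfn UNIV (\<lambda>e :: nat \<Rightarrow> 'v. formula (e 0))" by (intro dint)
  from elts_vsep[OF this, of "vlev omega"] show ?thesis
    unfolding formulas_def using formula_vlev_limit[OF _ limit_omega] by auto
qed

lemma formula_induct [consumes 1, case_names definable Mem Eq Not And All]:
  assumes "formula (p::'v::zfc)" "dfn UNIV (\<lambda>e. Q (e 0))"
    and "\<And>i j. i \<in> elts omega \<Longrightarrow> j \<in> elts omega \<Longrightarrow> Q (mem_code i j)"
    and "\<And>i j. i \<in> elts omega \<Longrightarrow> j \<in> elts omega \<Longrightarrow> Q (eq_code i j)"
    and "\<And>p. formula p \<Longrightarrow> Q p \<Longrightarrow> Q (not_code p)"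
    and "\<And>p q. formula p \<Longrightarrow> Q p \<Longrightarrow> formula q \<Longrightarrow> Q q \<Longrightarrow> Q (and_code p q)"
    and "\<And>i p. i \<in> elts omega \<Longrightarrow> formula p \<Longrightarrow> Q p \<Longrightarrow> Q (all_code i p)"
  shows "Q p"
proof -
  have e: "elts (vsep formulas Q) = {y. formula y \<and> Q y}"
    using elts_vsep[OF assms(2), of formulas] by (simp add: elts_formulas)
  have "p \<in> elts (vsep formulas Q)"
    using assms(1)[unfolded formula_def, rule_format, of "vsep formulas Q"] assms(3-)
    unfolding e by simp
  then show ?thesis unfolding e by simp
qed

text \<open>
  Tarski's clauses as operations on the sets of satisfying assignments; \<open>val M p s\<close> below says that
  \<open>s\<close> is the set that they assign to the formula \<open>p\<close>.
\<close>

definition sMem :: "'v::zfc \<Rightarrow> 'v \<Rightarrow> 'v \<Rightarrow> 'v" where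
  "sMem M i j = vsep (vfuns omega M) (\<lambda>a. ap a i \<in> elts (ap a j))"

definition sEq :: "'v::zfc \<Rightarrow> 'v \<Rightarrow> 'v \<Rightarrow> 'v" where
  "sEq M i j = vsep (vfuns omega M) (\<lambda>a. ap a i = ap a j)"

definition sNot :: "'v::zfc \<Rightarrow> 'v \<Rightarrow> 'v" where
  "sNot M s = vsep (vfuns omega M) (\<lambda>a. a \<notin> elts s)"

definition sAnd :: "'v::zfc \<Rightarrow> 'v \<Rightarrow> 'v \<Rightarrow> 'v" where
  "sAnd M s t = vsep (vfuns omega M) (\<lambda>a. a \<in> elts s \<and> a \<in> elts t)"

definition sAll :: "'v::zfc \<Rightarrow> 'v \<Rightarrow> 'v \<Rightarrow> 'v" where
  "sAll M i s = vsep (vfuns omega M) (\<lambda>a. \<forall>x\<in>elts M. upd a i x \<in> elts s)"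

lemmas s_defs = sMem_def sEq_def sNot_def sAnd_def sAll_def

lemma dterm_s [dint]:
  assumes "dterm P M" "dterm P s"
  shows "dterm P (\<lambda>e. sNot (M e) (s e))"
    and "dterm P t \<Longrightarrow> dterm P (\<lambda>e. sMem (M e) (s e) (t e))"
    and "dterm P t \<Longrightarrow> dterm P (\<lambda>e. sEq (M e) (s e) (t e))"
    and "dterm P t \<Longrightarrow> dterm P (\<lambda>e. sAnd (M e) (s e) (t e))"
    and "dterm P t \<Longrightarrow> dterm P (\<lambda>e. sAll (M e) (s e) (t e))"
  unfolding s_defs
  by (intro dint assms dterm_shift[OF assms(1)] dterm_shift[OF assms(2)] dterm_shift[of P t]
      dterm_shift[OF dterm_shift[OF assms(2)]] dterm_shift[OF dterm_shift[of P t]]; assumption)+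

lemma elts_s:
  "elts (sMem M i j) = {a. is_fun a omega M \<and> ap a i \<in> elts (ap a j)}"
  "elts (sEq M i j) = {a. is_fun a omega M \<and> ap a i = ap a j}"
  "elts (sNot M s) = {a. is_fun a omega M \<and> a \<notin> elts s}"
  "elts (sAnd M s t) = {a. is_fun a omega M \<and> a \<in> elts s \<and> a \<in> elts t}"
  "elts (sAll M i s) = {a. is_fun a omega M \<and> (\<forall>x\<in>elts M. upd a i x \<in> elts s)}"
  unfolding s_defs by (subst elts_vsep; (intro dint)?; simp add: elts_vfuns)+

definition val_closed :: "'v::zfc \<Rightarrow> 'v \<Rightarrow> bool" where
  "val_closed M X \<longleftrightarrow>
    (\<forall>i\<in>elts omega. \<forall>j\<in>elts omega. opair (mem_code i j) (sMem M i j) \<in> elts X) \<and>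
    (\<forall>i\<in>elts omega. \<forall>j\<in>elts omega. opair (eq_code i j) (sEq M i j) \<in> elts X) \<and>
    (\<forall>p s. opair p s \<in> elts X \<longrightarrow> opair (not_code p) (sNot M s) \<in> elts X) \<and>
    (\<forall>p s q t. opair p s \<in> elts X \<longrightarrow> opair q t \<in> elts X \<longrightarrow> opair (and_code p q) (sAnd M s t) \<in> elts X) \<and>
    (\<forall>i\<in>elts omega. \<forall>p s. opair p s \<in> elts X \<longrightarrow> opair (all_code i p) (sAll M i s) \<in> elts X)"

definition val :: "'v::zfc \<Rightarrow> 'v \<Rightarrow> 'v \<Rightarrow> bool" where
  "val M p s \<longleftrightarrow> (\<forall>X. val_closed M X \<longrightarrow> opair p s \<in> elts X)"

lemma dfn_val [dint]:
  assumes "dterm P M" "dterm P p" "dterm P s" shows "dfn P (\<lambda>e. val (M e) (p e) (s e))"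
  by (rule dfn3I[OF _ assms], unfold val_def val_closed_def, intro dint)

lemma val_intros:
  "i \<in> elts omega \<Longrightarrow> j \<in> elts omega \<Longrightarrow> val M (mem_code i j) (sMem M i j)"
  "i \<in> elts omega \<Longrightarrow> j \<in> elts omega \<Longrightarrow> val M (eq_code i j) (sEq M i j)"
  "val M p s \<Longrightarrow> val M (not_code p) (sNot M s)"
  "val M p s \<Longrightarrow> val M q t \<Longrightarrow> val M (and_code p q) (sAnd M s t)"
  "i \<in> elts omega \<Longrightarrow> val M p s \<Longrightarrow> val M (all_code i p) (sAll M i s)"
  unfolding val_def by (simp_all add: val_closed_def)

definition vprod :: "'v::zfc \<Rightarrow> 'v \<Rightarrow> 'v" where
  "vprod A B = vUN A (\<lambda>x. vimage (\<lambda>y. opair x y) B)"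

lemma elts_vprod: "elts (vprod A B) = {opair x y | x y. x \<in> elts A \<and> y \<in> elts B}"
proof -
  have 1: "dterm UNIV (\<lambda>e. vimage (\<lambda>y. opair (e 0) y) B)" by (intro dint)
  have 2: "dterm UNIV (\<lambda>e. opair x (e 0))" for x :: 'a by (intro dint)
  show ?thesis unfolding vprod_def elts_vUN[OF 1] by (auto simp: elts_vimage[OF 2])
qed

definition val_form :: "'v::zfc \<Rightarrow> 'v \<Rightarrow> 'v \<Rightarrow> bool" where
  "val_form M p s \<longleftrightarrow>
    (\<exists>i j. p = mem_code i j \<and> s = sMem M i j) \<or>
    (\<exists>i j. p = eq_code i j \<and> s = sEq M i j) \<or>
    (\<exists>q t. p = not_code q \<and> val M q t \<and> s = sNot M t) \<or>
    (\<exists>q t r u. p = and_code q r \<and> val M q t \<and> val M r u \<and> s = sAnd M t u) \<or>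
    (\<exists>i q t. p = all_code i q \<and> val M q t \<and> s = sAll M i t)"

lemma dfn_val_form [dint]:
  assumes "dterm P M" "dterm P p" "dterm P s" shows "dfn P (\<lambda>e. val_form (M e) (p e) (s e))"
  by (rule dfn3I[OF _ assms], unfold val_form_def, intro dint)

text \<open>Inversion for the inductively defined \<open>val\<close>, obtained by applying its
  minimality to the pairs of the right form.\<close>

lemma val_imp_form:
  assumes "val M p s" shows "val_form M p s"
proof -
  \<comment> \<open>The conjunct \<open>val M p s\<close> belongs to the induction because
    \<open>val_form\<close> speaks of \<open>val\<close> for the immediate subformulas.\<close>
  define X where "X = vsep (vprod formulas (vpow (vfuns omega M)))
    (\<lambda>z. \<exists>p s. z = opair p s \<and> val M p s \<and> val_form M p s)"
  have "elts X = {z \<in> elts (vprod formulas (vpow (vfuns omega M))). \<exists>p s. z = opair p s \<and> val M p s \<and> val_form M p s}"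
    unfolding X_def by (rule elts_vsep) (intro dint)
  then have X: "opair p s \<in> elts X \<longleftrightarrow> formula p \<and> elts s \<subseteq> elts (vfuns omega M) \<and> val M p s \<and> val_form M p s" for p s
    by (auto simp: elts_vprod elts_formulas)
  have sub: "elts (sMem M i j) \<subseteq> elts (vfuns omega M)" "elts (sEq M i j) \<subseteq> elts (vfuns omega M)"
    "elts (sNot M s) \<subseteq> elts (vfuns omega M)" "elts (sAnd M s t) \<subseteq> elts (vfuns omega M)"
    "elts (sAll M i s) \<subseteq> elts (vfuns omega M)" for i j s t
    unfolding elts_s elts_vfuns by auto
  have "val_closed M X"
    unfolding val_closed_def X
    by (intro conjI ballI allI impI; (elim conjE)?; (rule formula_intros sub val_intros)?; assumption?)
      (unfold val_form_def, blast+)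
  then show ?thesis using assms X unfolding val_def by blast
qed

text \<open>A formula determines its immediate parts, so inversion determines its value from theirs.
  This is recursion on formulas carried out in the model.\<close>

lemma val_unique: "formula p \<Longrightarrow> \<exists>!s. val M p s"
proof (induction p rule: formula_induct)
  case definable
  show ?case by (intro dint)
next
  case (Mem i j)
  show ?case
    by (rule ex1I[of _ "sMem M i j"], rule val_intros(1)[OF Mem]) (drule val_imp_form, simp add: val_form_def)
next
  case (Eq i j)
  show ?case
    by (rule ex1I[of _ "sEq M i j"], rule val_intros(2)[OF Eq]) (drule val_imp_form, simp add: val_form_def)
next
  case (Not p)
  then obtain s where s: "val M p s" "\<And>t. val M p t \<Longrightarrow> t = s" by blast
  show ?case
    by (rule ex1I[of _ "sNot M s"], rule val_intros(3)[OF s(1)])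
      (drule val_imp_form, auto simp: val_form_def dest: s(2))
next
  case (And p q)
  then obtain s t where s: "val M p s" "\<And>u. val M p u \<Longrightarrow> u = s" and t: "val M q t" "\<And>u. val M q u \<Longrightarrow> u = t" by metis
  show ?case
    by (rule ex1I[of _ "sAnd M s t"], rule val_intros(4)[OF s(1) t(1)])
      (drule val_imp_form, auto simp: val_form_def dest: s(2) t(2))
next
  case (All i p)
  then obtain s where s: "val M p s" "\<And>t. val M p t \<Longrightarrow> t = s" by blast
  show ?case
    by (rule ex1I[of _ "sAll M i s"], rule val_intros(5)[OF All(1) s(1)])
      (drule val_imp_form, auto simp: val_form_def dest: s(2))
qed

lemma ex_truth_set: "\<exists>T. truth_set (M::'v::zfc) T"
proof -
  define tv where "tv p = (THE s. val M p s)" for p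
  have tv: "val M p (tv p)" if "formula p" for p
    unfolding tv_def using theI'[OF val_unique[OF that]] .
  have eq: "tv p = s" if "formula p" "val M p s" for p s
    using val_unique[OF that(1)] tv[OF that(1)] that(2) by blast
  define T where "T = vsep (vprod formulas (vfuns omega M)) (\<lambda>z. \<exists>p a s. z = opair p a \<and> val M p s \<and> a \<in> elts s)"
  have "elts T = {z \<in> elts (vprod formulas (vfuns omega M)). \<exists>p a s. z = opair p a \<and> val M p s \<and> a \<in> elts s}"
    unfolding T_def by (rule elts_vsep) (intro dint)
  then have T: "opair p a \<in> elts T \<longleftrightarrow> a \<in> elts (tv p)" if "formula p" "is_fun a omega M" for p a
  proof -
    have "opair p a \<in> elts T \<longleftrightarrow> (\<exists>s. val M p s \<and> a \<in> elts s)"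
      using that \<open>elts T = _\<close> by (simp add: elts_vprod elts_formulas elts_vfuns)
    also have "\<dots> \<longleftrightarrow> a \<in> elts (tv p)"
      using tv[OF that(1)] eq[OF that(1)] by metis
    finally show ?thesis .
  qed
  have tvs: "tv (mem_code i j) = sMem M i j" "tv (eq_code i j) = sEq M i j" if "i \<in> elts omega" "j \<in> elts omega" for i j
    using that by (auto intro!: eq val_intros)
  have tvn: "tv (not_code p) = sNot M (tv p)" if "formula p" for p
    using that by (auto intro!: eq val_intros tv)
  have tva: "tv (and_code p q) = sAnd M (tv p) (tv q)" if "formula p" "formula q" for p q
    using that by (auto intro!: eq val_intros tv)
  have tvl: "tv (all_code i p) = sAll M i (tv p)" if "formula p" "i \<in> elts omega" for i p
    using that by (auto intro!: eq val_intros tv)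
  have "truth_set M T"
    unfolding truth_set_def
  proof (intro allI impI conjI ballI)
    fix a i j :: 'v assume "is_fun a omega M" "i \<in> elts omega" "j \<in> elts omega"
    then show "opair (mem_code i j) a \<in> elts T \<longleftrightarrow> app a i \<in> elts (app a j)"
      "opair (eq_code i j) a \<in> elts T \<longleftrightarrow> app a i = app a j"
      by (simp_all add: T tvs elts_s is_fun_app[of a omega M])
  next
    fix a p :: 'v assume "is_fun a omega M" "formula p"
    then show "opair (not_code p) a \<in> elts T \<longleftrightarrow> opair p a \<notin> elts T"
      by (simp add: T tvn elts_s)
  next
    fix a p q :: 'v assume "is_fun a omega M" "formula p" "formula q"
    then show "opair (and_code p q) a \<in> elts T \<longleftrightarrow> opair p a \<in> elts T \<and> opair q a \<in> elts T"
      by (simp add: T tva elts_s)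
  next
    fix a i p :: 'v assume "is_fun a omega M" "i \<in> elts omega" "formula p"
    then show "opair (all_code i p) a \<in> elts T \<longleftrightarrow> (\<forall>x\<in>elts M. opair p (upd a i x) \<in> elts T)"
      by (simp add: T tvl elts_s is_fun_upd)
  qed
  then show ?thesis by blast
qed

text \<open>Makes the existential quantifier over truth sets in \<open>satisfies\<close> harmless:
  all of them agree on formulas, standard or not.\<close>

lemma truth_set_unique:
  assumes T: "truth_set M T" "truth_set M T'" and "formula (p::'v::zfc)"
  shows "\<forall>a. is_fun a omega M \<longrightarrow> (opair p a \<in> elts T \<longleftrightarrow> opair p a \<in> elts T')"
  using assms(3)
proof (induction p rule: formula_induct)
  case definable
  show ?case by (intro dint)
next
  case (All i p)
  show ?case
  proof (intro allI impI)
    fix a assume a: "is_fun a omega M"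
    have "opair (all_code i p) a \<in> elts T \<longleftrightarrow> (\<forall>x\<in>elts M. opair p (upd a i x) \<in> elts T)"
      "opair (all_code i p) a \<in> elts T' \<longleftrightarrow> (\<forall>x\<in>elts M. opair p (upd a i x) \<in> elts T')"
      using T a All(1,2) unfolding truth_set_def by blast+
    then show "opair (all_code i p) a \<in> elts T \<longleftrightarrow> opair (all_code i p) a \<in> elts T'"
      using All(3) is_fun_upd[OF a All(1)] by simp
  qed
qed (use T in \<open>simp_all add: truth_set_def\<close>)

lemma satisfies_iff:
  "truth_set M T \<Longrightarrow> formula p \<Longrightarrow> is_fun a omega M \<Longrightarrow> satisfies M p a \<longleftrightarrow> opair p a \<in> elts (T::'v::zfc)"
  unfolding satisfies_def using truth_set_unique by blast

context
  fixes M a :: "'v::zfc"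
  assumes a: "is_fun a omega M"
begin

lemma sat_mem: "i \<in> elts omega \<Longrightarrow> j \<in> elts omega \<Longrightarrow> satisfies M (mem_code i j) a \<longleftrightarrow> ap a i \<in> elts (ap a j)"
  and sat_eq: "i \<in> elts omega \<Longrightarrow> j \<in> elts omega \<Longrightarrow> satisfies M (eq_code i j) a \<longleftrightarrow> ap a i = ap a j"
  and sat_not: "formula p \<Longrightarrow> satisfies M (not_code p) a \<longleftrightarrow> \<not> satisfies M p a"
  and sat_and: "formula p \<Longrightarrow> formula q \<Longrightarrow> satisfies M (and_code p q) a \<longleftrightarrow> satisfies M p a \<and> satisfies M q a"
  and sat_all: "i \<in> elts omega \<Longrightarrow> formula p \<Longrightarrow>
    satisfies M (all_code i p) a \<longleftrightarrow> (\<forall>x\<in>elts M. satisfies M p (upd a i x))"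
proof -
  obtain T where T: "truth_set M T" using ex_truth_set by blast
  note s = satisfies_iff[OF T]
  note t = T[unfolded truth_set_def, rule_format, OF a]
  show "satisfies M (mem_code i j) a \<longleftrightarrow> ap a i \<in> elts (ap a j)" if "i \<in> elts omega" "j \<in> elts omega"
    using that a t by (simp add: s is_fun_app[OF a])
  show "satisfies M (eq_code i j) a \<longleftrightarrow> ap a i = ap a j" if "i \<in> elts omega" "j \<in> elts omega"
    using that a t by (simp add: s is_fun_app[OF a])
  show "satisfies M (not_code p) a \<longleftrightarrow> \<not> satisfies M p a" if "formula p"
    using that a t by (simp add: s)
  show "satisfies M (and_code p q) a \<longleftrightarrow> satisfies M p a \<and> satisfies M q a" if "formula p" "formula q"
    using that a t by (simp add: s)
  show "satisfies M (all_code i p) a \<longleftrightarrow> (\<forall>x\<in>elts M. satisfies M p (upd a i x))" if "i \<in> elts omega" "formula p"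
    using that a t by (simp add: s is_fun_upd)
qed

end

definition ex_code :: "'v::zfc \<Rightarrow> 'v \<Rightarrow> 'v" where
  "ex_code i p = not_code (all_code i (not_code p))"

lemma formula_ex_code [simp]: "i \<in> elts omega \<Longrightarrow> formula p \<Longrightarrow> formula (ex_code i p)"
  unfolding ex_code_def by simp

lemma sat_ex:
  assumes "is_fun a omega M" "i \<in> elts omega" "formula p"
  shows "satisfies M (ex_code i p) a \<longleftrightarrow> (\<exists>x\<in>elts M. satisfies M p (upd a i x))"
  unfolding ex_code_def using assms by (simp add: sat_not sat_all is_fun_upd)

primrec code :: "fm \<Rightarrow> 'v::zfc" where
  "code (FMem i j) = mem_code (vnat i) (vnat j)"
| "code (FEq i j) = eq_code (vnat i) (vnat j)"
| "code (FNot \<phi>) = not_code (code \<phi>)"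
| "code (FAnd \<phi> \<psi>) = and_code (code \<phi>) (code \<psi>)"
| "code (FAll i \<phi>) = all_code (vnat i) (code \<phi>)"

lemma formula_code [simp]: "formula (code \<phi>)"
  by (induction \<phi>) simp_all

text \<open>Connects reflection, which concerns formulas of the meta-language, with satisfaction in
  the model; \<open>code\<close> reaches only standard formulas.\<close>

lemma sat_code: "is_fun a omega M \<Longrightarrow> satisfies M (code \<phi>) a \<longleftrightarrow> holdsU (elts M) \<phi> (\<lambda>i. ap a (vnat i))"
proof (induction \<phi> arbitrary: a)
  case (FAll k \<phi>)
  have "(\<lambda>i. ap (upd a (vnat k) x) (vnat i)) = (\<lambda>i. ap a (vnat i))(k := x)" for x
    by (rule ext) (simp add: ap_upd[OF is_fun_fn[OF FAll.prems]])
  then show ?case using FAll by (simp add: sat_all is_fun_upd)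
qed (simp_all add: sat_mem sat_eq sat_not sat_and)

text \<open>Replaces \<open>app\<close> by the definable \<open>ap\<close>, so that satisfaction
  itself becomes definable.\<close>

lemma truth_set_ap: "truth_set M T \<longleftrightarrow> (\<forall>a. is_fun a omega M \<longrightarrow>
     (\<forall>i\<in>elts omega. \<forall>j\<in>elts omega.
        (opair (mem_code i j) a \<in> elts T \<longleftrightarrow> ap a i \<in> elts (ap a j)) \<and>
        (opair (eq_code i j) a \<in> elts T \<longleftrightarrow> ap a i = ap a j)) \<and>
     (\<forall>p. formula p \<longrightarrow>
        (opair (not_code p) a \<in> elts T \<longleftrightarrow> opair p a \<notin> elts T)) \<and>
     (\<forall>p q. formula p \<longrightarrow> formula q \<longrightarrow>
        (opair (and_code p q) a \<in> elts T \<longleftrightarrow> opair p a \<in> elts T \<and> opair q a \<in> elts T)) \<and>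
     (\<forall>i\<in>elts omega. \<forall>p. formula p \<longrightarrow>
        (opair (all_code i p) a \<in> elts T \<longleftrightarrow>
          (\<forall>x\<in>elts M. opair p (upd a i x) \<in> elts (T::'v::zfc)))))"
  unfolding truth_set_def by (rule all_cong1, rule imp_cong[OF refl]) (simp add: is_fun_app[of _ omega M])

lemma dfn_satisfies [dint]:
  assumes "dterm P M" "dterm P p" "dterm P a" shows "dfn P (\<lambda>e. satisfies (M e) (p e) (a e :: 'v::zfc))"
  by (rule dfn3I[OF _ assms], unfold satisfies_def truth_set_ap, intro dint)


section \<open>Elements definable over a level\<close>

text \<open>Variables 0, 1 and 2 are scratch variables; the others carry the parameters \<open>e\<close>.\<close>

definition agree :: "'v::zfc \<Rightarrow> 'v \<Rightarrow> 'v \<Rightarrow> bool" where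
  "agree M e a \<longleftrightarrow> is_fun a omega M \<and>
    (\<forall>i\<in>elts omega. i \<noteq> vnat 0 \<longrightarrow> i \<noteq> vnat 1 \<longrightarrow> i \<noteq> vnat 2 \<longrightarrow> ap a i = ap e i)"

text \<open>Variable 0 holds the defined set. Quantifying over all \<open>a\<close> that agree with
  \<open>e\<close> makes \<open>d\<close> insensitive to the scratch variables 1 and 2, so
  definitions can be nested under one another's quantifiers.\<close>

definition Df :: "'v::zfc \<Rightarrow> 'v \<Rightarrow> 'v \<Rightarrow> bool" where
  "Df M e X \<longleftrightarrow> X \<in> elts M \<and>
    (\<exists>d. formula d \<and> (\<forall>a. agree M e a \<longrightarrow> (satisfies M d a \<longleftrightarrow> ap a (vnat 0) = X)))"

lemma dfn_agree [dint]:
  assumes "dterm P M" "dterm P p" "dterm P a" shows "dfn P (\<lambda>e. agree (M e) (p e) (a e))"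
  by (rule dfn3I[OF _ assms], unfold agree_def, intro dint)

lemma dfn_Df [dint]:
  assumes "dterm P M" "dterm P p" "dterm P a" shows "dfn P (\<lambda>e. Df (M e) (p e) (a e))"
  by (rule dfn3I[OF _ assms], unfold Df_def, intro dint)

definition reflects_rel :: "'v::zfc \<Rightarrow> ('v \<Rightarrow> 'v \<Rightarrow> 'v \<Rightarrow> bool) \<Rightarrow> bool" where
  "reflects_rel M R \<longleftrightarrow> (\<exists>\<phi>. \<forall>e. (\<forall>i. e i \<in> elts M) \<longrightarrow> holdsU (elts M) \<phi> e = R (e 0) (e 1) (e 2))"

lemma reflection_rel:
  assumes "\<And>R. R \<in> set Rs \<Longrightarrow> dfn {} (\<lambda>e. R (e 0) (e 1) (e 2))"
  shows "\<exists>\<mu>. limit_ordinal \<mu> \<and> (x::'v::zfc) \<in> V \<mu> \<and> (\<forall>R\<in>set Rs. reflects_rel (vlev \<mu>) R)"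
proof -
  have "\<forall>R\<in>set Rs. \<exists>\<phi>. \<forall>e. holds \<phi> e = R (e 0) (e 1) (e 2)"
    using assms unfolding dfn_empty by simp
  from bchoice[OF this] obtain f
    where f: "\<And>R e. R \<in> set Rs \<Longrightarrow> holds (f R) e = R (e 0) (e 1) (e 2)" by auto
  obtain \<mu> where \<mu>: "limit_ordinal \<mu>" "x \<in> V \<mu>" "\<forall>\<phi>\<in>set (map f Rs). reflects \<mu> \<phi>"
    using reflection[of x "map f Rs"] by blast
  have "reflects_rel (vlev \<mu>) R" if "R \<in> set Rs" for R
    unfolding reflects_rel_def using \<mu>(3) f[OF that] that unfolding reflects_def
    by (intro exI[of _ "f R"]) simp
  with \<mu> show ?thesis by blast
qed

lemma agree_upd:
  assumes "agree M e a" "x \<in> elts M" "k < 3" shows "agree M e (upd a (vnat k) x)"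
proof -
  have a: "is_fun a omega M" using assms(1) unfolding agree_def by blast
  have "vnat k \<in> {vnat 0, vnat 1, vnat 2 :: 'a}" using assms(3) by (auto simp del: vnat.simps simp: less_Suc_eq numeral_3_eq_3)
  then show ?thesis
    using assms(1) is_fun_upd[OF a _ assms(2), of "vnat k"] unfolding agree_def
    by (auto simp: ap_upd[OF is_fun_fn[OF a]] simp del: vnat.simps One_nat_def)
qed

text \<open>The formula says that variables 1 and 2 have values that satisfy the definitions of
  \<open>X\<close> and \<open>Y\<close> and that the formula reflecting \<open>R\<close> holds of
  variables 0, 1 and 2.\<close>

lemma Df_relation:
  assumes X: "Df M e X" and Y: "Df M e Y" and R: "reflects_rel M R"
  shows "\<exists>d. formula d \<and> (\<forall>a. agree M e a \<longrightarrow> (satisfies M d a \<longleftrightarrow> R (ap a (vnat 0)) X Y))"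
proof -
  obtain p where p: "formula p" "\<And>a. agree M e a \<Longrightarrow> satisfies M p a \<longleftrightarrow> ap a (vnat 0) = X"
    using X unfolding Df_def by blast
  obtain q where q: "formula q" "\<And>a. agree M e a \<Longrightarrow> satisfies M q a \<longleftrightarrow> ap a (vnat 0) = Y"
    using Y unfolding Df_def by blast
  obtain \<phi> where \<phi>: "\<And>e. (\<And>i. e i \<in> elts M) \<Longrightarrow> holdsU (elts M) \<phi> e = R (e 0) (e 1) (e 2)"
    using R unfolding reflects_rel_def by blast
  have XM: "X \<in> elts M" and YM: "Y \<in> elts M" using X Y unfolding Df_def by blast+
  have fn: "is_fun a omega M" if "agree M e a" for a using that unfolding agree_def by blast
  \<comment> \<open>\<open>pin k d\<close> asserts \<open>d\<close> of variable \<open>k\<close> by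
    requantifying variable 0 and equating it with \<open>k\<close>. Renaming variables inside
    \<open>d\<close>, a possibly non-standard formula, would take another internal
    recursion.\<close>
  define pin :: "nat \<Rightarrow> 'a \<Rightarrow> 'a" where "pin k d = ex_code (vnat 0) (and_code (eq_code (vnat 0) (vnat k)) d)" for k d
  have pin_f: "formula (pin k d)" if "formula d" for k d
    unfolding pin_def using that by (simp del: vnat.simps)
  have pin: "satisfies M (pin k d) a \<longleftrightarrow> ap a (vnat k) = Z"
    if d: "formula d" "\<And>a. agree M e a \<Longrightarrow> satisfies M d a \<longleftrightarrow> ap a (vnat 0) = Z"
      and a: "agree M e a" and k: "k \<noteq> 0" for k d Z a
  proof -
    note f = is_fun_fn[OF fn[OF a]]
    have "satisfies M (pin k d) a \<longleftrightarrow> (\<exists>x\<in>elts M. x = ap a (vnat k) \<and> x = Z)"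
    proof -
      have "satisfies M (and_code (eq_code (vnat 0) (vnat k)) d) (upd a (vnat 0) x) \<longleftrightarrow> x = ap a (vnat k) \<and> x = Z"
        if x: "x \<in> elts M" for x
        using k d a fn agree_upd[OF a x, of 0] by (simp add: sat_and sat_eq ap_upd[OF f] del: vnat.simps)
      then show ?thesis unfolding pin_def using fn[OF a] d(1) by (simp add: sat_ex del: vnat.simps)
    qed
    then show ?thesis using is_fun_ap[OF fn[OF a], of "vnat k"] by auto
  qed
  define d2 :: 'a where "d2 = and_code (pin 2 q) (code \<phi>)"
  define d1 :: 'a where "d1 = and_code (pin 1 p) (ex_code (vnat 2) d2)"
  have f2: "formula d2" and f1: "formula d1"
    unfolding d1_def d2_def using pin_f[OF p(1)] pin_f[OF q(1)] by (simp_all del: vnat.simps)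
  have "satisfies M (ex_code (vnat 1) d1) a \<longleftrightarrow> R (ap a (vnat 0)) X Y" if a: "agree M e a" for a
  proof -
    have s2: "satisfies M d2 (upd b (vnat 2) y) \<longleftrightarrow> y = Y \<and> R (ap b (vnat 0)) (ap b (vnat 1)) y"
      if b: "agree M e b" and y: "y \<in> elts M" for b y
    proof -
      note f = is_fun_fn[OF fn[OF b]]
      let ?b = "upd b (vnat 2) y"
      have b': "agree M e ?b" using agree_upd[OF b y, of 2] by simp
      have "holdsU (elts M) \<phi> (\<lambda>i. ap ?b (vnat i)) \<longleftrightarrow> R (ap ?b (vnat 0)) (ap ?b (vnat 1)) (ap ?b (vnat 2))"
        by (rule \<phi>) (rule is_fun_ap[OF fn[OF b']], simp)
      then show ?thesis
        unfolding d2_def using pin[OF q b', of 2] pin_f[OF q(1)] fn[OF b']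
        by (simp add: sat_and sat_code ap_upd[OF f] del: vnat.simps One_nat_def)
    qed
    have s1: "satisfies M d1 (upd a (vnat 1) x) \<longleftrightarrow> x = X \<and> R (ap a (vnat 0)) x Y" if x: "x \<in> elts M" for x
    proof -
      note f = is_fun_fn[OF fn[OF a]]
      let ?a = "upd a (vnat 1) x"
      have a': "agree M e ?a" using agree_upd[OF a x, of 1] by (simp del: vnat.simps One_nat_def)
      have "satisfies M (ex_code (vnat 2) d2) ?a \<longleftrightarrow> (\<exists>y\<in>elts M. y = Y \<and> R (ap ?a (vnat 0)) (ap ?a (vnat 1)) y)"
        using fn[OF a'] f2 s2[OF a'] by (simp add: sat_ex del: vnat.simps One_nat_def)
      then show ?thesis
        unfolding d1_def using pin[OF p a', of 1] pin_f[OF p(1)] fn[OF a'] f2 YM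
        by (simp add: sat_and ap_upd[OF f] del: vnat.simps One_nat_def)
    qed
    show ?thesis using fn[OF a] f1 s1 XM by (simp add: sat_ex del: vnat.simps One_nat_def)
  qed
  then show ?thesis using f1 by (intro exI[of _ "ex_code (vnat 1) d1"]) (simp del: vnat.simps One_nat_def)
qed

lemma Df_term:
  assumes "Df M e X" "Df M e Y" "reflects_rel M (\<lambda>z x y. z = f x y)" "f X Y \<in> elts M"
  shows "Df M e (f X Y)"
  using Df_relation[OF assms(1-3)] assms(4) unfolding Df_def by blast

text \<open>Successor, pairing and adjunction of one element: starting from the empty set they
  generate the natural numbers, the formulas, and the finite sequences of definable sets.\<close>

definition basic_rels :: "('v::zfc \<Rightarrow> 'v \<Rightarrow> 'v \<Rightarrow> bool) list" where
  "basic_rels = [\<lambda>z x y. z = vsucc x, \<lambda>z x y. z = opair x y, \<lambda>z x y. z = vun x (upair y y)]"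

lemma dfn_basic_rels: "R \<in> set basic_rels \<Longrightarrow> dfn {} (\<lambda>e. R (e 0) (e 1) (e 2))"
  unfolding basic_rels_def by (auto intro!: dint)

context
  fixes M e \<mu> :: "'v::zfc"
  assumes M: "M = vlev \<mu>" and lim: "limit_ordinal \<mu>"
    and rels: "\<And>R. R \<in> set basic_rels \<Longrightarrow> reflects_rel M R" and e: "is_fun e omega M"
begin

lemma Df_vempty: "Df M e vempty"
proof -
  define d :: 'v where "d = all_code (vnat 1) (not_code (mem_code (vnat 1) (vnat 0)))"
  have 0: "vempty \<in> elts M" unfolding M by (rule omega_vlev_limit[OF lim]) simp
  have "satisfies M d a \<longleftrightarrow> ap a (vnat 0) = vempty" if a: "agree M e a" for a
  proof -
    have f: "is_fun a omega M" using a unfolding agree_def by blast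
    have "satisfies M d a \<longleftrightarrow> (\<forall>x\<in>elts M. x \<notin> elts (ap a (vnat 0)))"
      unfolding d_def using f
      by (simp add: sat_all sat_not sat_mem is_fun_upd ap_upd[OF is_fun_fn[OF f]] del: vnat.simps One_nat_def)
    also have "\<dots> \<longleftrightarrow> elts (ap a (vnat 0)) = {}"
    proof -
      have "elts (ap a (vnat 0)) \<subseteq> elts M"
        using is_fun_ap[OF f, of "vnat 0"] vlev_trans[OF limit_ordinal_ordinal[OF lim]] unfolding M by auto
      then show ?thesis by auto
    qed
    finally show ?thesis by (simp only: elts_eq_empty)
  qed
  moreover have "formula d" unfolding d_def by (simp del: vnat.simps)
  ultimately show ?thesis unfolding Df_def using 0 by blast
qed

lemma Df_opair:
  assumes "Df M e X" "Df M e Y" shows "Df M e (opair X Y)"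
proof (rule Df_term[of M e X Y opair, OF assms])
  show "opair X Y \<in> elts M" using assms vlev_limit_opair[OF lim] unfolding Df_def M by blast
qed (rule rels, simp add: basic_rels_def)

lemma Df_insert:
  assumes "Df M e X" "Df M e Y" shows "Df M e (vun X (upair Y Y))"
proof (rule Df_term[of M e X Y "\<lambda>x y. vun x (upair y y)", OF assms])
  show "vun X (upair Y Y) \<in> elts M" using assms vlev_limit_vun[OF lim] unfolding Df_def M by blast
qed (rule rels, simp add: basic_rels_def)

lemma Df_omega: "n \<in> elts omega \<Longrightarrow> Df M e n"
proof (induction n rule: omega_induct)
  case definable
  show ?case by (intro dint)
next
  case (succ n)
  show ?case
    by (rule Df_term[of M e n n "\<lambda>x y. vsucc x", OF succ(2) succ(2)], rule rels, simp add: basic_rels_def)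
      (unfold M, rule omega_vlev_limit[OF lim], simp add: succ(1))
qed (rule Df_vempty)

text \<open>The induction covers non-standard \<open>p\<close> because \<open>Df\<close> quantifies
  over formulas of the model and is itself definable; the defining formula grows along with
  \<open>p\<close>.\<close>

lemma Df_formula: "formula p \<Longrightarrow> Df M e p"
proof (induction p rule: formula_induct)
  case definable
  show ?case by (intro dint)
qed (unfold codes_def; intro Df_opair Df_omega[OF vnat_omega]; (assumption | rule Df_omega; assumption))+

lemma Df_param:
  assumes "i \<in> elts omega" "i \<noteq> vnat 0" "i \<noteq> vnat 1" "i \<noteq> vnat 2" shows "Df M e (ap e i)"
  unfolding Df_def
proof (intro conjI exI[of _ "eq_code (vnat 0) i"] allI impI)
  show "ap e i \<in> elts M" using is_fun_ap[OF e assms(1)] .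
  show "satisfies M (eq_code (vnat 0) i) a \<longleftrightarrow> ap a (vnat 0) = ap e i" if "agree M e a" for a
    using that assms unfolding agree_def by (simp add: sat_eq del: vnat.simps)
qed (simp add: assms del: vnat.simps)

text \<open>The sequence is built by adjoining one pair at a time. Definability of each entry does
  not pass to the infinite sequence \<open>b\<close> in this way, hence the cut at \<open>n\<close>,
  a finite number in the sense of the model.\<close>

lemma Df_restr:
  assumes b: "fn b omega" and bD: "\<And>i. i \<in> elts omega \<Longrightarrow> Df M e (ap b i)" and "n \<in> elts omega"
  shows "Df M e (restr b n)"
  using assms(3)
proof (induction n rule: omega_induct)
  case definable
  show ?case by (intro dint)
next
  case zero
  have "restr b vempty = vempty" by (rule v_eqI) (simp add: elts_restr)
  then show ?case using Df_vempty by simp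
next
  case (succ n)
  have "restr b (vsucc n) = vun (restr b n) (upair (opair n (ap b n)) (opair n (ap b n)))"
    by (rule v_eqI) (use elts_fn[OF b] succ(1) omega_trans[OF succ(1)] in \<open>auto simp: elts_restr\<close>)
  then show ?case
    using Df_insert[OF succ(2) Df_opair[OF Df_omega[OF succ(1)] bD[OF succ(1)]]] by simp
qed

end


section \<open>Strategies\<close>

definition two :: "'v::zfc" where
  "two = upair (vnat 0) (vnat 1)"

lemma vempty_two [simp]: "vempty \<in> elts two" and vnat_1_two [simp]: "vnat 1 \<in> elts two"
  unfolding two_def by simp_all

lemma dterm_two [dint]: "dterm P (\<lambda>e. two)"
  unfolding two_def by (intro dint)

lemma ap_outside: "fn f A \<Longrightarrow> x \<notin> elts A \<Longrightarrow> ap f x = vempty"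
  unfolding ap_def vthe_def using fn_mem by metis

text \<open>The default value 0 of \<open>ap\<close> is itself a legal move, so moves can be read
  off without a condition on the index.\<close>

lemma ap_two: "is_fun f A two \<Longrightarrow> ap f x \<in> elts two"
  by (cases "x \<in> elts A") (simp_all add: is_fun_ap ap_outside[OF is_fun_fn])

lemma vlam_cong:
  assumes "dterm UNIV (\<lambda>e. F (e 0))" "dterm UNIV (\<lambda>e. G (e 0))" "\<And>x. x \<in> elts A \<Longrightarrow> F x = G x"
  shows "vlam A F = vlam A G"
  by (rule fn_ext[OF fn_vlam[OF assms(1)] fn_vlam[OF assms(2)]])
    (simp add: ap_vlam[OF assms(1)] ap_vlam[OF assms(2)] assms(3))

lemma elts_positions:
  assumes "dfn {} (\<lambda>e. turn (e 0))"
  shows "elts (positions turn \<theta> S) = {p. \<exists>\<beta>\<in>elts \<theta>. turn \<beta> \<and> is_fun p \<beta> (S::'v::zfc)}"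
  unfolding positions_def
proof (rule elts_mkset, rule small_subset)
  have "dterm UNIV (\<lambda>e. vfuns (e 0) S)" by (intro dint)
  then show "{p. \<exists>\<beta>\<in>elts \<theta>. turn \<beta> \<and> is_fun p \<beta> S} \<subseteq> elts (vUN \<theta> (\<lambda>\<beta>. vfuns \<beta> S))"
    by (subst elts_vUN) (auto simp: elts_vfuns)
qed (unfold mem_Collect_eq, intro dint dfn1I[OF assms])

lemma dterm_positions:
  assumes "dfn {} (\<lambda>e. turn (e 0))" "dterm P s" "dterm P (t :: (nat \<Rightarrow> 'v::zfc) \<Rightarrow> 'v)"
  shows "dterm P (\<lambda>e. positions turn (s e) (t e))"
  by (rule dterm2I[OF _ assms(2,3)], subst v_eq_iff, unfold elts_positions[OF assms(1)] mem_Collect_eq,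
      intro dint dfn1I[OF assms(1)])

text \<open>\<open>follows\<close> in terms of the definable \<open>ap\<close>; they are equivalent
  for a strategy and a play, because the position \<open>restr x \<beta>\<close> then lies in the
  domain of the strategy.\<close>

definition obeys :: "('v::zfc \<Rightarrow> bool) \<Rightarrow> 'v \<Rightarrow> 'v \<Rightarrow> 'v \<Rightarrow> bool" where
  "obeys turn \<theta> \<sigma> x \<longleftrightarrow> (\<forall>\<beta>\<in>elts \<theta>. turn \<beta> \<longrightarrow> ap x \<beta> = ap \<sigma> (restr x \<beta>))"

lemma follows_iff_obeys:
  assumes "dfn {} (\<lambda>e. turn (e 0))" "ordinal \<theta>" "strategy turn \<theta> S \<sigma>" "is_fun x \<theta> (S::'v::zfc)"
  shows "follows turn \<theta> \<sigma> x \<longleftrightarrow> obeys turn \<theta> \<sigma> x"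
proof -
  have "app x \<beta> = ap x \<beta>" "app \<sigma> (restr x \<beta>) = ap \<sigma> (restr x \<beta>)" if b: "\<beta> \<in> elts \<theta>" "turn \<beta>" for \<beta>
  proof -
    show "app x \<beta> = ap x \<beta>" by (rule is_fun_app[OF assms(4) b(1)])
    have "restr x \<beta> \<in> elts (positions turn \<theta> S)"
      unfolding elts_positions[OF assms(1)]
      using b is_fun_restr[OF assms(4) ordinal_subset[OF assms(2) b(1)]] by blast
    then show "app \<sigma> (restr x \<beta>) = ap \<sigma> (restr x \<beta>)"
      using assms(3) unfolding strategy_def by (rule is_fun_app[rotated])
  qed
  then show ?thesis unfolding follows_def obeys_def by simp
qed

definition wins1 :: "'v::zfc \<Rightarrow> 'v \<Rightarrow> 'v \<Rightarrow> bool" where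
  "wins1 \<theta> S A \<longleftrightarrow> (\<exists>\<sigma>. is_fun \<sigma> (positions first_turn \<theta> S) S \<and>
    (\<forall>x. is_fun x \<theta> S \<longrightarrow> obeys first_turn \<theta> \<sigma> x \<longrightarrow> x \<in> elts A))"

definition wins2 :: "'v::zfc \<Rightarrow> 'v \<Rightarrow> 'v \<Rightarrow> bool" where
  "wins2 \<theta> S A \<longleftrightarrow> (\<exists>\<sigma>. is_fun \<sigma> (positions second_turn \<theta> S) S \<and>
    (\<forall>x. is_fun x \<theta> S \<longrightarrow> obeys second_turn \<theta> \<sigma> x \<longrightarrow> x \<notin> elts A))"

lemma dfn_turns: "dfn {} (\<lambda>e. first_turn (e 0 :: 'v::zfc))" "dfn {} (\<lambda>e. second_turn (e 0 :: 'v))"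
  by (intro dint)+

lemma determined_iff: "ordinal \<theta> \<Longrightarrow> determined \<theta> S A \<longleftrightarrow> wins1 \<theta> S A \<or> wins2 \<theta> S (A::'v::zfc)"
  unfolding determined_def first_wins_def second_wins_def wins1_def wins2_def
  using follows_iff_obeys[OF dfn_turns(1), of \<theta> S] follows_iff_obeys[OF dfn_turns(2), of \<theta> S]
  by (metis strategy_def)

lemma dfn_wins1 [dint]:
  assumes "dterm P s" "dterm P t" "dterm P u" shows "dfn P (\<lambda>e. wins1 (s e) (t e) (u e))"
  by (rule dfn3I[OF _ assms], unfold wins1_def obeys_def, intro dint dterm_positions[OF dfn_turns(1)])

text \<open>The play in which one player uses \<open>\<sigma>\<close> against an opponent whose
  moves are fixed in advance by \<open>G\<close>.\<close>

definition run :: "('v::zfc \<Rightarrow> bool) \<Rightarrow> 'v \<Rightarrow> ('v \<Rightarrow> 'v) \<Rightarrow> 'v \<Rightarrow> 'v" where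
  "run turn \<sigma> G = trec (\<lambda>\<beta> f. if turn \<beta> then ap \<sigma> f else G \<beta>)"

context
  fixes turn :: "'v::zfc \<Rightarrow> bool"
  assumes turn: "dfn {} (\<lambda>e. turn (e 0))"
begin

lemma dfn_turn: "dterm P s \<Longrightarrow> dfn P (\<lambda>e. turn (s e))"
  by (rule dfn1I[OF turn])

lemma dterm_runH: "dterm UNIV (\<lambda>e. G (e 0)) \<Longrightarrow> dterm UNIV (\<lambda>e. if turn (e 0) then ap \<sigma> (e 1) else G (e 0))"
  by (intro dint dfn_turn)

lemma dterm_run: "dterm UNIV (\<lambda>e. G (e 0)) \<Longrightarrow> dterm UNIV (\<lambda>e. run turn \<sigma> G (e 0))"
  unfolding run_def using dterm_trec'[OF dterm_runH] .

lemma run_eq: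
  assumes "dterm UNIV (\<lambda>e. G (e 0))" "ordinal \<beta>"
  shows "run turn \<sigma> G \<beta> = (if turn \<beta> then ap \<sigma> (vlam \<beta> (run turn \<sigma> G)) else G \<beta>)"
  unfolding run_def by (rule trec_eq[OF dterm_runH[OF assms(1)] assms(2)])

lemma run_two:
  assumes G: "dterm UNIV (\<lambda>e. G (e 0))" "\<And>x. G x \<in> elts two"
    and \<sigma>: "is_fun \<sigma> (positions turn \<theta> two) two" and \<theta>: "ordinal \<theta>"
    and b: "\<beta> \<in> elts \<theta>"
  shows "run turn \<sigma> G \<beta> \<in> elts two"
  using \<theta> b
proof (induction rule: ordinal_mem_induct)
  case definable
  show ?case by (intro dint dterm_run G)
next
  case (step \<beta>)
  have "is_fun (vlam \<beta> (run turn \<sigma> G)) \<beta> two"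
    by (rule is_fun_vlam[OF dterm_run[OF G(1)] step(4)])
  then have "turn \<beta> \<Longrightarrow> vlam \<beta> (run turn \<sigma> G) \<in> elts (positions turn \<theta> two)"
    unfolding elts_positions[OF turn] using step(1) by blast
  then show ?case
    using is_fun_ap[OF \<sigma>] G(2) run_eq[OF G(1) step(2), of \<sigma>] by simp
qed

lemma run_play:
  assumes G: "dterm UNIV (\<lambda>e. G (e 0))" "\<And>x. G x \<in> elts two"
    and \<sigma>: "is_fun \<sigma> (positions turn \<theta> two) two" and \<theta>: "ordinal \<theta>"
  shows "is_fun (vlam \<theta> (run turn \<sigma> G)) \<theta> two" "obeys turn \<theta> \<sigma> (vlam \<theta> (run turn \<sigma> G))"
proof -
  note d = dterm_run[OF G(1), of \<sigma>]
  show "is_fun (vlam \<theta> (run turn \<sigma> G)) \<theta> two"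
    by (rule is_fun_vlam[OF d]) (rule run_two[OF G \<sigma> \<theta>])
  have "ap (vlam \<theta> (run turn \<sigma> G)) \<beta> = ap \<sigma> (restr (vlam \<theta> (run turn \<sigma> G)) \<beta>)"
    if b: "\<beta> \<in> elts \<theta>" "turn \<beta>" for \<beta>
  proof -
    have sub: "elts \<beta> \<subseteq> elts \<theta>" using ordinal_subset[OF \<theta> b(1)] .
    have "restr (vlam \<theta> (run turn \<sigma> G)) \<beta> = vlam \<beta> (run turn \<sigma> G)"
    proof (rule fn_ext[OF fn_restr[OF fn_vlam[OF d] sub] fn_vlam[OF d]])
      fix x assume x: "x \<in> elts \<beta>"
      then show "ap (restr (vlam \<theta> (run turn \<sigma> G)) \<beta>) x = ap (vlam \<beta> (run turn \<sigma> G)) x"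
        using ap_restr[OF fn_vlam[OF d] sub x] ap_vlam[OF d, of x \<theta>] ap_vlam[OF d x] sub by auto
    qed
    then show ?thesis
      using ap_vlam[OF d b(1)] run_eq[OF G(1) ordinal_elem[OF \<theta> b(1)], of \<sigma>] b(2) by simp
  qed
  then show "obeys turn \<theta> \<sigma> (vlam \<theta> (run turn \<sigma> G))" unfolding obeys_def by blast
qed

lemma run_cong:
  assumes G: "dterm UNIV (\<lambda>e. G (e 0))" "dterm UNIV (\<lambda>e. H (e 0))" and \<theta>: "ordinal \<theta>"
    and eq: "\<And>x. x \<in> elts \<theta> \<Longrightarrow> G x = H x" and b: "\<beta> \<in> elts \<theta>"
  shows "run turn \<sigma> G \<beta> = run turn \<sigma> H \<beta>"
  using \<theta> b
proof (induction rule: ordinal_mem_induct)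
  case definable
  show ?case by (intro dint dterm_run G)
next
  case (step \<beta>)
  have "vlam \<beta> (run turn \<sigma> G) = vlam \<beta> (run turn \<sigma> H)"
    by (rule vlam_cong[OF dterm_run[OF G(1)] dterm_run[OF G(2)] step(4)])
  then show ?case
    using run_eq[OF G(1) step(2), of \<sigma>] run_eq[OF G(2) step(2), of \<sigma>] eq[OF step(1)] by simp
qed

end

section \<open>Concatenation of positions\<close>

definition vfst :: "'v::zfc \<Rightarrow> 'v" where
  "vfst z = vthe (\<lambda>x. \<exists>y. z = opair x y)"

text \<open>Recovers the length of a position from the position, so that a strategy can be given by
  a term in the position alone.\<close>

definition vdom :: "'v::zfc \<Rightarrow> 'v" where
  "vdom f = vimage vfst f"

text \<open>Left subtraction of \<omega>.\<close>

definition vsub :: "'v::zfc \<Rightarrow> 'v" where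
  "vsub x = vthe (\<lambda>\<gamma>. ordinal \<gamma> \<and> x = oadd omega \<gamma>)"

text \<open>The moves of the concatenation of \<open>r\<close>, taken with length \<omega>, and the
  function \<open>q\<close>; from the end of \<open>q\<close> on they are 0.\<close>

definition splice :: "'v::zfc \<Rightarrow> 'v \<Rightarrow> 'v \<Rightarrow> 'v" where
  "splice r q x = (if x \<in> elts omega then ap r x else ap q (vsub x))"

lemma dterm_vfst [dint]: assumes "dterm P s" shows "dterm P (\<lambda>e. vfst (s e))"
  unfolding vfst_def by (intro dint dterm_shift[OF dterm_shift[OF assms]])

lemma dterm_vdom [dint]: assumes "dterm P s" shows "dterm P (\<lambda>e. vdom (s e))"
  unfolding vdom_def by (intro dint assms)

lemma dterm_vsub [dint]: assumes "dterm P s" shows "dterm P (\<lambda>e. vsub (s e))"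
  unfolding vsub_def by (intro dint dterm_shift[OF assms])

lemma dterm_splice [dint]:
  assumes "dterm P r" "dterm P q" "dterm P x" shows "dterm P (\<lambda>e. splice (r e) (q e) (x e))"
  unfolding splice_def by (intro dint assms)

lemma vdom_fn: "fn f A \<Longrightarrow> vdom f = A"
proof (rule extensionality)
  assume f: "fn f A"
  have d: "dterm UNIV (\<lambda>e. vfst (e 0 :: 'a))" by (intro dint)
  have "vfst (opair x y) = x" for x y :: 'a unfolding vfst_def by (rule vthe_eq) auto
  then show "elts (vdom f) = elts A" unfolding vdom_def elts_vimage[OF d] elts_fn[OF f] by (simp add: image_image)
qed

lemma oadd_omega_notin: "ordinal \<gamma> \<Longrightarrow> oadd omega \<gamma> \<notin> elts (omega::'v::zfc)"
  using elts_oadd[of \<gamma> omega] mem_irrefl by blast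

lemma vsub_oadd: "ordinal \<gamma> \<Longrightarrow> vsub (oadd omega \<gamma>) = (\<gamma>::'v::zfc)"
  unfolding vsub_def by (rule vthe_eq) (auto simp: oadd_inject)

lemma splice_omega: "i \<in> elts omega \<Longrightarrow> splice r q i = ap r i"
  unfolding splice_def by simp

lemma splice_oadd: "ordinal \<gamma> \<Longrightarrow> splice r q (oadd omega \<gamma>) = ap q \<gamma>"
  unfolding splice_def by (simp add: oadd_omega_notin vsub_oadd)

text \<open>Stated for either player, using only that \<open>turn\<close> is invariant under the
  shift by \<omega>. The opening \<open>r\<close> is what \<open>\<sigma>\<close> produces against
  \<open>h\<close>, and \<open>\<tau>\<close> answers \<open>q\<close> as \<open>\<sigma>\<close>
  answers \<open>r\<close> followed by \<open>q\<close>. Since \<open>r\<close> does not depend on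
  \<open>y\<close>, all continuations share the reals read off from it.\<close>

lemma strategy_tail:
  fixes turn :: "'v::zfc \<Rightarrow> bool"
  assumes turn: "dfn {} (\<lambda>e. turn (e 0))" and shift': "\<forall>\<beta>. ordinal \<beta> \<longrightarrow> turn (oadd omega \<beta>) = turn \<beta>"
    and \<theta>: "ordinal \<theta>" and \<alpha>: "ordinal \<alpha>" and sub: "elts (oadd omega \<alpha>) \<subseteq> elts \<theta>"
    and \<sigma>: "is_fun \<sigma> (positions turn \<theta> two) two" and h: "is_fun h omega two"
  shows "\<exists>r \<tau>. (\<forall>i\<in>elts omega. \<not> turn i \<longrightarrow> ap r i = ap h i) \<and> is_fun \<tau> (positions turn \<alpha> two) two \<and>
    (\<forall>y. is_fun y \<alpha> two \<longrightarrow> obeys turn \<alpha> \<tau> y \<longrightarrow> (\<exists>z. is_fun z \<theta> two \<and> obeys turn \<theta> \<sigma> z \<and>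
      (\<forall>i\<in>elts omega. ap z i = ap r i) \<and> (\<forall>\<beta>\<in>elts \<alpha>. ap z (oadd omega \<beta>) = ap y \<beta>)))"
proof -
  note shift = shift'[rule_format]
  have dh: "dterm UNIV (\<lambda>e. ap h (e 0))" by (intro dint)
  note dr = dterm_run[OF turn dh, of \<sigma>]
  define r where "r = vlam omega (run turn \<sigma> (ap h))"
  have om: "elts omega \<subseteq> elts \<theta>" using sub elts_oadd[OF \<alpha>, of omega] by blast
  have r: "is_fun r omega two"
    unfolding r_def by (rule is_fun_vlam[OF dr], rule run_two[OF turn dh ap_two[OF h] \<sigma> \<theta>]) (use om in blast)
  have rh: "ap r i = ap h i" if "i \<in> elts omega" "\<not> turn i" for i
    unfolding r_def using ap_vlam[OF dr that(1)] run_eq[OF turn dh ordinal_of_omega[OF that(1)], of \<sigma>] that(2) by simp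
  have ds: "dterm UNIV (\<lambda>e. splice r q (e 0))" for r q :: 'v by (intro dint)
  have dt: "dterm UNIV (\<lambda>e. ap \<sigma> (vlam (oadd omega (vdom (e 0))) (splice r (e 0))))" by (intro dint)
  define \<tau> where "\<tau> = vlam (positions turn \<alpha> two) (\<lambda>q. ap \<sigma> (vlam (oadd omega (vdom q)) (splice r q)))"
  have pos: "vlam (oadd omega \<beta>) (splice r q) \<in> elts (positions turn \<theta> two)"
    if b: "\<beta> \<in> elts \<alpha>" "turn \<beta>" and q: "is_fun q \<beta> two" for \<beta> q
  proof -
    have "is_fun (vlam (oadd omega \<beta>) (splice r q)) (oadd omega \<beta>) two"
      by (rule is_fun_vlam[OF ds]) (simp add: splice_def ap_two[OF r] ap_two[OF q])
    moreover have "oadd omega \<beta> \<in> elts \<theta>" using oadd_less[OF \<alpha> b(1), of omega] sub by blast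
    ultimately show ?thesis
      unfolding elts_positions[OF turn] using shift[OF ordinal_elem[OF \<alpha> b(1)]] b(2) by blast
  qed
  have \<tau>: "is_fun \<tau> (positions turn \<alpha> two) two"
    unfolding \<tau>_def
  proof (rule is_fun_vlam[OF dt])
    fix q assume "q \<in> elts (positions turn \<alpha> two)"
    then obtain \<beta> where b: "\<beta> \<in> elts \<alpha>" "turn \<beta>" "is_fun q \<beta> two" unfolding elts_positions[OF turn] by blast
    show "ap \<sigma> (vlam (oadd omega (vdom q)) (splice r q)) \<in> elts two"
      unfolding vdom_fn[OF is_fun_fn[OF b(3)]] by (rule is_fun_ap[OF \<sigma> pos[OF b]])
  qed
  have "\<exists>z. is_fun z \<theta> two \<and> obeys turn \<theta> \<sigma> z \<and>
      (\<forall>i\<in>elts omega. ap z i = ap r i) \<and> (\<forall>\<beta>\<in>elts \<alpha>. ap z (oadd omega \<beta>) = ap y \<beta>)"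
    if y: "is_fun y \<alpha> two" and ob: "obeys turn \<alpha> \<tau> y" for y
  proof -
    \<comment> \<open>The opponent plays \<open>h\<close>, then the moves of \<open>y\<close>, then
      0 at the indices from \<omega> + \<alpha> on. At the player's own turns it is
      \<open>\<sigma>\<close> that must reproduce \<open>y\<close>, which is shown in
      \<open>R2\<close>.\<close>
    let ?G = "splice h y"
    let ?R = "run turn \<sigma> ?G"
    have G: "?G x \<in> elts two" for x unfolding splice_def by (simp add: ap_two[OF h] ap_two[OF y])
    note d = dterm_run[OF turn ds[of h y], of \<sigma>]
    have R1: "?R i = ap r i" if i: "i \<in> elts omega" for i
      unfolding r_def ap_vlam[OF dr i]
      by (rule run_cong[OF turn ds dh ordinal_omega _ i]) (rule splice_omega)
    have R2: "?R (oadd omega \<beta>) = ap y \<beta>" if "\<beta> \<in> elts \<alpha>" for \<beta>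
      using \<alpha> that
    proof (induction rule: ordinal_mem_induct)
      case definable
      show ?case by (intro dint dterm_app1[OF d])
    next
      case (step \<beta>)
      have y': "is_fun (restr y \<beta>) \<beta> two" by (rule is_fun_restr[OF y step(3)])
      have e: "?R (oadd omega \<beta>) = (if turn \<beta> then ap \<sigma> (vlam (oadd omega \<beta>) ?R) else ap y \<beta>)"
        using run_eq[OF turn ds, of "oadd omega \<beta>" \<sigma> h y] step(2) shift[OF step(2)] splice_oadd[OF step(2)] by simp
      show ?case
      proof (cases "turn \<beta>")
        case True
        \<comment> \<open>By induction the position reached is \<open>r\<close> followed by an
          initial part of \<open>y\<close>. There \<open>\<sigma>\<close> moves as
          \<open>\<tau>\<close> does, and \<open>y\<close> obeys \<open>\<tau>\<close>.\<close>
        have "vlam (oadd omega \<beta>) ?R = vlam (oadd omega \<beta>) (splice r (restr y \<beta>))"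
        proof (rule vlam_cong[OF d ds])
          fix x assume "x \<in> elts (oadd omega \<beta>)"
          then consider "x \<in> elts omega" | \<gamma> where "\<gamma> \<in> elts \<beta>" "x = oadd omega \<gamma>"
            unfolding elts_oadd[OF step(2)] by blast
          then show "?R x = splice r (restr y \<beta>) x"
          proof cases
            case 1
            then show ?thesis by (simp add: R1 splice_omega)
          next
            case (2 \<gamma>)
            then show ?thesis
              using step(4)[OF 2(1)] ap_restr[OF is_fun_fn[OF y] step(3) 2(1)]
                splice_oadd[OF ordinal_elem[OF step(2) 2(1)]] by simp
          qed
        qed
        moreover have "restr y \<beta> \<in> elts (positions turn \<alpha> two)"
          unfolding elts_positions[OF turn] using step(1) True y' by blast
        then have "ap \<tau> (restr y \<beta>) = ap \<sigma> (vlam (oadd omega \<beta>) (splice r (restr y \<beta>)))"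
          unfolding \<tau>_def using ap_vlam[OF dt] vdom_fn[OF is_fun_fn[OF y']] by simp
        ultimately show ?thesis using e True ob step(1) unfolding obeys_def by simp
      qed (use e in simp)
    qed
    have "ap (vlam \<theta> ?R) i = ap r i" if "i \<in> elts omega" for i
      using R1[OF that] ap_vlam[OF d, of i \<theta>] om that by auto
    moreover have "ap (vlam \<theta> ?R) (oadd omega \<beta>) = ap y \<beta>" if b: "\<beta> \<in> elts \<alpha>" for \<beta>
      using R2[OF b] b ap_vlam[OF d, of "oadd omega \<beta>" \<theta>] oadd_less[OF \<alpha> b, of omega] sub by auto
    ultimately show ?thesis using run_play[OF turn ds G \<sigma> \<theta>] by blast
  qed
  with rh \<tau> show ?thesis by (intro exI[of _ r] exI[of _ \<tau>]) simp
qed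


section \<open>The game that starts with a choice of reals\<close>

text \<open>The index of the move that carries bit \<open>j\<close> of parameter \<open>i\<close>.
  The factor 2 selects moves of the first player below \<omega>, and n j + i interleaves
  \<open>n\<close> reals.\<close>

definition slot :: "'v::zfc \<Rightarrow> 'v \<Rightarrow> 'v \<Rightarrow> 'v" where
  "slot n i j = omult (vnat 2) (oadd (omult n j) i)"

lemma dterm_slot [dint]: "dterm P s \<Longrightarrow> dterm P t \<Longrightarrow> dterm P u \<Longrightarrow> dterm P (\<lambda>e. slot (s e) (t e) (u e))"
  unfolding slot_def by (intro dint)

lemma
  assumes "n \<in> elts (omega::'v::zfc)" "i \<in> elts n" "j \<in> elts omega"
  shows slot_omega: "slot n i j \<in> elts omega" and first_turn_slot: "first_turn (slot n i j)"
proof -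
  have "i \<in> elts omega" using assms omega_trans by blast
  then have *: "oadd (omult n j) i \<in> elts omega" using assms by (intro oadd_omega omult_omega)
  then show "slot n i j \<in> elts omega" unfolding slot_def by (intro omult_omega vnat_omega)
  show "first_turn (slot n i j)" unfolding slot_def by (rule first_turn_even[OF *])
qed

lemma slot_inject:
  assumes "n \<in> elts (omega::'v::zfc)" "i \<in> elts n" "j \<in> elts omega" "i' \<in> elts n" "j' \<in> elts omega"
    and "slot n i j = slot n i' j'"
  shows "i = i' \<and> j = j'"
proof -
  have o: "ordinal n" "ordinal i" "ordinal j" "ordinal i'" "ordinal j'"
    using assms ordinal_of_omega ordinal_elem by metis+
  have "oadd (omult n j) i = oadd (omult n j') i'"
    by (rule omult_inject[OF _ _ assms(6)[unfolded slot_def]]) (simp_all add: o)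
  then show ?thesis by (rule omult_oadd_inject[OF o(1,3,5) assms(2,4)])
qed

text \<open>
  The parameters coded by \<open>b\<close> and the play \<open>z\<close>: a successor ordinal in \<open>b\<close> codes its predecessor,
  0 stands for the real read off from \<open>z\<close>.
\<close>

definition asg :: "'v::zfc \<Rightarrow> 'v \<Rightarrow> 'v \<Rightarrow> 'v" where
  "asg b n z = vlam omega (\<lambda>i. if i \<in> elts n then
      (if ap b i = vempty then vsep omega (\<lambda>j. ap z (slot n i j) = vnat 1) else vUnion (ap b i)) else vempty)"

lemma dterm_asg [dint]:
  assumes "dterm P s" "dterm P t" "dterm P u" shows "dterm P (\<lambda>e. asg (s e) (t e) (u e))"
proof -
  have "dterm {} (\<lambda>e. asg (e 1) (e 2) (e 3))" unfolding asg_def by (intro dint)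
  from dfn_eq[OF dterm_var this] show ?thesis by (rule dterm3I[OF _ assms])
qed

text \<open>For arbitrary reals the formula need not define a set of plays; the clause
  \<open>is_fun y \<alpha> two\<close> cuts the result down to a payoff set.\<close>

definition payoff_at :: "'v::zfc \<Rightarrow> 'v \<Rightarrow> 'v \<Rightarrow> 'v \<Rightarrow> 'v" where
  "payoff_at p \<mu> \<alpha> a = vsep (vlev \<mu>) (\<lambda>y. is_fun y \<alpha> two \<and> satisfies (vlev \<mu>) p (upd a vempty y))"

lemma elts_payoff_at:
  "elts (payoff_at p \<mu> \<alpha> a) = {y \<in> V \<mu>. is_fun y \<alpha> two \<and> satisfies (vlev \<mu>) p (upd a vempty y)}"
  unfolding payoff_at_def by (rule elts_vsep) (intro dint)

text \<open>Everything besides the play is packed into one set, so that reflection and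
  \<open>Df_relation\<close> have a single parameter to handle.\<close>

definition params :: "'v::zfc \<Rightarrow> 'v \<Rightarrow> 'v \<Rightarrow> 'v \<Rightarrow> 'v \<Rightarrow> 'v \<Rightarrow> 'v" where
  "params p b \<mu> n \<alpha> \<theta> = opair (opair p b) (opair (opair \<mu> n) (opair \<alpha> \<theta>))"

text \<open>Membership of the play \<open>z\<close> in the new payoff set. The set \<open>y\<close>
  is the tail of \<open>z\<close> from \<omega> on: its values on \<open>\<alpha>\<close> are
  prescribed, and elements of \<open>A\<close> are functions on \<open>\<alpha>\<close>.\<close>

definition real_first :: "'v::zfc \<Rightarrow> 'v \<Rightarrow> bool" where
  "real_first z W \<longleftrightarrow> (\<exists>p b \<mu> n \<alpha> \<theta> A. W = params p b \<mu> n \<alpha> \<theta> \<and> A = payoff_at p \<mu> \<alpha> (asg b n z) \<and>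
    is_fun z \<theta> two \<and> \<not> wins1 \<alpha> two A \<and> (\<exists>y\<in>elts A. \<forall>\<beta>\<in>elts \<alpha>. ap y \<beta> = ap z (oadd omega \<beta>)))"

lemma dfn_real_first [dint]:
  assumes "dterm P s" "dterm P t" shows "dfn P (\<lambda>e. real_first (s e) (t e))"
  by (rule dfn2I[OF _ assms], unfold real_first_def params_def payoff_at_def, intro dint)

lemma real_first_params:
  "real_first z (params p b \<mu> n \<alpha> \<theta>) \<longleftrightarrow> is_fun z \<theta> two \<and> \<not> wins1 \<alpha> two (payoff_at p \<mu> \<alpha> (asg b n z)) \<and>
    (\<exists>y\<in>elts (payoff_at p \<mu> \<alpha> (asg b n z)). \<forall>\<beta>\<in>elts \<alpha>. ap y \<beta> = ap z (oadd omega \<beta>))"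
  unfolding real_first_def params_def by simp

section \<open>Ordinal definability of the new payoff set\<close>

definition vcons :: "'v::zfc \<Rightarrow> 'v \<Rightarrow> 'v" where
  "vcons x a = vlam omega (\<lambda>i. if i = vempty then x else ap a (vUnion i))"

lemma
  shows fn_vcons: "fn (vcons x a) omega" and ap_vcons_vempty [simp]: "ap (vcons x a) vempty = x"
    and ap_vcons_vsucc [simp]: "i \<in> elts omega \<Longrightarrow> ap (vcons x a) (vsucc i) = ap a i"
proof -
  have d: "dterm UNIV (\<lambda>e. if e 0 = vempty then x else ap a (vUnion (e 0)))" by (intro dint)
  show "fn (vcons x a) omega" unfolding vcons_def by (rule fn_vlam[OF d])
  show "ap (vcons x a) vempty = x" unfolding vcons_def by (simp add: ap_vlam[OF d])
  show "i \<in> elts omega \<Longrightarrow> ap (vcons x a) (vsucc i) = ap a i"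
    unfolding vcons_def by (simp add: ap_vlam[OF d] vUnion_vsucc ordinal_of_omega)
qed

definition ord_seq :: "'v::zfc \<Rightarrow> 'v \<Rightarrow> bool" where
  "ord_seq n a \<longleftrightarrow> (\<forall>i\<in>elts omega. ordinal (ap a i) \<and> (i \<notin> elts n \<longrightarrow> ap a i = vempty))"

lemma ord_seq_vcons:
  assumes "n \<in> elts omega" "ordinal x" "ord_seq n a" shows "ord_seq (vsucc n) (vcons x a)"
  unfolding ord_seq_def
proof
  fix i :: 'a assume i: "i \<in> elts omega"
  have n: "ordinal n" using assms(1) by (rule ordinal_of_omega)
  from i show "ordinal (ap (vcons x a) i) \<and> (i \<notin> elts (vsucc n) \<longrightarrow> ap (vcons x a) i = vempty)"
  proof (cases rule: omega_cases)
    case 1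
    have "vempty \<in> elts (vsucc n)" using ordinal_subset_iff[OF ordinal_vempty n] by auto
    with 1 assms(2) show ?thesis by simp
  next
    case (2 m)
    have "m \<in> elts n \<Longrightarrow> i \<in> elts (vsucc n)" using vsucc_mem_vsucc[OF n] 2(2) by simp
    then show ?thesis using 2 assms(3) unfolding ord_seq_def by auto
  qed
qed

text \<open>The level \<open>M\<close> contains \<open>B\<close> and the ordinal parameters
  \<open>e\<close> and reflects \<open>real_first\<close>. Over \<open>M\<close> the set
  \<open>W\<close> is definable from \<open>e\<close>, so \<open>real_first z W\<close> turns into a
  formula about \<open>z\<close> and \<open>e\<close> alone. That formula is an object of the model
  and may be non-standard.\<close>

lemma ordinal_definable_real_first:
  fixes p b \<mu> n \<alpha> \<theta> :: "'v::zfc"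
  assumes p: "formula p" and b: "fn b omega" "ord_seq n b" and n: "n \<in> elts omega"
    and o: "ordinal \<mu>" "ordinal \<alpha>" "ordinal \<theta>"
    and B: "elts B = {z. real_first z (params p (restr b n) \<mu> n \<alpha> \<theta>)}"
  shows "ordinal_definable B"
proof -
  define W where "W = params p (restr b n) \<mu> n \<alpha> \<theta>"
  \<comment> \<open>Three zeros occupy the scratch variables of \<open>agree\<close>; then
    \<open>\<mu>\<close>, \<open>\<alpha>\<close> and \<open>\<theta>\<close> are variables 3 to 5,
    and the entries of \<open>b\<close> start at variable 6.\<close>
  define e where "e = vcons vempty (vcons vempty (vcons vempty (vcons \<mu> (vcons \<alpha> (vcons \<theta> b)))))"
  let ?k = "vsucc (vsucc (vsucc (vsucc (vsucc (vsucc n)))))"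
  let ?s = "\<lambda>i. vsucc (vsucc (vsucc (vsucc (vsucc (vsucc i)))))"
  have k: "?k \<in> elts omega" using n by simp
  have e_ord: "ord_seq ?k e"
    unfolding e_def using n o b by (intro ord_seq_vcons) simp_all
  have e_fn: "fn e omega" unfolding e_def by (rule fn_vcons)
  have "dfn {} (\<lambda>e. R (e 0) (e 1) (e 2))" if "R \<in> set ((\<lambda>z x y. real_first z x) # basic_rels)"
    for R :: "'v \<Rightarrow> 'v \<Rightarrow> 'v \<Rightarrow> bool"
    using that dfn_basic_rels by (auto intro: dfn_real_first dterm_var)
  from reflection_rel[where Rs = "(\<lambda>z x y. real_first z x) # basic_rels" and x = "opair e B", OF this]
  obtain \<nu> where l: "limit_ordinal \<nu>" "opair e B \<in> V \<nu>"
    and rels: "reflects_rel (vlev \<nu>) (\<lambda>z x y. real_first z x)"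
      "\<And>R. R \<in> set basic_rels \<Longrightarrow> reflects_rel (vlev \<nu>) R" by auto
  define M where "M = vlev \<nu>"
  have ol: "ordinal \<nu>" using l(1) by (rule limit_ordinal_ordinal)
  have eM: "e \<in> elts M" and BM: "B \<in> elts M" unfolding M_def using vlev_opairD[OF ol l(2)] .
  have e: "is_fun e omega M"
    unfolding is_fun_iff
  proof (intro conjI ballI, rule e_fn)
    fix i :: 'v assume "i \<in> elts omega"
    then have "opair i (ap e i) \<in> elts e" using fn_mem[OF e_fn] by simp
    then have "opair i (ap e i) \<in> elts M" using vlev_trans[OF ol] eM unfolding M_def by blast
    then show "ap e i \<in> elts M" using vlev_opairD[OF ol] unfolding M_def by blast
  qed
  note D = M_def l(1) rels(2)[folded M_def] e
  have vnats: "vnat 3 = (vsucc (vsucc (vsucc vempty)) :: 'v)" "vnat 4 = (vsucc (vnat 3) :: 'v)" "vnat 5 = (vsucc (vnat 4) :: 'v)"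
    by (simp_all add: eval_nat_numeral)
  have ae: "ap e (vnat 3) = \<mu>" "ap e (vnat 4) = \<alpha>" "ap e (vnat 5) = \<theta>"
    unfolding e_def vnats by simp_all
  have par: "Df M e (ap e (vnat 3))" "Df M e (ap e (vnat 4))" "Df M e (ap e (vnat 5))"
    by (rule Df_param[OF D], simp_all only: vnat_omega vnat_eq_iff not_False_eq_True; simp)+
  have bD: "Df M e (ap b i)" if i: "i \<in> elts omega" for i
  proof -
    have "ap e (?s i) = ap b i" unfolding e_def using i by simp
    moreover have "Df M e (ap e (?s i))" by (rule Df_param[OF D]) (simp_all add: i vnat2)
    ultimately show ?thesis by simp
  qed
  have W: "Df M e W"
    unfolding W_def params_def
    by (intro Df_opair[OF D] Df_formula[OF D p] Df_restr[OF D b(1) bD n] Df_omega[OF D n] par[unfolded ae])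
  obtain d where d: "formula d" "\<And>a. agree M e a \<Longrightarrow> satisfies M d a \<longleftrightarrow> real_first (ap a (vnat 0)) W"
    using Df_relation[OF W W rels(1)[folded M_def]] by blast
  have sat: "satisfies M d (upd e vempty x) \<longleftrightarrow> real_first x W" if "x \<in> elts M" for x
  proof -
    have "agree M e e" unfolding agree_def using e by blast
    from agree_upd[OF this that, of 0] d(2) show ?thesis
      by (simp add: ap_upd[OF e_fn])
  qed
  \<comment> \<open>\<open>M\<close> is transitive and contains \<open>B\<close>, so restricting to
    \<open>M\<close> loses no element of \<open>B\<close>.\<close>
  have "elts B = {x \<in> elts M. satisfies M d (upd e vempty x)}"
    using sat vlev_trans[OF ol] BM B unfolding W_def[symmetric] M_def by blast
  moreover have "ordinal (app e i)" "i \<notin> elts ?k \<longrightarrow> app e i = vempty" if "i \<in> elts omega" for i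
    using that e_ord unfolding ord_seq_def is_fun_app[OF e that] by blast+
  ultimately show ?thesis
    unfolding ordinal_definable_def definable_from_def
    using ol d(1) e k unfolding M_def
    by (intro exI[of _ \<nu>] exI[of _ d] exI[of _ e] exI[of _ ?k]) (simp add: Vlevel_eq)
qed

section \<open>Transfer of determinacy from the longer game\<close>

lemma determined_from_longer_game:
  fixes \<alpha> \<theta> :: "'v::zfc"
  assumes \<theta>: "ordinal \<theta>" and \<alpha>: "ordinal \<alpha>" and sub: "elts (oadd omega \<alpha>) \<subseteq> elts \<theta>"
    and det: "\<And>B. payoff_set \<theta> two B \<Longrightarrow> ordinal_definable B \<Longrightarrow> determined \<theta> two B"
    and A: "payoff_set \<alpha> two A" "ordinal_definable_from_reals A"
  shows "determined \<alpha> two A"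
proof (rule ccontr)
  assume "\<not> determined \<alpha> two A"
  then have no1: "\<not> wins1 \<alpha> two A" and no2: "\<not> wins2 \<alpha> two A" unfolding determined_iff[OF \<alpha>] by blast+
  obtain \<mu> p a n where \<mu>: "ordinal \<mu>" and p: "formula p" and a: "is_fun a omega (vlev \<mu>)"
    and par: "\<And>i. i \<in> elts omega \<Longrightarrow> ordinal (ap a i) \<or> real_number (ap a i)"
    and n: "n \<in> elts omega" and zero: "\<And>i. i \<in> elts omega \<Longrightarrow> i \<notin> elts n \<Longrightarrow> ap a i = vempty"
    and eA: "elts A = {x \<in> V \<mu>. satisfies (vlev \<mu>) p (upd a vempty x)}"
  proof -
    obtain \<mu> p a n where *: "ordinal \<mu>" "formula p" "is_fun a omega (Vlevel \<mu>)"
      "\<forall>i\<in>elts omega. ordinal (app a i) \<or> real_number (app a i)" "n \<in> elts omega"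
      "\<forall>i\<in>elts omega. i \<notin> elts n \<longrightarrow> app a i = vempty"
      "elts A = {x \<in> elts (Vlevel \<mu>). satisfies (Vlevel \<mu>) p (upd a vempty x)}"
      using A(2) unfolding ordinal_definable_from_reals_def definable_from_def by blast
    show ?thesis
    proof (rule that[of \<mu> p a n])
      show "ordinal (ap a i) \<or> real_number (ap a i)" if "i \<in> elts omega" for i
        using bspec[OF *(4) that] unfolding is_fun_app[OF *(3) that] .
      show "ap a i = vempty" if "i \<in> elts omega" "i \<notin> elts n" for i
        using *(6) that is_fun_app[OF *(3) that(1)] by simp
    qed (use *[unfolded Vlevel_eq[OF *(1)]] in simp_all)
  qed
  have afn: "fn a omega" using a by (rule is_fun_fn)
  have nw: "i \<in> elts omega" if "i \<in> elts n" for i using omega_trans[OF n] that by blast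
  \<comment> \<open>The successor keeps 0 free as the mark of a real. A parameter that is both an
    ordinal and a real is treated as an ordinal.\<close>
  define bf where "bf i = (if i \<in> elts n \<and> ordinal (ap a i) then vsucc (ap a i) else vempty)" for i
  have dbf: "dterm UNIV (\<lambda>e. bf (e 0))" unfolding bf_def by (intro dint)
  define b where "b = vlam omega bf"
  have b: "fn b omega" unfolding b_def by (rule fn_vlam[OF dbf])
  have apb: "ap b i = bf i" if "i \<in> elts omega" for i unfolding b_def by (rule ap_vlam[OF dbf that])
  have bseq: "ord_seq n b" unfolding ord_seq_def by (simp add: apb bf_def)
  define c where "c = restr b n"
  have apc: "ap c i = bf i" if "i \<in> elts n" for i
    unfolding c_def using ap_restr[OF b omega_trans[OF n] that] apb[OF nw[OF that]] by simp
  define W where "W = params p c \<mu> n \<alpha> \<theta>"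
  define B where "B = vsep (vfuns \<theta> two) (\<lambda>z. real_first z W)"
  have "elts B = {z \<in> elts (vfuns \<theta> two). real_first z W}"
    unfolding B_def by (rule elts_vsep) (intro dint)
  then have B: "elts B = {z. real_first z W}"
    unfolding W_def real_first_params elts_vfuns by blast
  have "payoff_set \<theta> two B" unfolding payoff_set_def B W_def real_first_params by blast
  moreover have "ordinal_definable B"
    by (rule ordinal_definable_real_first[OF p b bseq n \<mu> \<alpha> \<theta>]) (simp add: B W_def c_def)
  ultimately have "wins1 \<theta> two B \<or> wins2 \<theta> two B" using det determined_iff[OF \<theta>] by blast
  define af where "af z i = (if i \<in> elts n then
      (if ap c i = vempty then vsep omega (\<lambda>j. ap z (slot n i j) = vnat 1) else vUnion (ap c i)) else vempty)" for z i
  have daf: "dterm UNIV (\<lambda>e. af z (e 0))" for z unfolding af_def by (intro dint)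
  have asg: "asg c n z = vlam omega (af z)" for z unfolding asg_def af_def ..
  have asg_cong: "asg c n z = asg c n r" if "\<forall>i\<in>elts omega. ap z i = ap r i" for z r
  proof -
    have "vsep omega (\<lambda>j. ap z (slot n i j) = vnat 1) = vsep omega (\<lambda>j. ap r (slot n i j) = vnat 1)"
      if i: "i \<in> elts n" for i
    proof (rule extensionality)
      have d: "dfn UNIV (\<lambda>e. ap z (slot n i (e 0)) = vnat 1)" for z by (intro dint)
      show "elts (vsep omega (\<lambda>j. ap z (slot n i j) = vnat 1)) = elts (vsep omega (\<lambda>j. ap r (slot n i j) = vnat 1))"
        unfolding elts_vsep[OF d] using \<open>\<forall>i\<in>elts omega. ap z i = ap r i\<close> slot_omega[OF n i] by auto
    qed
    then show ?thesis unfolding asg by (intro vlam_cong[OF daf daf]) (simp add: af_def)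
  qed
  \<comment> \<open>The honest opening: the bits of the real parameters of \<open>A\<close>, each in
    its slot. All other moves, in particular those of the second player, are 0.\<close>
  define hf where "hf k = (if \<exists>i\<in>elts n. \<exists>j\<in>elts (ap a i). \<not> ordinal (ap a i) \<and> k = slot n i j then vnat 1 else vempty :: 'v)" for k
  have dhf: "dterm UNIV (\<lambda>e. hf (e 0))" unfolding hf_def by (intro dint)
  define h where "h = vlam omega hf"
  have h: "is_fun h omega two" unfolding h_def by (rule is_fun_vlam[OF dhf]) (simp add: hf_def del: One_nat_def)
  have real: "elts (ap a i) \<subseteq> elts omega" if "i \<in> elts n" "\<not> ordinal (ap a i)" for i
    using par[OF nw[OF that(1)]] that(2) unfolding real_number_def by blast
  have hslot: "ap h (slot n i j) = vnat 1 \<longleftrightarrow> j \<in> elts (ap a i)"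
    if i: "i \<in> elts n" and j: "j \<in> elts omega" and r: "\<not> ordinal (ap a i)" for i j
  proof -
    have "(\<exists>i'\<in>elts n. \<exists>j'\<in>elts (ap a i'). \<not> ordinal (ap a i') \<and> slot n i j = slot n i' j') \<longleftrightarrow> j \<in> elts (ap a i)"
    proof
      assume "\<exists>i'\<in>elts n. \<exists>j'\<in>elts (ap a i'). \<not> ordinal (ap a i') \<and> slot n i j = slot n i' j'"
      then obtain i' j' where *: "i' \<in> elts n" "j' \<in> elts (ap a i')" "\<not> ordinal (ap a i')" "slot n i j = slot n i' j'"
        by blast
      have "j' \<in> elts omega" using real[OF *(1,3)] *(2) by blast
      then show "j \<in> elts (ap a i)" using slot_inject[OF n i j *(1) _ *(4)] *(2) by blast
    qed (use i r in blast)
    then show ?thesis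
      unfolding h_def ap_vlam[OF dhf slot_omega[OF n i j]] hf_def by simp
  qed
  \<comment> \<open>Agreement with \<open>h\<close> is assumed on the slots only, because an opening
    produced by a strategy of the second player is known to follow \<open>h\<close> just at the
    first player's moves.\<close>
  have asg_a: "asg c n z = a" if z: "\<And>i j. i \<in> elts n \<Longrightarrow> j \<in> elts omega \<Longrightarrow> ap z (slot n i j) = ap h (slot n i j)" for z
    unfolding asg
  proof (rule fn_ext[OF fn_vlam[OF daf] afn])
    fix i :: 'v assume i: "i \<in> elts omega"
    have "af z i = ap a i"
    proof (cases "i \<in> elts n")
      case True
      show ?thesis
      proof (cases "ordinal (ap a i)")
        case False
        have d: "dfn UNIV (\<lambda>e. ap z (slot n i (e 0)) = vnat 1)" by (intro dint)
        have "elts (vsep omega (\<lambda>j. ap z (slot n i j) = vnat 1)) = elts (ap a i)"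
          unfolding elts_vsep[OF d] using z[OF True] hslot[OF True _ False] real[OF True False] by auto
        then have "vsep omega (\<lambda>j. ap z (slot n i j) = vnat 1) = ap a i" by (rule extensionality)
        then show ?thesis using True False unfolding af_def apc[OF True] bf_def by simp
      qed (use True in \<open>simp add: af_def apc bf_def vUnion_vsucc\<close>)
    qed (simp add: af_def zero[OF i])
    then show "ap (vlam omega (af z)) i = ap a i" by (simp add: ap_vlam[OF daf i])
  qed
  have pay_a: "payoff_at p \<mu> \<alpha> a = A"
    by (rule extensionality) (use A(1) eA in \<open>auto simp: elts_payoff_at payoff_set_def\<close>)
  have inB: "z \<in> elts B \<longleftrightarrow> is_fun z \<theta> two \<and> \<not> wins1 \<alpha> two (payoff_at p \<mu> \<alpha> (asg c n z)) \<and>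
    (\<exists>y\<in>elts (payoff_at p \<mu> \<alpha> (asg c n z)). \<forall>\<beta>\<in>elts \<alpha>. ap y \<beta> = ap z (oadd omega \<beta>))" for z
    unfolding B W_def by (simp add: real_first_params)
  have turn1: "\<forall>\<beta>::'v. ordinal \<beta> \<longrightarrow> first_turn (oadd omega \<beta>) = first_turn \<beta>"
    by (intro allI impI first_turn_oadd limit_omega)
  have turn2: "\<forall>\<beta>::'v. ordinal \<beta> \<longrightarrow> second_turn (oadd omega \<beta>) = second_turn \<beta>"
    using turn1 by (simp add: second_turn_iff_not_first)
  from \<open>wins1 \<theta> two B \<or> wins2 \<theta> two B\<close> show False
  proof
    assume "wins1 \<theta> two B"
    then obtain \<sigma> where \<sigma>: "is_fun \<sigma> (positions first_turn \<theta> two) two"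
      "\<And>x. is_fun x \<theta> two \<Longrightarrow> obeys first_turn \<theta> \<sigma> x \<Longrightarrow> x \<in> elts B" unfolding wins1_def by blast
    from strategy_tail[OF dfn_turns(1) turn1 \<theta> \<alpha> sub \<sigma>(1) h]
    obtain r \<tau> where \<tau>: "is_fun \<tau> (positions first_turn \<alpha> two) two"
      and tail: "\<forall>y. is_fun y \<alpha> two \<longrightarrow> obeys first_turn \<alpha> \<tau> y \<longrightarrow> (\<exists>z. is_fun z \<theta> two \<and> obeys first_turn \<theta> \<sigma> z \<and>
        (\<forall>i\<in>elts omega. ap z i = ap r i) \<and> (\<forall>\<beta>\<in>elts \<alpha>. ap z (oadd omega \<beta>) = ap y \<beta>))"
      by (elim exE conjE)
    let ?A = "payoff_at p \<mu> \<alpha> (asg c n r)"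
    \<comment> \<open>The opening \<open>r\<close> contains the reals chosen by
      \<open>\<sigma>\<close>, which may differ from those of \<open>A\<close>; the game that they
      define is \<open>?A\<close>. A play obeying \<open>\<tau>\<close> is the tail of a play won by
      \<open>\<sigma>\<close>, so it lies in \<open>?A\<close>, and the same win certifies that the
      first player has no winning strategy for \<open>?A\<close>.\<close>
    have *: "y \<in> elts ?A \<and> \<not> wins1 \<alpha> two ?A" if y: "is_fun y \<alpha> two" "obeys first_turn \<alpha> \<tau> y" for y
    proof -
      obtain z where z: "is_fun z \<theta> two" "obeys first_turn \<theta> \<sigma> z" "\<forall>i\<in>elts omega. ap z i = ap r i"
        "\<forall>\<beta>\<in>elts \<alpha>. ap z (oadd omega \<beta>) = ap y \<beta>" using tail[rule_format, OF y] by blast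
      have "z \<in> elts B" by (rule \<sigma>(2)[OF z(1,2)])
      then obtain y' where y': "y' \<in> elts ?A" "\<forall>\<beta>\<in>elts \<alpha>. ap y' \<beta> = ap z (oadd omega \<beta>)" and nw: "\<not> wins1 \<alpha> two ?A"
        unfolding inB asg_cong[OF z(3)] by blast
      have "y' = y"
      proof (rule fn_ext)
        show "fn y' \<alpha>" using y'(1) unfolding elts_payoff_at by (auto intro: is_fun_fn)
        show "fn y \<alpha>" using y(1) by (rule is_fun_fn)
      qed (use y'(2) z(4) in simp)
      with y'(1) nw show ?thesis by blast
    qed
    then have "wins1 \<alpha> two ?A" unfolding wins1_def using \<tau> by blast
    \<comment> \<open>The certificate comes only with an actual play obeying \<open>\<tau>\<close>;
      the run against constantly 0 provides one.\<close>
    moreover have d: "dterm UNIV (\<lambda>e :: nat \<Rightarrow> 'v. vempty)" by (intro dint)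
    ultimately show False
      using * run_play[OF dfn_turns(1) d vempty_two \<tau> \<alpha>] by blast
  next
    assume "wins2 \<theta> two B"
    then obtain \<sigma> where \<sigma>: "is_fun \<sigma> (positions second_turn \<theta> two) two"
      "\<And>x. is_fun x \<theta> two \<Longrightarrow> obeys second_turn \<theta> \<sigma> x \<Longrightarrow> x \<notin> elts B" unfolding wins2_def by blast
    from strategy_tail[OF dfn_turns(2) turn2 \<theta> \<alpha> sub \<sigma>(1) h]
    obtain r \<tau> where r: "\<forall>i\<in>elts omega. \<not> second_turn i \<longrightarrow> ap r i = ap h i"
      and \<tau>: "is_fun \<tau> (positions second_turn \<alpha> two) two"
      and tail: "\<forall>y. is_fun y \<alpha> two \<longrightarrow> obeys second_turn \<alpha> \<tau> y \<longrightarrow> (\<exists>z. is_fun z \<theta> two \<and> obeys second_turn \<theta> \<sigma> z \<and>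
        (\<forall>i\<in>elts omega. ap z i = ap r i) \<and> (\<forall>\<beta>\<in>elts \<alpha>. ap z (oadd omega \<beta>) = ap y \<beta>))"
      by (elim exE conjE)
    \<comment> \<open>Slots are moves of the first player, here the opponent of
      \<open>\<sigma>\<close>, so \<open>r\<close> carries the honest reals whatever
      \<open>\<sigma>\<close> does.\<close>
    have "ap r (slot n i j) = ap h (slot n i j)" if ij: "i \<in> elts n" "j \<in> elts omega" for i j
      using r slot_omega[OF n ij] first_turn_slot[OF n ij] second_turn_iff_not_first ordinal_of_omega by blast
    then have ra: "asg c n r = a" by (rule asg_a)
    have "y \<notin> elts A" if y: "is_fun y \<alpha> two" "obeys second_turn \<alpha> \<tau> y" for y
    proof
      assume yA: "y \<in> elts A"
      obtain z where z: "is_fun z \<theta> two" "obeys second_turn \<theta> \<sigma> z" "\<forall>i\<in>elts omega. ap z i = ap r i"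
        "\<forall>\<beta>\<in>elts \<alpha>. ap z (oadd omega \<beta>) = ap y \<beta>" using tail[rule_format, OF y] by blast
      have "z \<in> elts B"
        unfolding inB asg_cong[OF z(3)] ra pay_a using z(1,4) no1 yA by auto
      with \<sigma>(2)[OF z(1,2)] show False by blast
    qed
    then have "wins2 \<alpha> two A" unfolding wins2_def using \<tau> by blast
    with no2 show False by blast
  qed
qed

text \<open>These are the lengths for which \<omega> \<cdot> \<alpha> is shorter than \<omega> +
  \<alpha>. At most one move is made, by the first player, so he wins as soon as \<open>A\<close>
  contains a play, and otherwise every strategy of the second player wins.\<close>

lemma determined_short:
  assumes \<alpha>: "\<alpha> = vempty \<or> \<alpha> = (vsucc vempty :: 'v::zfc)" shows "determined \<alpha> two A"
proof -
  have o: "ordinal \<alpha>" using \<alpha> by auto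
  have d: "dterm UNIV (\<lambda>_ :: nat \<Rightarrow> 'v. x)" for x by (intro dint)
  have const: "is_fun (vlam (positions turn \<alpha> two) (\<lambda>_. x)) (positions turn \<alpha> two) two"
    if "x \<in> elts two" for turn and x :: 'v
    by (rule is_fun_vlam[OF d]) (rule that)
  show ?thesis
  proof (cases "\<exists>y\<in>elts A. is_fun y \<alpha> two")
    case True
    then obtain y where y: "y \<in> elts A" "is_fun y \<alpha> two" by blast
    let ?\<sigma> = "vlam (positions first_turn \<alpha> two) (\<lambda>_. ap y vempty)"
    have "x = y" if x: "is_fun x \<alpha> two" "obeys first_turn \<alpha> ?\<sigma> x" for x
    proof (rule fn_ext[OF is_fun_fn[OF x(1)] is_fun_fn[OF y(2)]])
      fix \<beta> assume b: "\<beta> \<in> elts \<alpha>"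
      then have 0: "\<beta> = vempty" using \<alpha> by auto
      then have t: "first_turn \<beta>" by (simp add: first_turn_limit)
      have "restr x \<beta> \<in> elts (positions first_turn \<alpha> two)"
        unfolding elts_positions[OF dfn_turns(1)] using b t is_fun_restr[OF x(1) ordinal_subset[OF o b]] by blast
      then show "ap x \<beta> = ap y \<beta>" using x(2) b t 0 unfolding obeys_def by (simp add: ap_vlam[OF d])
    qed
    then have "wins1 \<alpha> two A" unfolding wins1_def using const[OF ap_two[OF y(2)]] y(1) by blast
    then show ?thesis unfolding determined_iff[OF o] by blast
  next
    case False
    then have "wins2 \<alpha> two A" unfolding wins2_def using const[OF vempty_two] by blast
    then show ?thesis unfolding determined_iff[OF o] by blast
  qed
qed

theorem corollary6:
  fixes \<alpha> :: "'v::zfc"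
  assumes "ordinal \<alpha>"
  shows
    "((\<forall>A. payoff_set (ord_add omega \<alpha>) (upair (vnat 0) (vnat 1)) A \<longrightarrow> ordinal_definable A \<longrightarrow>
         determined (ord_add omega \<alpha>) (upair (vnat 0) (vnat 1)) A) \<longrightarrow>
      (\<forall>A. payoff_set \<alpha> (upair (vnat 0) (vnat 1)) A \<longrightarrow> ordinal_definable_from_reals A \<longrightarrow>
         determined \<alpha> (upair (vnat 0) (vnat 1)) A)) \<and>
     ((\<forall>A. payoff_set (ord_mult omega \<alpha>) (upair (vnat 0) (vnat 1)) A \<longrightarrow> ordinal_definable A \<longrightarrow>
         determined (ord_mult omega \<alpha>) (upair (vnat 0) (vnat 1)) A) \<longrightarrow>
      (\<forall>A. payoff_set \<alpha> (upair (vnat 0) (vnat 1)) A \<longrightarrow> ordinal_definable_from_reals A \<longrightarrow>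
         determined \<alpha> (upair (vnat 0) (vnat 1)) A))"
  unfolding two_def[symmetric] ord_add_eq[OF assms] ord_mult_eq[OF ordinal_omega assms]
proof (intro conjI impI allI)
  fix A
  assume "\<forall>A. payoff_set (oadd omega \<alpha>) two A \<longrightarrow> ordinal_definable A \<longrightarrow> determined (oadd omega \<alpha>) two A"
    and "payoff_set \<alpha> two A" "ordinal_definable_from_reals A"
  then show "determined \<alpha> two A"
    by (intro determined_from_longer_game[of "oadd omega \<alpha>" \<alpha>]) (simp_all add: assms)
next
  fix A
  assume *: "\<forall>A. payoff_set (omult omega \<alpha>) two A \<longrightarrow> ordinal_definable A \<longrightarrow> determined (omult omega \<alpha>) two A"
    "payoff_set \<alpha> two A" "ordinal_definable_from_reals A"
  show "determined \<alpha> two A"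
  proof (cases "\<alpha> = vempty \<or> \<alpha> = vsucc vempty")
    case False
    with * show ?thesis
      by (intro determined_from_longer_game[of "omult omega \<alpha>" \<alpha>])
        (simp_all add: assms omega_oadd_subset_omult)
  qed (rule determined_short)
qed

end
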